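(* Let $S\geq 0$ be a random variable such that $S^2\in\mathbb{D}^{1,2}$, and let $\eta\sim\mathcal{N}(0,1)$ be independent of the underlying isonormal Gaussian process $X$. Let $\{F_n\}$ be a sequence of random variables in $\mathbb{D}^{1,2}$ such that $E[F_n]=0$ and $F_n=\delta(u_n)$, where $u_n\in\mathbb{D}^{1,2}(\mathfrak{H})$. Assume that the following conditions hold as $n\to\infty$: 1. $\langle u_n,DF_n\rangle_{\mathfrak{H}}\to S^2$ in $L^1(\Omega)$; 2. $\langle u_n,h\rangle_{\mathfrak{H}}\to 0$ in $L^1(\Omega)$, for every $h\in\mathfrak{H}$; 3. $\langle u_n,DS^2\rangle_{\mathfrak{H}}\to 0$ in $L^1(\Omega)$. Then $F_n$ converges stably to $S\eta$. Moreover, for every $\varphi:\mathbb{R}\to\mathbb{R}$ of class $C^3$ with bounded second and third derivatives and every $n$, $$\bigl|E[\varphi(F_n)]-E[\varphi(S\eta)]\bigr|\leq \frac12\|\varphi''\|_\infty E\bigl[|\langle u_n,DF_n\rangle_{\mathfrak{H}}-S^2|\bigr]+\frac13\|\varphi'''\|_\infty E\bigl[|\langle u_n,DS^2\rangle_{\mathfrak{H}}|\bigr].$$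
   Context: $\mathfrak{H}$ is a real separable infinite-dimensional Hilbert space and $X=\{X(h):h\in\mathfrak{H}\}$ is an isonormal Gaussian process over $\mathfrak{H}$ on a probability space $(\Omega,\mathcal{F},P)$: a centered Gaussian family with $E[X(h)X(g)]=\langle h,g\rangle_{\mathfrak{H}}$; $\mathcal{F}$ is the $P$-completion of $\sigma(X)$. $D$ is the Malliavin derivative with respect to $X$; $\mathbb{D}^{k,p}(V)$ is the usual Malliavin--Sobolev space of $V$-valued random variables ($\mathbb{D}^{k,p}=\mathbb{D}^{k,p}(\mathbb{R})$). $\delta$ is the adjoint of $D$ (divergence operator, or Skorohod integral). The random variable $\eta$ is defined on an extension of the probability space, and $S$ is $\mathcal{F}$-measurable. Stable convergence: real random variables $F_n$ on $(\Omega,\mathcal{F},P)$ converge stably to $F$, defined on an extended probability space $(\Omega',\mathcal{F}',P')$, if $\lim_{n}E[Ze^{i\lambda F_n}]=E'[Ze^{i\lambda F}]$ for every $\lambda\in\mathbb{R}$ and every bounded $\mathcal{F}$-measurable random variable $Z$. *)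

theory Defs
  imports "HOL-Probability.Probability"
begin

definition Lp :: "nat \<Rightarrow> 'a measure \<Rightarrow> ('a \<Rightarrow> 'v::{banach, second_countable_topology}) set" where
  "Lp p M = {f \<in> borel_measurable M. integrable M (\<lambda>\<omega>. norm (f \<omega>) ^ p)}"

definition tendsto_Lp ::
  "nat \<Rightarrow> 'a measure \<Rightarrow> (nat \<Rightarrow> 'a \<Rightarrow> 'v::{banach, second_countable_topology}) \<Rightarrow> ('a \<Rightarrow> 'v) \<Rightarrow> bool"
where
  "tendsto_Lp p M Y L \<longleftrightarrow>
     (\<forall>n. Y n \<in> Lp p M) \<and> L \<in> Lp p M \<and>
     (\<lambda>n. \<integral>\<omega>. norm (Y n \<omega> - L \<omega>) ^ p \<partial>M) \<longlonglongrightarrow> 0"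

text \<open>A random variable \<open>Z\<close> on \<open>M\<close> is regarded as the random variable \<open>\<lambda>\<omega>. Z (\<pi> \<omega>)\<close> on the
  extension \<open>M'\<close>.\<close>

definition extension_of :: "'b measure \<Rightarrow> ('b \<Rightarrow> 'a) \<Rightarrow> 'a measure \<Rightarrow> bool" where
  "extension_of M' \<pi> M \<longleftrightarrow> prob_space M' \<and> \<pi> \<in> measurable M' M \<and> distr M' M \<pi> = M"

definition converges_stably ::
  "'a measure \<Rightarrow> (nat \<Rightarrow> 'a \<Rightarrow> real) \<Rightarrow> 'b measure \<Rightarrow> ('b \<Rightarrow> 'a) \<Rightarrow> ('b \<Rightarrow> real) \<Rightarrow> bool"
where
  "converges_stably M F M' \<pi> G \<longleftrightarrow>
     (\<forall>t::real. \<forall>Z \<in> borel_measurable M. (\<exists>c::real. \<forall>\<omega>. \<bar>Z \<omega>\<bar> \<le> c) \<longrightarrow>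
        (\<lambda>n. \<integral>\<omega>. complex_of_real (Z \<omega>) * iexp (t * F n \<omega>) \<partial>M)
          \<longlonglongrightarrow> (\<integral>\<omega>. complex_of_real (Z (\<pi> \<omega>)) * iexp (t * G \<omega>) \<partial>M'))"

text \<open>The degenerate case is needed because \<^const>\<open>normal_density\<close> is identically zero
  for standard deviation zero.\<close>

definition normal_law :: "real \<Rightarrow> real \<Rightarrow> real measure" where
  "normal_law \<mu> \<sigma> =
     (if \<sigma> = 0 then return borel \<mu> else density lborel (\<lambda>x. ennreal (normal_density \<mu> \<sigma> x)))"

text \<open>The first two conditions say that \<open>X\<close> is a centered (jointly) Gaussian family.\<close>

definition isonormal_process :: "'a measure \<Rightarrow> ('h::real_inner \<Rightarrow> 'a \<Rightarrow> real) \<Rightarrow> bool" where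
  "isonormal_process M X \<longleftrightarrow>
     (\<forall>h. X h \<in> borel_measurable M) \<and>
     (\<forall>B c. finite B \<longrightarrow>
        (\<exists>\<sigma>\<ge>0. distr M borel (\<lambda>\<omega>. \<Sum>h\<in>B. c h * X h \<omega>) = normal_law 0 \<sigma>)) \<and>
     (\<forall>h g. (\<integral>\<omega>. X h \<omega> * X g \<omega> \<partial>M) = h \<bullet> g)"

definition generated_sigma :: "'a measure \<Rightarrow> ('h \<Rightarrow> 'a \<Rightarrow> real) \<Rightarrow> 'a measure" where
  "generated_sigma M X = sigma (space M) {X h -` A \<inter> space M | h A. A \<in> sets borel}"

definition completion_of_generated :: "'a measure \<Rightarrow> ('h \<Rightarrow> 'a \<Rightarrow> real) \<Rightarrow> bool" where
  "completion_of_generated M X \<longleftrightarrow>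
     sets M = sets (completion (restr_to_subalg M (generated_sigma M X)))"

text \<open>A function on \<open>\<real>\<^sup>n\<close> is a function on real sequences that only depends on the coordinates
  below \<open>n\<close>. For such functions, continuity in the product topology on sequences is continuity
  on \<open>\<real>\<^sup>n\<close>, and the partial derivatives in the remaining directions vanish.\<close>

definition partial_deriv :: "nat \<Rightarrow> ((nat \<Rightarrow> real) \<Rightarrow> real) \<Rightarrow> (nat \<Rightarrow> real) \<Rightarrow> real" where
  "partial_deriv i f x = deriv (\<lambda>t. f (x(i := t))) (x i)"

definition partial_derivs :: "nat list \<Rightarrow> ((nat \<Rightarrow> real) \<Rightarrow> real) \<Rightarrow> (nat \<Rightarrow> real) \<Rightarrow> real" where
  "partial_derivs is f = foldr partial_deriv is f"

text \<open>The class \<open>C\<^sub>p\<^sup>\<infinity>(\<real>\<^sup>n)\<close>: partial derivatives of all orders exist, are continuous, and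
  have at most polynomial growth (the empty list gives \<open>f\<close> itself).\<close>

definition smooth_poly_growth :: "nat \<Rightarrow> ((nat \<Rightarrow> real) \<Rightarrow> real) \<Rightarrow> bool" where
  "smooth_poly_growth n f \<longleftrightarrow>
     (\<forall>x y. (\<forall>i<n. x i = y i) \<longrightarrow> f x = f y) \<and>
     (\<forall>is. continuous_on UNIV (partial_derivs is f) \<and>
           (\<forall>i x. (\<lambda>t. partial_derivs is f (x(i := t))) differentiable (at (x i))) \<and>
           (\<exists>C N. \<forall>x. \<bar>partial_derivs is f x\<bar> \<le> C * (1 + (\<Sum>i<n. \<bar>x i\<bar>)) ^ N))"

text \<open>\<open>F = f (X h\<^sub>0, \<dots>, X h\<^sub>n\<^sub>-\<^sub>1)\<close> and \<open>G = DF\<close>.\<close>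

definition smooth_cylindrical ::
  "('h::real_inner \<Rightarrow> 'a \<Rightarrow> real) \<Rightarrow> ('a \<Rightarrow> real) \<Rightarrow> ('a \<Rightarrow> 'h) \<Rightarrow> bool"
where
  "smooth_cylindrical X F G \<longleftrightarrow>
     (\<exists>n f h. smooth_poly_growth n f \<and>
        F = (\<lambda>\<omega>. f (\<lambda>j. X (h j) \<omega>)) \<and>
        G = (\<lambda>\<omega>. \<Sum>i<n. partial_deriv i f (\<lambda>j. X (h j) \<omega>) *\<^sub>R h i))"

text \<open>The graph of the closure of \<open>D\<close> as an operator from \<open>L\<^sup>2(\<Omega>)\<close> to \<open>L\<^sup>2(\<Omega>; H)\<close>.\<close>

definition has_malliavin_deriv ::
  "'a measure \<Rightarrow> ('h::{real_inner, banach, second_countable_topology} \<Rightarrow> 'a \<Rightarrow> real) \<Rightarrow>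
   ('a \<Rightarrow> real) \<Rightarrow> ('a \<Rightarrow> 'h) \<Rightarrow> bool"
where
  "has_malliavin_deriv M X F G \<longleftrightarrow>
     (\<exists>Fs Gs. (\<forall>k. smooth_cylindrical X (Fs k) (Gs k)) \<and>
        tendsto_Lp 2 M Fs F \<and> tendsto_Lp 2 M Gs G)"

definition D12 ::
  "'a measure \<Rightarrow> ('h::{real_inner, banach, second_countable_topology} \<Rightarrow> 'a \<Rightarrow> real) \<Rightarrow>
   ('a \<Rightarrow> real) set"
where
  "D12 M X = {F. \<exists>G. has_malliavin_deriv M X F G}"

text \<open>By closability, the derivative is determined up to almost sure equality; this picks a
  version of it.\<close>

definition malliavin_D ::
  "'a measure \<Rightarrow> ('h::{real_inner, banach, second_countable_topology} \<Rightarrow> 'a \<Rightarrow> real) \<Rightarrow>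
   ('a \<Rightarrow> real) \<Rightarrow> 'a \<Rightarrow> 'h"
where
  "malliavin_D M X F = (SOME G. has_malliavin_deriv M X F G)"

text \<open>The Hilbert tensor product \<open>H \<otimes> V\<close> is realised as the space of Hilbert-Schmidt operators
  from \<open>H\<close> to \<open>V\<close>, with \<open>g \<otimes> v\<close> acting as \<open>\<lambda>h. (g \<bullet> h) *\<^sub>R v\<close>. For a bounded operator \<open>T\<close>, the
  supremum below is the sum of \<open>(norm (T e))\<^sup>2\<close> over any orthonormal basis of \<open>H\<close>.\<close>

definition hs_norm_sq :: "('h::real_inner \<Rightarrow> 'v::real_inner) \<Rightarrow> ennreal" where
  "hs_norm_sq T =
     (SUP B \<in> {B. finite B \<and> pairwise orthogonal B \<and> (\<forall>e\<in>B. norm e = 1)}.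
        \<Sum>e\<in>B. ennreal ((norm (T e))\<^sup>2))"

text \<open>\<open>U = \<Sum>\<^sub>j F\<^sub>j v\<^sub>j\<close> and \<open>T = DU = \<Sum>\<^sub>j DF\<^sub>j \<otimes> v\<^sub>j\<close>.\<close>

definition smooth_cylindrical_vec ::
  "('h::real_inner \<Rightarrow> 'a \<Rightarrow> real) \<Rightarrow> ('a \<Rightarrow> 'v::real_inner) \<Rightarrow> ('a \<Rightarrow> 'h \<Rightarrow> 'v) \<Rightarrow> bool"
where
  "smooth_cylindrical_vec X U T \<longleftrightarrow>
     (\<exists>m F G v. (\<forall>j<m::nat. smooth_cylindrical X (F j) (G j)) \<and>
        U = (\<lambda>\<omega>. \<Sum>j<m. F j \<omega> *\<^sub>R v j) \<and>
        T = (\<lambda>\<omega> h. \<Sum>j<m. (G j \<omega> \<bullet> h) *\<^sub>R v j))"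

definition has_malliavin_deriv_vec ::
  "'a measure \<Rightarrow> ('h::{real_inner, banach, second_countable_topology} \<Rightarrow> 'a \<Rightarrow> real) \<Rightarrow>
   ('a \<Rightarrow> 'v::{real_inner, banach, second_countable_topology}) \<Rightarrow> ('a \<Rightarrow> 'h \<Rightarrow> 'v) \<Rightarrow> bool"
where
  "has_malliavin_deriv_vec M X U T \<longleftrightarrow>
     (\<forall>\<omega>. bounded_linear (T \<omega>)) \<and> (\<forall>h. (\<lambda>\<omega>. T \<omega> h) \<in> borel_measurable M) \<and>
     (\<exists>Us Ts. (\<forall>k. smooth_cylindrical_vec X (Us k) (Ts k)) \<and>
        tendsto_Lp 2 M Us U \<and>
        (\<lambda>k. \<integral>\<^sup>+\<omega>. hs_norm_sq (\<lambda>h. Ts k \<omega> h - T \<omega> h) \<partial>M) \<longlonglongrightarrow> 0)"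

definition D12_vec ::
  "'a measure \<Rightarrow> ('h::{real_inner, banach, second_countable_topology} \<Rightarrow> 'a \<Rightarrow> real) \<Rightarrow>
   ('a \<Rightarrow> 'v::{real_inner, banach, second_countable_topology}) set"
where
  "D12_vec M X = {U. \<exists>T. has_malliavin_deriv_vec M X U T}"

text \<open>The graph of the adjoint of \<open>D\<close>: \<open>u\<close> is in the domain of \<open>\<delta>\<close> and \<open>\<delta>(u) = d\<close> almost surely.\<close>

definition has_divergence ::
  "'a measure \<Rightarrow> ('h::{real_inner, banach, second_countable_topology} \<Rightarrow> 'a \<Rightarrow> real) \<Rightarrow>
   ('a \<Rightarrow> 'h) \<Rightarrow> ('a \<Rightarrow> real) \<Rightarrow> bool"
where
  "has_divergence M X u d \<longleftrightarrow>
     u \<in> Lp 2 M \<and> d \<in> Lp 2 M \<and>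
     (\<forall>F G. has_malliavin_deriv M X F G \<longrightarrow>
        (\<integral>\<omega>. F \<omega> * d \<omega> \<partial>M) = (\<integral>\<omega>. G \<omega> \<bullet> u \<omega> \<partial>M))"

definition class_C :: "nat \<Rightarrow> (real \<Rightarrow> real) \<Rightarrow> bool" where
  "class_C k f \<longleftrightarrow>
     (\<forall>j<k. \<forall>x. (deriv ^^ j) f differentiable (at x)) \<and> continuous_on UNIV ((deriv ^^ k) f)"

definition sup_norm :: "(real \<Rightarrow> real) \<Rightarrow> real" where
  "sup_norm f = (SUP x. \<bar>f x\<bar>)"

end

theory Submission
  imports Defs
begin

text \<open>Interpolate along \<open>Y\<^sub>\<theta> = W + sin \<theta> F + cos \<theta> \<surd>(S\<^sup>2 + \<epsilon>) y\<close>, \<open>0 \<le> \<theta> \<le> \<pi>/2\<close>, on the product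
  of \<open>\<Omega>\<close> with a standard Gaussian variable \<open>y\<close>. Duality between \<open>D\<close> and \<open>\<delta>\<close> (for fixed \<open>y\<close>) and
  Gaussian integration by parts (for fixed \<open>\<omega>\<close>) turn the \<open>\<theta>\<close>-derivative of \<open>E \<phi>(Y\<^sub>\<theta>)\<close> into
  \<open>cos \<theta> E[\<phi>''(Y\<^sub>\<theta>) \<langle>u, DW\<rangle>] + sin \<theta> cos \<theta> E[\<phi>''(Y\<^sub>\<theta>) (\<langle>u, DF\<rangle> - S\<^sup>2 - \<epsilon>)] +
  cos\<^sup>3 \<theta> / 2 E[\<phi>'''(Y\<^sub>\<theta>) \<langle>u, DS\<^sup>2\<rangle>]\<close>. With \<open>W = 0\<close> and \<open>\<epsilon> \<rightarrow> 0\<close>, integration over \<open>\<theta>\<close> gives the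
  quantitative bound. For stable convergence take \<open>\<phi> = cos, sin\<close> and for \<open>W\<close> finite sums of smooth
  functions of the \<open>X(h)\<close>: then \<open>\<langle>u\<^sub>n, DW\<rangle> \<rightarrow> 0\<close> in \<open>L\<^sup>1\<close> by the second condition, which yields
  convergence tested against \<open>exp(i W)\<close>, and these variables determine all bounded measurable ones.
  Only linearity of \<open>D\<close> and the one-variable \<open>C\<^sup>1\<close> chain rule are needed.\<close>

section \<open>Smooth functions of polynomial growth\<close>

text \<open>The square root is singular at 0 and differentiability is assumed only for
  \<open>S^2\<close>, which is why the path contains \<open>S^2 + \<epsilon>\<close>. Its derivative
  brings in the factor 1/(2 sqrt(S^2 + \<epsilon>)), but Gaussian integration by parts returns
  exactly sqrt(S^2 + \<epsilon>); the third-order term therefore keeps only half of the inner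
  product of \<open>u\<close> with \<open>DS^2\<close>, and the bound survives \<epsilon>
  \<rightarrow> 0. A path with weights sqrt(t) and sqrt(1 - t) would have infinite speed at its
  ends; with the angle the speed is dominated independently of \<theta>, and the constants 1/2 and
  1/3 are the integrals of sin cos and of cos^3/2 over [0, pi/2]. For frozen \<open>y\<close> the
  point on the path is a linear combination, so the only nonlinear maps to be differentiated are the
  square root and \<phi>', which has the bounded derivative \<phi>''. The main work on the Malliavin
  side is that such maps are only C^1, while the approximating functionals must have derivatives of
  all orders with polynomial growth. The derivative is handled as the relation
  \<open>has_malliavin_deriv\<close>: the duality in \<open>has_divergence\<close> may be applied to
  any pair of the graph that has been constructed.\<close>

definition tame :: "nat \<Rightarrow> ((nat \<Rightarrow> real) \<Rightarrow> real) \<Rightarrow> bool" where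
  "tame n f \<longleftrightarrow>
     (\<forall>x y. (\<forall>i<n. x i = y i) \<longrightarrow> f x = f y) \<and>
     continuous_on UNIV f \<and>
     (\<forall>i x. (\<lambda>t. f (x(i := t))) differentiable (at (x i))) \<and>
     (\<exists>C N. \<forall>x. \<bar>f x\<bar> \<le> C * (1 + (\<Sum>i<n. \<bar>x i\<bar>)) ^ N)"

lemma partial_deriv_cong:
  assumes "\<And>x y. (\<forall>i<n. x i = y i) \<Longrightarrow> f x = f y" and "\<forall>i<n. x i = y i"
  shows "partial_deriv j f x = partial_deriv j f y"
proof (cases "j < n")
  case True
  then show ?thesis
    using assms by (auto simp: partial_deriv_def intro!: arg_cong2[of _ _ _ _ deriv] assms(1))
next
  case False
  then have "f (z(j := t)) = f z" for z t
    by (intro assms(1)) auto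
  then show ?thesis
    by (simp add: partial_deriv_def)
qed

text \<open>Separates the iteration over derivative lists from the conditions on one function, so
  that closure properties can be checked for one function at a time. Dependence on the first
  \<open>n\<close> coordinates, required of \<open>f\<close> alone on the left, passes to its
  derivatives by \<open>partial_deriv_cong\<close>.\<close>

lemma smooth_poly_growth_iff_tame:
  "smooth_poly_growth n f \<longleftrightarrow> (\<forall>is. tame n (partial_derivs is f))"
proof
  assume *: "smooth_poly_growth n f"
  have "(\<forall>i<n. x i = y i) \<Longrightarrow> partial_derivs is f x = partial_derivs is f y" for "is" x y
  proof (induction "is" arbitrary: x y)
    case Nil
    then show ?case using * by (simp add: partial_derivs_def smooth_poly_growth_def)
  next
    case (Cons j "is")
    from partial_deriv_cong[of n "partial_derivs is f", OF Cons.IH Cons.prems]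
    show ?case by (simp add: partial_derivs_def)
  qed
  with * show "\<forall>is. tame n (partial_derivs is f)"
    unfolding smooth_poly_growth_def tame_def by blast
next
  assume *: "\<forall>is. tame n (partial_derivs is f)"
  moreover have "\<forall>x y. (\<forall>i<n. x i = y i) \<longrightarrow> f x = f y"
    using *[rule_format, of "[]"] by (simp add: partial_derivs_def tame_def)
  ultimately show "smooth_poly_growth n f"
    unfolding smooth_poly_growth_def tame_def by blast
qed

text \<open>Higher derivatives of a composite have no convenient closed form. An algebra, however,
  is closed under differentiation as soon as the derivatives of its generators lie in it, which
  replaces explicit formulas.\<close>

inductive_set function_algebra :: "(('b \<Rightarrow> real)) set \<Rightarrow> ('b \<Rightarrow> real) set" for B where
  base: "f \<in> B \<Longrightarrow> f \<in> function_algebra B"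
| const: "(\<lambda>x. c) \<in> function_algebra B"
| add: "f \<in> function_algebra B \<Longrightarrow> g \<in> function_algebra B \<Longrightarrow> (\<lambda>x. f x + g x) \<in> function_algebra B"
| mult: "f \<in> function_algebra B \<Longrightarrow> g \<in> function_algebra B \<Longrightarrow> (\<lambda>x. f x * g x) \<in> function_algebra B"

lemma growth_add:
  fixes s :: "'b \<Rightarrow> real"
  assumes "\<And>x. 0 \<le> s x" "\<And>x. \<bar>f x\<bar> \<le> C * (1 + s x) ^ N" "\<And>x. \<bar>g x\<bar> \<le> D * (1 + s x) ^ K"
  shows "\<bar>f x + g x\<bar> \<le> (\<bar>C\<bar> + \<bar>D\<bar>) * (1 + s x) ^ (N + K)"
proof -
  have "\<bar>f x\<bar> \<le> \<bar>C\<bar> * (1 + s x) ^ (N + K)"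
    using assms(1)[of x]
    by (intro order_trans[OF assms(2)] mult_mono power_increasing) auto
  moreover have "\<bar>g x\<bar> \<le> \<bar>D\<bar> * (1 + s x) ^ (N + K)"
    using assms(1)[of x]
    by (intro order_trans[OF assms(3)] mult_mono power_increasing) auto
  ultimately show ?thesis by (simp add: ring_distribs)
qed

lemma growth_mult:
  fixes s :: "'b \<Rightarrow> real"
  assumes "\<And>x. \<bar>f x\<bar> \<le> C * (1 + s x) ^ N" "\<And>x. \<bar>g x\<bar> \<le> D * (1 + s x) ^ K"
  shows "\<bar>f x * g x\<bar> \<le> (C * D) * (1 + s x) ^ (N + K)"
proof -
  have "\<bar>f x\<bar> * \<bar>g x\<bar> \<le> (C * (1 + s x) ^ N) * (D * (1 + s x) ^ K)"
    using assms by (intro mult_mono) (auto intro: order_trans[OF abs_ge_zero])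
  then show ?thesis by (simp add: abs_mult power_add algebra_simps)
qed

lemma tame_const: "tame n (\<lambda>x. c)"
  unfolding tame_def by (intro conjI allI exI[of _ 0] exI[of _ "\<bar>c\<bar>"]) auto

lemma tame_add:
  assumes "tame n f" "tame n g"
  shows "tame n (\<lambda>x. f x + g x)"
proof -
  obtain C N D K where "\<And>x. \<bar>f x\<bar> \<le> C * (1 + (\<Sum>i<n. \<bar>x i\<bar>)) ^ N"
    "\<And>x. \<bar>g x\<bar> \<le> D * (1 + (\<Sum>i<n. \<bar>x i\<bar>)) ^ K"
    using assms unfolding tame_def by meson
  then have "\<And>x. \<bar>f x + g x\<bar> \<le> (\<bar>C\<bar> + \<bar>D\<bar>) * (1 + (\<Sum>i<n. \<bar>x i\<bar>)) ^ (N + K)"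
    by (intro growth_add[where s="\<lambda>x. \<Sum>i<n. \<bar>x i\<bar>"]) (auto intro: sum_nonneg)
  then have "\<exists>C N. \<forall>x. \<bar>f x + g x\<bar> \<le> C * (1 + (\<Sum>i<n. \<bar>x i\<bar>)) ^ N" by blast
  moreover have "\<forall>x y. (\<forall>i<n. x i = y i) \<longrightarrow> f x + g x = f y + g y"
    using assms unfolding tame_def by metis
  ultimately show ?thesis
    using assms unfolding tame_def
    by (intro conjI allI continuous_on_add continuous_on_mult differentiable_add differentiable_mult) blast+
qed

lemma tame_mult:
  assumes "tame n f" "tame n g"
  shows "tame n (\<lambda>x. f x * g x)"
proof -
  obtain C N D K where "\<And>x. \<bar>f x\<bar> \<le> C * (1 + (\<Sum>i<n. \<bar>x i\<bar>)) ^ N"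
    "\<And>x. \<bar>g x\<bar> \<le> D * (1 + (\<Sum>i<n. \<bar>x i\<bar>)) ^ K"
    using assms unfolding tame_def by meson
  then have "\<And>x. \<bar>f x * g x\<bar> \<le> (C * D) * (1 + (\<Sum>i<n. \<bar>x i\<bar>)) ^ (N + K)"
    by (rule growth_mult[where s="\<lambda>x. \<Sum>i<n. \<bar>x i\<bar>"])
  then have "\<exists>C N. \<forall>x. \<bar>f x * g x\<bar> \<le> C * (1 + (\<Sum>i<n. \<bar>x i\<bar>)) ^ N" by blast
  moreover have "\<forall>x y. (\<forall>i<n. x i = y i) \<longrightarrow> f x * g x = f y * g y"
    using assms unfolding tame_def by metis
  ultimately show ?thesis
    using assms unfolding tame_def
    by (intro conjI allI continuous_on_add continuous_on_mult differentiable_add differentiable_mult) blast+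
qed

lemma tame_has_partial:
  assumes "tame n f"
  shows "((\<lambda>t. f (x(i := t))) has_real_derivative partial_deriv i f x) (at (x i))"
  using assms unfolding tame_def partial_deriv_def
  by (simp add: DERIV_deriv_iff_real_differentiable)

lemma partial_deriv_eqI:
  assumes "\<And>x. ((\<lambda>t. f (x(i := t))) has_real_derivative f' x) (at (x i))"
  shows "partial_deriv i f = f'"
  unfolding partial_deriv_def using DERIV_imp_deriv[OF assms] by auto

text \<open>Sum and product rule, by induction on the generation. The two claims are proved together
  because these rules use the differentiability contained in \<open>tame\<close>.\<close>

lemma function_algebra_closed:
  assumes "\<And>g. g \<in> B \<Longrightarrow> tame n g"
    and "\<And>g i. g \<in> B \<Longrightarrow> partial_deriv i g \<in> function_algebra B"
    and "g \<in> function_algebra B"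
  shows "tame n g \<and> partial_deriv i g \<in> function_algebra B"
  using assms(3)
proof (induction)
  case (base f)
  then show ?case using assms by auto
next
  case (const c)
  have "partial_deriv i (\<lambda>x. c) = (\<lambda>x. 0)" by (simp add: partial_deriv_def fun_eq_iff)
  then show ?case by (auto simp: tame_const intro: function_algebra.const)
next
  case (add f g)
  then have "partial_deriv i (\<lambda>x. f x + g x) = (\<lambda>x. partial_deriv i f x + partial_deriv i g x)"
    using tame_has_partial by (intro partial_deriv_eqI DERIV_add) blast+
  with add show ?case by (auto intro: tame_add function_algebra.add)
next
  case (mult f g)
  then have "partial_deriv i (\<lambda>x. f x * g x) =
      (\<lambda>x. partial_deriv i f x * g x + partial_deriv i g x * f x)"
    using tame_has_partial by (intro partial_deriv_eqI DERIV_mult[THEN DERIV_cong]) (blast | simp)+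
  with mult show ?case by (auto intro!: tame_mult function_algebra.add function_algebra.mult)
qed

lemma smooth_poly_growth_algebra:
  assumes "\<And>g. g \<in> B \<Longrightarrow> tame n g"
    and "\<And>g i. g \<in> B \<Longrightarrow> partial_deriv i g \<in> function_algebra B"
    and "g \<in> function_algebra B"
  shows "smooth_poly_growth n g"
proof -
  have "partial_derivs is g \<in> function_algebra B" for "is"
  proof (induction "is")
    case Nil
    then show ?case using assms(3) by (simp add: partial_derivs_def)
  next
    case (Cons i "is")
    from function_algebra_closed[OF assms(1,2) this, of i]
    show ?case by (simp add: partial_derivs_def)
  qed
  then show ?thesis
    unfolding smooth_poly_growth_iff_tame using function_algebra_closed[OF assms(1,2)] by blast
qed

lemma tame_coordinate: "tame (Suc i) (\<lambda>x. x i)"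
proof -
  have "\<bar>x i\<bar> \<le> 1 * (1 + (\<Sum>j<Suc i. \<bar>x j\<bar>)) ^ 1" for x :: "nat \<Rightarrow> real"
  proof -
    have "0 \<le> (\<Sum>j<i. \<bar>x j\<bar>)" by (rule sum_nonneg) simp
    then show ?thesis by simp
  qed
  then have "\<exists>C N. \<forall>x :: nat \<Rightarrow> real. \<bar>x i\<bar> \<le> C * (1 + (\<Sum>j<Suc i. \<bar>x j\<bar>)) ^ N"
    by (intro exI allI)
  moreover have "(\<lambda>t. (x(j := t)) i) differentiable (at (x j))" for j and x :: "nat \<Rightarrow> real"
    by (cases "j = i") auto
  moreover have "continuous_on UNIV (\<lambda>x :: nat \<Rightarrow> real. x i)"
    by (rule continuous_on_product_coordinates)
  ultimately show ?thesis
    unfolding tame_def by (intro conjI allI impI) (assumption | simp)+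
qed

lemma smooth_poly_growth_coordinate: "smooth_poly_growth (Suc i) (\<lambda>x. x i)"
proof (rule smooth_poly_growth_algebra[of "{\<lambda>x. x i}"])
  show "(\<lambda>x. x i) \<in> function_algebra {\<lambda>x. x i}" by (rule function_algebra.base) simp
  show "tame (Suc i) g" if "g \<in> {\<lambda>x. x i}" for g
    using that tame_coordinate by simp
  show "partial_deriv j g \<in> function_algebra {\<lambda>x. x i}" if "g \<in> {\<lambda>x. x i}" for g j
  proof -
    have "partial_deriv j (\<lambda>x. x i) = (\<lambda>x. if j = i then 1 else 0)"
      by (rule partial_deriv_eqI) (cases "j = i"; simp)
    then show ?thesis
      using that by (cases "j = i") (simp_all add: function_algebra.const)
  qed
qed

lemma tame_mono:
  assumes "tame n f" "n \<le> m"
  shows "tame m f"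
proof -
  obtain C N where C: "\<And>x. \<bar>f x\<bar> \<le> C * (1 + (\<Sum>i<n. \<bar>x i\<bar>)) ^ N"
    using assms unfolding tame_def by meson
  have "\<bar>f x\<bar> \<le> \<bar>C\<bar> * (1 + (\<Sum>i<m. \<bar>x i\<bar>)) ^ N" for x
  proof -
    have "(\<Sum>i<n. \<bar>x i\<bar>) \<le> (\<Sum>i<m. \<bar>x i\<bar>)" "0 \<le> (\<Sum>i<n. \<bar>x i\<bar>)"
      using assms(2) by (auto intro!: sum_mono2 sum_nonneg)
    then show ?thesis
      by (intro order_trans[OF C] mult_mono power_mono) auto
  qed
  then have "\<exists>C N. \<forall>x. \<bar>f x\<bar> \<le> C * (1 + (\<Sum>i<m. \<bar>x i\<bar>)) ^ N" by blast
  then show ?thesis using assms unfolding tame_def by auto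
qed

lemma shift_update:
  "(\<lambda>j. (x(i := t)) (j + m)) = (if m \<le> i then (\<lambda>j. x (j + m))(i - m := t) else (\<lambda>j. x (j + m)))"
  for m i :: nat
  by (auto simp: fun_eq_iff)

text \<open>Functions of two different Gaussian families are brought onto one concatenated family;
  the second function then reads its arguments from position \<open>m\<close> on.\<close>

lemma tame_shift:
  assumes "tame n f"
  shows "tame (m + n) (\<lambda>x. f (\<lambda>j. x (j + m)))"
proof -
  obtain C N where C: "\<And>x. \<bar>f x\<bar> \<le> C * (1 + (\<Sum>i<n. \<bar>x i\<bar>)) ^ N"
    using assms unfolding tame_def by meson
  have "\<bar>f (\<lambda>j. x (j + m))\<bar> \<le> \<bar>C\<bar> * (1 + (\<Sum>i<m + n. \<bar>x i\<bar>)) ^ N" for x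
  proof -
    have "(\<Sum>i<n. \<bar>x (i + m)\<bar>) = (\<Sum>i\<in>{m..<m + n}. \<bar>x i\<bar>)"
      using sum.shift_bounds_nat_ivl[of "\<lambda>i. \<bar>x i\<bar>" 0 m n] by (simp add: lessThan_atLeast0 add.commute)
    also have "\<dots> \<le> (\<Sum>i<m + n. \<bar>x i\<bar>)"
      by (intro sum_mono2) auto
    finally have "(\<Sum>i<n. \<bar>x (i + m)\<bar>) \<le> (\<Sum>i<m + n. \<bar>x i\<bar>)" .
    moreover have "0 \<le> (\<Sum>i<n. \<bar>x (i + m)\<bar>)" by (rule sum_nonneg) simp
    ultimately show ?thesis
      by (intro order_trans[OF C] mult_mono power_mono) auto
  qed
  then have "\<exists>C N. \<forall>x. \<bar>f (\<lambda>j. x (j + m))\<bar> \<le> C * (1 + (\<Sum>i<m + n. \<bar>x i\<bar>)) ^ N" by blast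
  moreover have "continuous_on UNIV (\<lambda>x. f (\<lambda>j. x (j + m)))"
  proof (rule continuous_on_compose2[of UNIV f UNIV "\<lambda>x j. x (j + m)"])
    show "continuous_on UNIV f" using assms unfolding tame_def by blast
    show "continuous_on UNIV (\<lambda>x :: nat \<Rightarrow> real. \<lambda>j. x (j + m))"
      by (intro continuous_on_coordinatewise_then_product continuous_on_product_coordinates)
  qed simp
  moreover have "(\<lambda>t. f (\<lambda>j. (x(i := t)) (j + m))) differentiable at (x i)" for i x
  proof (cases "m \<le> i")
    case True
    have "(\<lambda>t. f ((\<lambda>j. x (j + m))(i - m := t))) differentiable at ((\<lambda>j. x (j + m)) (i - m))"
      using assms unfolding tame_def by blast
    then show ?thesis unfolding shift_update using True by simp
  next
    case False
    then show ?thesis unfolding shift_update by simp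
  qed
  moreover have "\<forall>x y. (\<forall>i<m + n. x i = y i) \<longrightarrow> f (\<lambda>j. x (j + m)) = f (\<lambda>j. y (j + m))"
    using assms unfolding tame_def by auto
  ultimately show ?thesis unfolding tame_def by blast
qed

lemma partial_deriv_shift:
  "partial_deriv i (\<lambda>x. f (\<lambda>j. x (j + m))) =
     (if m \<le> i then (\<lambda>x. partial_deriv (i - m) f (\<lambda>j. x (j + m))) else (\<lambda>x. 0))"
  unfolding partial_deriv_def shift_update by auto

lemma partial_derivs_Cons: "partial_derivs (i # is) f = partial_deriv i (partial_derivs is f)"
  by (simp add: partial_derivs_def)

lemma partial_derivs_Nil: "partial_derivs [] f = f"
  by (simp add: partial_derivs_def)

lemma smooth_poly_growth_lincomb:
  assumes "smooth_poly_growth n f" "smooth_poly_growth m g"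
  shows "smooth_poly_growth (n + m) (\<lambda>x. a * f x + b * g (\<lambda>j. x (j + n)))"
proof -
  \<comment> \<open>All iterated derivatives of both functions are generators, so differentiating a
    generator gives another generator or 0.\<close>
  define B where "B = range (\<lambda>is. partial_derivs is f) \<union>
    range (\<lambda>is x. partial_derivs is g (\<lambda>j. x (j + n)))"
  have base: "partial_derivs is f \<in> B" "(\<lambda>x. partial_derivs is g (\<lambda>j. x (j + n))) \<in> B" for "is"
    unfolding B_def by auto
  show ?thesis
  proof (rule smooth_poly_growth_algebra[of B])
    show "tame (n + m) h" if "h \<in> B" for h
      using that assms tame_mono[of n _ "n + m"] tame_shift[of m _ n]
      unfolding B_def smooth_poly_growth_iff_tame by auto
    show "partial_deriv i h \<in> function_algebra B" if hB: "h \<in> B" for h i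
    proof -
      consider "is" where "h = partial_derivs is f"
        | "is" where "h = (\<lambda>x. partial_derivs is g (\<lambda>j. x (j + n)))"
        using hB unfolding B_def by blast
      then show ?thesis
      proof cases
        case 1
        then show ?thesis
          using function_algebra.base[OF base(1)[of "i # is" for "is"]]
          by (simp add: partial_derivs_Cons)
      next
        case 2
        then show ?thesis
          using function_algebra.base[OF base(2)[of "(i - n) # is" for "is"]]
          by (simp add: partial_derivs_Cons partial_deriv_shift function_algebra.const)
      qed
    qed
    show "(\<lambda>x. a * f x + b * g (\<lambda>j. x (j + n))) \<in> function_algebra B"
      using base[of "[]"] unfolding partial_derivs_Nil
      by (intro function_algebra.add[OF function_algebra.mult function_algebra.mult]
          function_algebra.const function_algebra.base)
  qed
qed

text \<open>Linear growth of \<open>h\<close> is what preserves polynomial growth, even with the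
  same exponent \<open>N\<close>.\<close>

lemma tame_compose:
  assumes f: "tame n f" and h: "\<And>y. (h has_real_derivative h' y) (at y)"
    and growth: "\<And>y. \<bar>h y\<bar> \<le> C * (1 + \<bar>y\<bar>)"
  shows "tame n (\<lambda>x. h (f x))"
    and "partial_deriv i (\<lambda>x. h (f x)) = (\<lambda>x. h' (f x) * partial_deriv i f x)"
proof -
  have der: "((\<lambda>t. h (f (x(i := t)))) has_real_derivative h' (f x) * partial_deriv i f x) (at (x i))"
    for i x
  proof -
    have "(h has_real_derivative h' (f x)) (at (f (x(i := x i))))" using h by simp
    from DERIV_chain2[OF this tame_has_partial[OF f]] show ?thesis .
  qed
  show "partial_deriv i (\<lambda>x. h (f x)) = (\<lambda>x. h' (f x) * partial_deriv i f x)"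
    using der by (rule partial_deriv_eqI)
  obtain D N where D: "\<And>x. \<bar>f x\<bar> \<le> D * (1 + (\<Sum>i<n. \<bar>x i\<bar>)) ^ N"
    using f unfolding tame_def by meson
  have "\<bar>h (f x)\<bar> \<le> (\<bar>C\<bar> * (1 + \<bar>D\<bar>)) * (1 + (\<Sum>i<n. \<bar>x i\<bar>)) ^ N" for x
  proof -
    have "0 \<le> (\<Sum>i<n. \<bar>x i\<bar>)" by (rule sum_nonneg) simp
    then have s: "1 \<le> (1 + (\<Sum>i<n. \<bar>x i\<bar>)) ^ N" by (intro one_le_power) simp
    have "\<bar>h (f x)\<bar> \<le> \<bar>C\<bar> * (1 + \<bar>f x\<bar>)"
      by (rule order_trans[OF growth mult_right_mono]) auto
    also have "\<bar>f x\<bar> \<le> \<bar>D\<bar> * (1 + (\<Sum>i<n. \<bar>x i\<bar>)) ^ N"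
      using s by (intro order_trans[OF D mult_right_mono]) auto
    with s have "\<bar>C\<bar> * (1 + \<bar>f x\<bar>)
        \<le> \<bar>C\<bar> * ((1 + (\<Sum>i<n. \<bar>x i\<bar>)) ^ N + \<bar>D\<bar> * (1 + (\<Sum>i<n. \<bar>x i\<bar>)) ^ N)"
      by (intro mult_left_mono add_mono) auto
    finally show ?thesis by (simp add: algebra_simps)
  qed
  then have "\<exists>C N. \<forall>x. \<bar>h (f x)\<bar> \<le> C * (1 + (\<Sum>i<n. \<bar>x i\<bar>)) ^ N" by blast
  moreover have "continuous_on UNIV h" by (rule DERIV_continuous_on) (use h in auto)
  then have "continuous_on UNIV (\<lambda>x. h (f x))"
    by (rule continuous_on_compose2) (use f in \<open>simp_all add: tame_def\<close>)
  moreover have "(\<lambda>t. h (f (x(i := t)))) differentiable at (x i)" for i x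
    using der unfolding real_differentiable_def by blast
  moreover have "\<forall>x y. (\<forall>i<n. x i = y i) \<longrightarrow> h (f x) = h (f y)"
    using f unfolding tame_def by metis
  ultimately show "tame n (\<lambda>x. h (f x))"
    unfolding tame_def by blast
qed

lemma function_algebra_polynomial:
  assumes "real_polynomial_function p" "g \<in> function_algebra B"
  shows "(\<lambda>x. p (g x)) \<in> function_algebra B"
  using assms(1)
proof (induction)
  case (linear f)
  then obtain c where "f = (\<lambda>x. x * c)" using real_bounded_linear by auto
  then show ?case
    using function_algebra.mult[OF assms(2) function_algebra.const[of c]] by simp
next
  case (const c)
  show ?case by (rule function_algebra.const)
next
  case (add f h)
  from function_algebra.add[OF add.IH] show ?case .
next
  case (mult f h)
  from function_algebra.mult[OF mult.IH] show ?case .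
qed

text \<open>The derivative of \<open>arctan\<close> is 1/(1 + y^2), called \<open>r\<close> below,
  and the derivative of \<open>r\<close> is -2 y r^2. Hence the algebra generated by the derivatives
  of \<open>f\<close> and by \<open>h\<close>, \<open>arctan\<close> and \<open>r\<close> applied to
  \<open>f\<close> is closed under differentiation.\<close>

lemma smooth_poly_growth_compose:
  assumes f: "smooth_poly_growth n f" and p: "real_polynomial_function p"
    and h: "\<And>y. (h has_real_derivative p (arctan y)) (at y)"
    and growth: "\<And>y. \<bar>h y\<bar> \<le> C * (1 + \<bar>y\<bar>)"
  shows "smooth_poly_growth n (\<lambda>x. h (f x))"
    and "partial_deriv i (\<lambda>x. h (f x)) = (\<lambda>x. p (arctan (f x)) * partial_deriv i f x)"
proof -
  define r :: "real \<Rightarrow> real" where "r = (\<lambda>y. inverse (1 + y\<^sup>2))"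
  have r: "(r has_real_derivative (- 2 * y * (r y * r y))) (at y)" for y
  proof -
    have "1 + y\<^sup>2 \<noteq> 0" by (simp add: add_nonneg_eq_0_iff)
    then show ?thesis
      unfolding r_def by (auto intro!: derivative_eq_intros simp: power2_eq_square)
  qed
  have r_bound: "\<bar>r y\<bar> \<le> 1 * (1 + \<bar>y\<bar>)" for y
  proof -
    have "\<bar>r y\<bar> \<le> 1"
      unfolding r_def by (simp add: inverse_le_1_iff abs_of_nonneg add_nonneg_nonneg)
    then show ?thesis by simp
  qed
  have arctan_bound: "\<bar>arctan y\<bar> \<le> pi * (1 + \<bar>y\<bar>)" for y
  proof -
    have "\<bar>arctan y\<bar> \<le> pi" using arctan_bounded[of y] pi_gt_zero by linarith
    moreover have "0 \<le> pi * \<bar>y\<bar>" by simp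
    ultimately show ?thesis unfolding distrib_left by linarith
  qed
  define B where "B = range (\<lambda>is. partial_derivs is f) \<union>
    {\<lambda>x. h (f x), \<lambda>x. arctan (f x), \<lambda>x. r (f x)}"
  have fB: "partial_derivs is f \<in> function_algebra B" for "is"
    unfolding B_def by (auto intro: function_algebra.base)
  have f0: "f \<in> function_algebra B" and f1: "partial_deriv i f \<in> function_algebra B" for i
    using fB[of "[]"] fB[of "[i]"] by (simp_all add: partial_derivs_Cons partial_derivs_Nil)
  have atn: "(\<lambda>x. arctan (f x)) \<in> function_algebra B" and rB: "(\<lambda>x. r (f x)) \<in> function_algebra B"
    unfolding B_def by (auto intro: function_algebra.base)
  have tf: "tame n f" using f unfolding smooth_poly_growth_iff_tame by (metis partial_derivs_Nil)
  note th = tame_compose[OF tf h growth] and tr = tame_compose[OF tf r r_bound]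
    and ta = tame_compose[OF tf DERIV_arctan arctan_bound]
  show "partial_deriv i (\<lambda>x. h (f x)) = (\<lambda>x. p (arctan (f x)) * partial_deriv i f x)"
    by (rule th)
  show "smooth_poly_growth n (\<lambda>x. h (f x))"
  proof (rule smooth_poly_growth_algebra[of B])
    show "tame n g" if "g \<in> B" for g
      using that f th(1) tr(1) ta(1) unfolding B_def smooth_poly_growth_iff_tame by blast
    show "partial_deriv i g \<in> function_algebra B" if gB: "g \<in> B" for g i
    proof -
      consider "is" where "g = partial_derivs is f" | "g = (\<lambda>x. h (f x))"
        | "g = (\<lambda>x. arctan (f x))" | "g = (\<lambda>x. r (f x))"
        using gB unfolding B_def by blast
      then show ?thesis
      proof cases
        case 1
        then show ?thesis using fB[of "i # is" for "is"] by (simp add: partial_derivs_Cons)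
      next
        case 2
        then show ?thesis
          using function_algebra.mult[OF function_algebra_polynomial[OF p atn] f1] by (simp add: th(2))
      next
        case 3
        then show ?thesis
          using function_algebra.mult[OF rB f1] by (simp add: ta(2) r_def)
      next
        case 4
        then show ?thesis
          using function_algebra.mult[OF function_algebra.mult[OF function_algebra.mult[OF
                  function_algebra.const[of "-2"] f0] function_algebra.mult[OF rB rB]] f1]
          by (simp add: tr(2))
      qed
    qed
    show "(\<lambda>x. h (f x)) \<in> function_algebra B"
      unfolding B_def by (rule function_algebra.base) simp
  qed
qed

section \<open>The chain rule for the Malliavin derivative\<close>

text \<open>A polynomial in \<open>arctan\<close> is bounded, with derivatives of polynomial growth, so the Weierstrass
  theorem on \<open>[-\<pi>/2, \<pi>/2]\<close> provides bounded, locally uniform approximations of the derivative in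
  the chain rule by admissible functions.\<close>

lemma arctan_polynomial_approx:
  fixes g :: "real \<Rightarrow> real"
  assumes g: "continuous_on UNIV g" and bound: "\<And>x. \<bar>g x\<bar> \<le> B" and "0 < e" "0 \<le> R"
  obtains p where "real_polynomial_function p" "\<And>x. \<bar>x\<bar> \<le> R \<Longrightarrow> \<bar>p (arctan x) - g x\<bar> < e"
    "\<And>x. \<bar>p (arctan x)\<bar> \<le> B + e"
proof -
  \<comment> \<open>Clamping to [-arctan R, arctan R] keeps \<open>tan\<close> away from its poles,
    so \<open>g (tan (c \<theta>))\<close> is continuous on the closed interval. It equals
    \<open>g x\<close> at \<theta> = arctan x for |x| \<le> R and obeys the bound of
    \<open>g\<close> everywhere.\<close>
  define c where "c = (\<lambda>\<theta>. max (- arctan R) (min (arctan R) \<theta>))"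
  have ar: "0 \<le> arctan R" using assms by simp
  have c: "- (pi / 2) < c \<theta>" "c \<theta> < pi / 2" for \<theta>
    unfolding c_def using arctan_bounded[of R] ar by auto
  have "continuous_on UNIV c" unfolding c_def by (intro continuous_intros)
  moreover have "cos (c \<theta>) \<noteq> 0" for \<theta>
    using cos_gt_zero_pi[of "c \<theta>"] c[of \<theta>] by auto
  ultimately have "continuous_on UNIV (\<lambda>\<theta>. tan (c \<theta>))"
    by (intro Transcendental.continuous_on_tan ballI)
  then have q: "continuous_on {- (pi / 2)..pi / 2} (\<lambda>\<theta>. g (tan (c \<theta>)))"
    by (intro continuous_on_compose2[OF g]) (auto intro: continuous_on_subset)
  obtain p where p: "real_polynomial_function p"
    "\<And>\<theta>. \<theta> \<in> {- (pi / 2)..pi / 2} \<Longrightarrow> \<bar>g (tan (c \<theta>)) - p \<theta>\<bar> < e"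
    using Stone_Weierstrass_real_polynomial_function[OF compact_Icc q \<open>0 < e\<close>] by blast
  have pe: "\<bar>g (tan (c (arctan x))) - p (arctan x)\<bar> < e" for x
    using p(2)[of "arctan x"] arctan_bounded[of x] by auto
  have "\<bar>p (arctan x) - g x\<bar> < e" if "\<bar>x\<bar> \<le> R" for x
  proof -
    have "arctan x \<le> arctan R" "arctan (- R) \<le> arctan x"
      using that by (auto simp: arctan_le_iff)
    then have "c (arctan x) = arctan x" unfolding c_def by (simp add: arctan_minus)
    with pe[of x] show ?thesis by (simp add: tan_arctan abs_minus_commute)
  qed
  moreover have "\<bar>p (arctan x)\<bar> \<le> B + e" for x
    using pe[of x] bound[of "tan (c (arctan x))"] by linarith
  ultimately show thesis using that p(1) by blast
qed

text \<open>\<open>H k\<close> is an antiderivative of a polynomial in \<open>arctan\<close>,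
  normalised at 0; the estimates for \<open>H k - h\<close> are mean value inequalities starting
  from 0. The estimates on [-k, k] give convergence, the global ones give domination, with
  \<open>2 * B + 1\<close> arising as \<open>(B + 1) + B\<close>.\<close>

lemma smooth_approx_C1:
  fixes h h' :: "real \<Rightarrow> real"
  assumes h: "\<And>y. (h has_real_derivative h' y) (at y)" and h': "continuous_on UNIV h'"
    and bound: "\<And>y. \<bar>h' y\<bar> \<le> B"
  obtains p and H :: "nat \<Rightarrow> real \<Rightarrow> real" where
    "\<And>k. real_polynomial_function (p k)"
    "\<And>k y. (H k has_real_derivative p k (arctan y)) (at y)"
    "\<And>k y. \<bar>p k (arctan y)\<bar> \<le> B + 1"
    "\<And>k y. \<bar>y\<bar> \<le> real k \<Longrightarrow> \<bar>p k (arctan y) - h' y\<bar> \<le> 1 / Suc k"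
    "\<And>k y. \<bar>y\<bar> \<le> real k \<Longrightarrow> \<bar>H k y - h y\<bar> \<le> \<bar>y\<bar> / Suc k"
    "\<And>k y. \<bar>H k y - h y\<bar> \<le> (2 * B + 1) * \<bar>y\<bar>"
    "\<And>k. H k 0 = h 0"
proof -
  have "\<exists>p. real_polynomial_function p \<and> (\<forall>x. \<bar>x\<bar> \<le> real k \<longrightarrow> \<bar>p (arctan x) - h' x\<bar> < 1 / Suc k)
    \<and> (\<forall>x. \<bar>p (arctan x)\<bar> \<le> B + 1 / Suc k)" for k
    by (rule arctan_polynomial_approx[OF h' bound, of "1 / Suc k" "real k"]) auto
  then obtain p where p: "\<And>k. real_polynomial_function (p k)"
    and p1: "\<And>k x. \<bar>x\<bar> \<le> real k \<Longrightarrow> \<bar>p k (arctan x) - h' x\<bar> < 1 / Suc k"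
    and p2: "\<And>k x. \<bar>p k (arctan x)\<bar> \<le> B + 1 / Suc k"
    by metis
  have "isCont (\<lambda>y. p k (arctan y)) y" for k y
    by (rule isCont_o2[OF isCont_arctan continuous_real_polymonial_function[OF p]])
  then have "\<exists>F. \<forall>y. (F has_real_derivative p k (arctan y)) (at y)" for k
    using einterval_antiderivative[of "-\<infinity>" \<infinity> "\<lambda>y. p k (arctan y)"]
    by (auto simp: has_real_derivative_iff_has_vector_derivative)
  then have "\<exists>F. \<forall>k y. (F k has_real_derivative p k (arctan y)) (at y)" by (intro choice allI)
  then obtain F where F: "\<And>k y. (F k has_real_derivative p k (arctan y)) (at y)" by blast
  define H where "H = (\<lambda>k y. F k y - F k 0 + h 0)"
  have H: "(H k has_real_derivative p k (arctan y)) (at y)" for k y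
    unfolding H_def using F by (auto intro!: derivative_eq_intros)
  have p3: "\<bar>p k (arctan y)\<bar> \<le> B + 1" for k y
  proof -
    have "1 / real (Suc k) \<le> 1" by simp
    with p2[of k y] show ?thesis by linarith
  qed
  have d: "((\<lambda>y. H k y - h y) has_real_derivative p k (arctan y) - h' y) (at y within S)" for k y S
    using DERIV_diff[OF H h] by (rule has_field_derivative_at_within)
  have "\<bar>H k y - h y\<bar> \<le> \<bar>y\<bar> / Suc k" if y: "\<bar>y\<bar> \<le> real k" for k y
  proof -
    have "norm ((H k y - h y) - (H k 0 - h 0)) \<le> 1 / Suc k * norm (y - 0)"
    proof (rule field_differentiable_bound[OF _ d])
      show "norm (p k (arctan z) - h' z) \<le> 1 / Suc k" if "z \<in> {- real k..real k}" for z
        using p1[of z k] that by (simp add: abs_le_iff less_imp_le)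
    qed (use y in auto)
    then show ?thesis by (simp add: H_def)
  qed
  moreover have "\<bar>H k y - h y\<bar> \<le> (2 * B + 1) * \<bar>y\<bar>" for k y
  proof -
    have "\<bar>p k (arctan y) - h' y\<bar> \<le> 2 * B + 1" for y
      using p3[of k y] bound[of y] by linarith
    then show ?thesis
      using field_differentiable_bound[of UNIV "\<lambda>y. H k y - h y"
          "\<lambda>y. p k (arctan y) - h' y" "2 * B + 1" y 0, OF _ d]
      by (auto simp: H_def)
  qed
  ultimately show thesis
    using that[of p H] p H p1 p3 by (auto simp: H_def less_imp_le)
qed

section \<open>Square-integrable functions and convergence in mean square\<close>

lemma Lp2_bound:
  assumes "f \<in> borel_measurable M" "integrable M w" "\<And>\<omega>. (norm (f \<omega>))\<^sup>2 \<le> w \<omega>"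
  shows "f \<in> Lp 2 M"
proof -
  have "integrable M (\<lambda>\<omega>. (norm (f \<omega>))\<^sup>2)"
    by (rule Bochner_Integration.integrable_bound[OF assms(2)])
      (use assms(1) order_trans[OF assms(3) abs_ge_self] in auto)
  with assms(1) show ?thesis unfolding Lp_def by simp
qed

lemma Lp2D:
  assumes "f \<in> Lp 2 M"
  shows "f \<in> borel_measurable M" "integrable M (\<lambda>\<omega>. (norm (f \<omega>))\<^sup>2)"
  using assms unfolding Lp_def by auto

lemma norm_add_sq_le:
  fixes a b :: "'v::real_normed_vector"
  shows "(norm (a + b))\<^sup>2 \<le> 2 * (norm a)\<^sup>2 + 2 * (norm b)\<^sup>2"
proof -
  have "(norm (a + b))\<^sup>2 \<le> (norm a + norm b)\<^sup>2"
    by (intro power_mono norm_triangle_ineq) simp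
  also have "\<dots> \<le> 2 * (norm a)\<^sup>2 + 2 * (norm b)\<^sup>2"
    using sum_squares_bound[of "norm a" "norm b"] by (simp add: power2_sum)
  finally show ?thesis .
qed

lemma Lp2_add:
  assumes "f \<in> Lp 2 M" "g \<in> Lp 2 M"
  shows "(\<lambda>\<omega>. f \<omega> + g \<omega>) \<in> Lp 2 M"
  by (rule Lp2_bound[where w="\<lambda>\<omega>. 2 * (norm (f \<omega>))\<^sup>2 + 2 * (norm (g \<omega>))\<^sup>2"])
    (use Lp2D[OF assms(1)] Lp2D[OF assms(2)] norm_add_sq_le in auto)

lemma Lp2_dominated:
  fixes f :: "'a \<Rightarrow> 'v::{banach, second_countable_topology}"
    and g :: "'a \<Rightarrow> 'w::{banach, second_countable_topology}"
  assumes "f \<in> Lp 2 M" "g \<in> borel_measurable M" "\<And>\<omega>. norm (g \<omega>) \<le> c * norm (f \<omega>)"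
  shows "g \<in> Lp 2 M"
proof (rule Lp2_bound[OF assms(2)])
  show "integrable M (\<lambda>\<omega>. c\<^sup>2 * (norm (f \<omega>))\<^sup>2)" using Lp2D[OF assms(1)] by auto
  show "(norm (g \<omega>))\<^sup>2 \<le> c\<^sup>2 * (norm (f \<omega>))\<^sup>2" for \<omega>
    using power_mono[OF assms(3), of \<omega> 2] by (simp add: power_mult_distrib)
qed

lemma Lp2_scaleR:
  assumes "f \<in> Lp 2 M"
  shows "(\<lambda>\<omega>. c *\<^sub>R f \<omega>) \<in> Lp 2 M"
  by (rule Lp2_dominated[OF assms, of _ "\<bar>c\<bar>"]) (use Lp2D[OF assms] in auto)

lemma Lp2_diff:
  assumes "f \<in> Lp 2 M" "g \<in> Lp 2 M"
  shows "(\<lambda>\<omega>. f \<omega> - g \<omega>) \<in> Lp 2 M"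
  using Lp2_add[OF assms(1) Lp2_scaleR[OF assms(2), of "-1"]] by simp

text \<open>The two error terms match the chain rule, where one comes from approximating the random
  variable and the other from approximating the function. Membership of \<open>Y n\<close> in L^2 is
  deduced from that of \<open>L\<close> and of the difference.\<close>

lemma tendsto_Lp2I:
  fixes Y :: "nat \<Rightarrow> 'a \<Rightarrow> 'v::{banach, second_countable_topology}"
  assumes Y: "\<And>n. Y n \<in> borel_measurable M" and L: "L \<in> Lp 2 M"
    and le: "\<And>n \<omega>. norm (Y n \<omega> - L \<omega>) \<le> a n \<omega> + b n \<omega>"
    and a: "\<And>n. integrable M (\<lambda>\<omega>. (a n \<omega>)\<^sup>2)" "(\<lambda>n. \<integral>\<omega>. (a n \<omega>)\<^sup>2 \<partial>M) \<longlonglongrightarrow> 0"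
    and b: "\<And>n. integrable M (\<lambda>\<omega>. (b n \<omega>)\<^sup>2)" "(\<lambda>n. \<integral>\<omega>. (b n \<omega>)\<^sup>2 \<partial>M) \<longlonglongrightarrow> 0"
  shows "tendsto_Lp 2 M Y L"
proof -
  have sq: "(norm (Y n \<omega> - L \<omega>))\<^sup>2 \<le> 2 * (a n \<omega>)\<^sup>2 + 2 * (b n \<omega>)\<^sup>2" for n \<omega>
    using power_mono[OF le, of n \<omega> 2] norm_add_sq_le[of "a n \<omega>" "b n \<omega>"] by simp
  have d: "(\<lambda>\<omega>. Y n \<omega> - L \<omega>) \<in> Lp 2 M" for n
    by (rule Lp2_bound[OF _ _ sq]) (use Y Lp2D[OF L] a(1) b(1) in auto)
  have "Y n \<in> Lp 2 M" for n
    using Lp2_add[OF d L] by simp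
  moreover have "(\<lambda>n. \<integral>\<omega>. (norm (Y n \<omega> - L \<omega>))\<^sup>2 \<partial>M) \<longlonglongrightarrow> 0"
  proof (rule tendsto_sandwich[OF _ _ tendsto_const])
    show "(\<lambda>n. 2 * (\<integral>\<omega>. (a n \<omega>)\<^sup>2 \<partial>M) + 2 * (\<integral>\<omega>. (b n \<omega>)\<^sup>2 \<partial>M)) \<longlonglongrightarrow> 0"
      using tendsto_add[OF tendsto_mult_left[OF a(2), of 2] tendsto_mult_left[OF b(2), of 2]] by simp
    have "(\<integral>\<omega>. (norm (Y n \<omega> - L \<omega>))\<^sup>2 \<partial>M) \<le> (\<integral>\<omega>. 2 * (a n \<omega>)\<^sup>2 + 2 * (b n \<omega>)\<^sup>2 \<partial>M)" for n
      by (rule integral_mono) (use Lp2D[OF d] a(1) b(1) sq in auto)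
    then show "\<forall>\<^sub>F n in sequentially. (\<integral>\<omega>. (norm (Y n \<omega> - L \<omega>))\<^sup>2 \<partial>M) \<le>
        2 * (\<integral>\<omega>. (a n \<omega>)\<^sup>2 \<partial>M) + 2 * (\<integral>\<omega>. (b n \<omega>)\<^sup>2 \<partial>M)"
      using a(1) b(1) by simp
  qed simp
  ultimately show ?thesis unfolding tendsto_Lp_def using L by blast
qed

lemma tendsto_Lp2D:
  assumes "tendsto_Lp 2 M Y L"
  shows "Y n \<in> Lp 2 M" "L \<in> Lp 2 M" "(\<lambda>n. \<integral>\<omega>. (norm (Y n \<omega> - L \<omega>))\<^sup>2 \<partial>M) \<longlonglongrightarrow> 0"
    "integrable M (\<lambda>\<omega>. (norm (Y n \<omega> - L \<omega>))\<^sup>2)"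
  using assms Lp2D(2)[OF Lp2_diff] unfolding tendsto_Lp_def by blast+

lemma tendsto_Lp_subseq:
  assumes "tendsto_Lp p M Y L" "strict_mono r"
  shows "tendsto_Lp p M (\<lambda>n. Y (r n)) L"
  using assms LIMSEQ_subseq_LIMSEQ[OF _ assms(2)] unfolding tendsto_Lp_def comp_def by blast

text \<open>The squared distances tend to 0 in L^1, so the almost everywhere statement for L^1
  applies to them.\<close>

lemma tendsto_Lp2_AE_subseq:
  assumes "tendsto_Lp 2 M Y L"
  obtains r :: "nat \<Rightarrow> nat" where "strict_mono r" "AE \<omega> in M. (\<lambda>n. Y (r n) \<omega>) \<longlonglongrightarrow> L \<omega>"
proof -
  have "\<exists>r::nat\<Rightarrow>nat. strict_mono r \<and> (AE x in M. (\<lambda>n. (norm (Y (r n) x - L x))\<^sup>2) \<longlonglongrightarrow> 0)"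
    by (rule tendsto_L1_AE_subseq) (use tendsto_Lp2D[OF assms] in auto)
  then obtain r :: "nat \<Rightarrow> nat" where "strict_mono r"
    and r: "AE x in M. (\<lambda>n. (norm (Y (r n) x - L x))\<^sup>2) \<longlonglongrightarrow> 0" by blast
  have "AE \<omega> in M. (\<lambda>n. Y (r n) \<omega>) \<longlonglongrightarrow> L \<omega>"
    using r
  proof eventually_elim
    case (elim \<omega>)
    from tendsto_real_sqrt[OF elim] show ?case
      by (subst LIM_zero_iff[symmetric]) (simp add: tendsto_norm_zero_iff)
  qed
  with \<open>strict_mono r\<close> show thesis using that by blast
qed

section \<open>Composition and linear combination under the Malliavin derivative\<close>

lemma smooth_cylindrical_compose:
  assumes "smooth_cylindrical X F G" "real_polynomial_function p"
    and "\<And>y. (h has_real_derivative p (arctan y)) (at y)" "\<And>y. \<bar>h y\<bar> \<le> C * (1 + \<bar>y\<bar>)"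
  shows "smooth_cylindrical X (\<lambda>\<omega>. h (F \<omega>)) (\<lambda>\<omega>. p (arctan (F \<omega>)) *\<^sub>R G \<omega>)"
proof -
  obtain n f e where f: "smooth_poly_growth n f" and F: "F = (\<lambda>\<omega>. f (\<lambda>j. X (e j) \<omega>))"
    and G: "G = (\<lambda>\<omega>. \<Sum>i<n. partial_deriv i f (\<lambda>j. X (e j) \<omega>) *\<^sub>R e i)"
    using assms(1) unfolding smooth_cylindrical_def by blast
  show ?thesis
    unfolding smooth_cylindrical_def
    by (rule exI[of _ n], rule exI[of _ "\<lambda>x. h (f x)"], rule exI[of _ e])
      (simp add: smooth_poly_growth_compose[OF f assms(2-)] F G scaleR_sum_right)
qed

lemma sum_lessThan_add:
  fixes f :: "nat \<Rightarrow> 'v::comm_monoid_add"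
  shows "(\<Sum>i<m + n. f i) = (\<Sum>i<m. f i) + (\<Sum>i<n. f (m + i))"
  by (induction n) (simp_all add: add.assoc)

lemma smooth_cylindrical_lincomb:
  assumes "smooth_cylindrical X F G" "smooth_cylindrical X F' G'"
  shows "smooth_cylindrical X (\<lambda>\<omega>. a * F \<omega> + b * F' \<omega>) (\<lambda>\<omega>. a *\<^sub>R G \<omega> + b *\<^sub>R G' \<omega>)"
proof -
  obtain n f e where f: "smooth_poly_growth n f" and F: "F = (\<lambda>\<omega>. f (\<lambda>j. X (e j) \<omega>))"
    and G: "G = (\<lambda>\<omega>. \<Sum>i<n. partial_deriv i f (\<lambda>j. X (e j) \<omega>) *\<^sub>R e i)"
    using assms(1) unfolding smooth_cylindrical_def by blast
  obtain n' f' e' where f': "smooth_poly_growth n' f'" and F': "F' = (\<lambda>\<omega>. f' (\<lambda>j. X (e' j) \<omega>))"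
    and G': "G' = (\<lambda>\<omega>. \<Sum>i<n'. partial_deriv i f' (\<lambda>j. X (e' j) \<omega>) *\<^sub>R e' i)"
    using assms(2) unfolding smooth_cylindrical_def by blast
  \<comment> \<open>Both functionals are read off one family of directions: the first
    \<open>n\<close> belong to \<open>F\<close>, the later ones to \<open>F'\<close>.\<close>
  define d where "d = (\<lambda>j. if j < n then e j else e' (j - n))"
  have dep: "\<And>x y. (\<forall>i<n. x i = y i) \<Longrightarrow> f x = f y"
    using f unfolding smooth_poly_growth_def by blast
  have tf: "tame n f" "tame n' f'"
    using f f' unfolding smooth_poly_growth_iff_tame by (metis partial_derivs_Nil)+
  have fd: "f (\<lambda>j. X (d j) \<omega>) = f (\<lambda>j. X (e j) \<omega>)"
    "partial_deriv i f (\<lambda>j. X (d j) \<omega>) = partial_deriv i f (\<lambda>j. X (e j) \<omega>)" for i \<omega>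
    by (rule dep partial_deriv_cong[OF dep], auto simp: d_def)+
  \<comment> \<open>The sum for the combined functional runs over \<open>n + n'\<close> directions,
    so \<open>f\<close> must contribute nothing in the added ones.\<close>
  have out: "partial_deriv i f x = 0" if "n \<le> i" for i x
  proof -
    have "f (x(i := t)) = f x" for t using that by (intro dep) auto
    then show ?thesis by (simp add: partial_deriv_def)
  qed
  have pd: "partial_deriv i (\<lambda>x. a * f x + b * f' (\<lambda>j. x (j + n))) =
      (\<lambda>x. a * partial_deriv i f x + b * partial_deriv i (\<lambda>x. f' (\<lambda>j. x (j + n))) x)" for i
    by (intro partial_deriv_eqI DERIV_add DERIV_cmult tame_has_partial[OF tf(1)]
        tame_has_partial[OF tame_shift[OF tf(2)]])
  show ?thesis
    unfolding smooth_cylindrical_def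
  proof (intro exI conjI)
    show "smooth_poly_growth (n + n') (\<lambda>x. a * f x + b * f' (\<lambda>j. x (j + n)))"
      using f f' by (rule smooth_poly_growth_lincomb)
    show "(\<lambda>\<omega>. a * F \<omega> + b * F' \<omega>) =
        (\<lambda>\<omega>. a * f (\<lambda>j. X (d j) \<omega>) + b * f' (\<lambda>j. X (d (j + n)) \<omega>))"
      unfolding F F' fd by (simp add: d_def)
    show "(\<lambda>\<omega>. a *\<^sub>R G \<omega> + b *\<^sub>R G' \<omega>) = (\<lambda>\<omega>. \<Sum>i<n + n'.
        partial_deriv i (\<lambda>x. a * f x + b * f' (\<lambda>j. x (j + n))) (\<lambda>j. X (d j) \<omega>) *\<^sub>R d i)"
      unfolding pd partial_deriv_shift sum_lessThan_add fd G G'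
      by (simp add: out d_def scaleR_sum_right)
  qed
qed

lemma has_malliavin_derivD:
  assumes "has_malliavin_deriv M X F G"
  shows "F \<in> Lp 2 M" "G \<in> Lp 2 M"
  using assms tendsto_Lp2D(2) unfolding has_malliavin_deriv_def by blast+

lemma has_malliavin_deriv_lincomb:
  assumes "has_malliavin_deriv M X F G" "has_malliavin_deriv M X F' G'"
  shows "has_malliavin_deriv M X (\<lambda>\<omega>. a * F \<omega> + b * F' \<omega>) (\<lambda>\<omega>. a *\<^sub>R G \<omega> + b *\<^sub>R G' \<omega>)"
proof -
  have lin: "tendsto_Lp 2 M (\<lambda>n \<omega>. a *\<^sub>R Y n \<omega> + b *\<^sub>R Z n \<omega>) (\<lambda>\<omega>. a *\<^sub>R L \<omega> + b *\<^sub>R K \<omega>)"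
    if "tendsto_Lp 2 M Y L" "tendsto_Lp 2 M Z K"
    for Y Z :: "nat \<Rightarrow> 'a \<Rightarrow> 'v::{banach, second_countable_topology}" and L K
  proof (rule tendsto_Lp2I)
    note Y = tendsto_Lp2D[OF that(1)] and Z = tendsto_Lp2D[OF that(2)]
    show "(\<lambda>\<omega>. a *\<^sub>R Y n \<omega> + b *\<^sub>R Z n \<omega>) \<in> borel_measurable M" for n
      using Lp2D(1)[OF Y(1)] Lp2D(1)[OF Z(1)] by measurable
    show "(\<lambda>\<omega>. a *\<^sub>R L \<omega> + b *\<^sub>R K \<omega>) \<in> Lp 2 M"
      by (intro Lp2_add Lp2_scaleR Y(2) Z(2))
    show "norm (a *\<^sub>R Y n \<omega> + b *\<^sub>R Z n \<omega> - (a *\<^sub>R L \<omega> + b *\<^sub>R K \<omega>)) \<le>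
        \<bar>a\<bar> * norm (Y n \<omega> - L \<omega>) + \<bar>b\<bar> * norm (Z n \<omega> - K \<omega>)" for n \<omega>
    proof -
      have "a *\<^sub>R Y n \<omega> + b *\<^sub>R Z n \<omega> - (a *\<^sub>R L \<omega> + b *\<^sub>R K \<omega>) =
          a *\<^sub>R (Y n \<omega> - L \<omega>) + b *\<^sub>R (Z n \<omega> - K \<omega>)" by (simp add: algebra_simps)
      then show ?thesis by (metis norm_scaleR norm_triangle_ineq)
    qed
    show "integrable M (\<lambda>\<omega>. (\<bar>a\<bar> * norm (Y n \<omega> - L \<omega>))\<^sup>2)"
      "integrable M (\<lambda>\<omega>. (\<bar>b\<bar> * norm (Z n \<omega> - K \<omega>))\<^sup>2)" for n
      unfolding power_mult_distrib using Y(4) Z(4) by auto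
    show "(\<lambda>n. \<integral>\<omega>. (\<bar>a\<bar> * norm (Y n \<omega> - L \<omega>))\<^sup>2 \<partial>M) \<longlonglongrightarrow> 0"
      "(\<lambda>n. \<integral>\<omega>. (\<bar>b\<bar> * norm (Z n \<omega> - K \<omega>))\<^sup>2 \<partial>M) \<longlonglongrightarrow> 0"
      unfolding power_mult_distrib using tendsto_mult_left[OF Y(3), of "\<bar>a\<bar>\<^sup>2"]
        tendsto_mult_left[OF Z(3), of "\<bar>b\<bar>\<^sup>2"] by simp_all
  qed
  obtain Fs Gs where 1: "\<And>k. smooth_cylindrical X (Fs k) (Gs k)"
    "tendsto_Lp 2 M Fs F" "tendsto_Lp 2 M Gs G"
    using assms(1) unfolding has_malliavin_deriv_def by blast
  obtain Fs' Gs' where 2: "\<And>k. smooth_cylindrical X (Fs' k) (Gs' k)"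
    "tendsto_Lp 2 M Fs' F'" "tendsto_Lp 2 M Gs' G'"
    using assms(2) unfolding has_malliavin_deriv_def by blast
  show ?thesis
    unfolding has_malliavin_deriv_def
    using smooth_cylindrical_lincomb[OF 1(1) 2(1)] lin[OF 1(2) 2(2)] lin[OF 1(3) 2(3)]
    by (intro exI[of _ "\<lambda>k \<omega>. a * Fs k \<omega> + b * Fs' k \<omega>"]
        exI[of _ "\<lambda>k \<omega>. a *\<^sub>R Gs k \<omega> + b *\<^sub>R Gs' k \<omega>"]) auto
qed

text \<open>Composition with a function that is merely C^1 can leave the class of smooth
  functionals, so variable and function are approximated simultaneously by \<open>H k\<close>
  applied to \<open>Fs k\<close>. The common Lipschitz constant \<open>B + 1\<close> controls the
  change from \<open>Fs k\<close> to \<open>F\<close>; dominated convergence controls the change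
  from \<open>H k\<close> to \<open>h\<close>.\<close>

lemma has_malliavin_deriv_chain:
  assumes FG: "has_malliavin_deriv M X F G"
    and prob: "prob_space M"
    and h: "\<And>y. (h has_real_derivative h' y) (at y)" and h': "continuous_on UNIV h'"
    and bound: "\<And>y. \<bar>h' y\<bar> \<le> B"
  shows "has_malliavin_deriv M X (\<lambda>\<omega>. h (F \<omega>)) (\<lambda>\<omega>. h' (F \<omega>) *\<^sub>R G \<omega>)"
proof -
  interpret prob_space M by (rule prob)
  obtain Fs0 Gs0 where 0: "\<And>k. smooth_cylindrical X (Fs0 k) (Gs0 k)"
    "tendsto_Lp 2 M Fs0 F" "tendsto_Lp 2 M Gs0 G"
    using FG unfolding has_malliavin_deriv_def by blast
  \<comment> \<open>As \<open>h'\<close> is only continuous, its values at the approximants are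
    compared pointwise; this calls for almost everywhere convergence, after which dominated
    convergence returns to L^2.\<close>
  obtain r :: "nat \<Rightarrow> nat" where r: "strict_mono r" "AE \<omega> in M. (\<lambda>n. Fs0 (r n) \<omega>) \<longlonglongrightarrow> F \<omega>"
    using tendsto_Lp2_AE_subseq[OF 0(2)] by blast
  define Fs Gs where "Fs = (\<lambda>n. Fs0 (r n))" and "Gs = (\<lambda>n. Gs0 (r n))"
  have cyl: "smooth_cylindrical X (Fs k) (Gs k)" for k
    unfolding Fs_def Gs_def by (rule 0)
  have tF: "tendsto_Lp 2 M Fs F" and tG: "tendsto_Lp 2 M Gs G"
    unfolding Fs_def Gs_def using tendsto_Lp_subseq[OF 0(2) r(1)] tendsto_Lp_subseq[OF 0(3) r(1)] .
  have AE: "AE \<omega> in M. (\<lambda>n. Fs n \<omega>) \<longlonglongrightarrow> F \<omega>"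
    unfolding Fs_def by (rule r)
  note F = tendsto_Lp2D[OF tF] and G = tendsto_Lp2D[OF tG]
  have meas[measurable]: "F \<in> borel_measurable M" "G \<in> borel_measurable M"
    "\<And>k. Fs k \<in> borel_measurable M" "\<And>k. Gs k \<in> borel_measurable M"
    by (fact Lp2D(1)[OF F(2)] Lp2D(1)[OF G(2)] Lp2D(1)[OF F(1)] Lp2D(1)[OF G(1)])+
  obtain p H where p: "\<And>k. real_polynomial_function (p k)"
    and H: "\<And>k y. (H k has_real_derivative p k (arctan y)) (at y)"
    and pB: "\<And>k y. \<bar>p k (arctan y)\<bar> \<le> B + 1"
    and p_lim: "\<And>k y. \<bar>y\<bar> \<le> real k \<Longrightarrow> \<bar>p k (arctan y) - h' y\<bar> \<le> 1 / Suc k"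
    and H_lim: "\<And>k y. \<bar>y\<bar> \<le> real k \<Longrightarrow> \<bar>H k y - h y\<bar> \<le> \<bar>y\<bar> / Suc k"
    and H_le: "\<And>k y. \<bar>H k y - h y\<bar> \<le> (2 * B + 1) * \<bar>y\<bar>"
    and H0: "\<And>k. H k 0 = h 0"
    by (rule smooth_approx_C1[OF h h' bound], rule that)
  have B: "0 \<le> B" using bound[of 0] by linarith
  have H_lip: "\<bar>H k x - H k y\<bar> \<le> (B + 1) * \<bar>x - y\<bar>" for k x y
    using field_differentiable_bound[of UNIV "H k" "\<lambda>y. p k (arctan y)" "B + 1" x y] H pB by auto
  have H_growth: "\<bar>H k y\<bar> \<le> (\<bar>h 0\<bar> + (B + 1)) * (1 + \<bar>y\<bar>)" for k y
  proof -
    have "\<bar>H k y\<bar> \<le> \<bar>h 0\<bar> + (B + 1) * \<bar>y\<bar>" using H_lip[of k y 0] H0[of k] by simp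
    moreover have "0 \<le> \<bar>h 0\<bar> * \<bar>y\<bar>" by simp
    ultimately show ?thesis using B unfolding distrib_left distrib_right by linarith
  qed
  have h_lip: "\<bar>h x - h y\<bar> \<le> B * \<bar>x - y\<bar>" for x y
    using field_differentiable_bound[of UNIV h h' B x y] h bound by auto
  have cont: "continuous_on UNIV h" "continuous_on UNIV (H k)" "continuous_on UNIV (\<lambda>y. p k (arctan y))" for k
  proof -
    show "continuous_on UNIV h" "continuous_on UNIV (H k)"
      by (rule DERIV_continuous_on, rule has_field_derivative_at_within, rule h H)+
    show "continuous_on UNIV (\<lambda>y. p k (arctan y))"
      by (intro continuous_at_imp_continuous_on ballI
          isCont_o2[OF isCont_arctan continuous_real_polymonial_function[OF p]])
  qed
  have [measurable]: "h \<in> borel_measurable borel" "h' \<in> borel_measurable borel"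
    "H k \<in> borel_measurable borel" for k
    using cont h' by (simp_all add: borel_measurable_continuous_onI)
  have pFs[measurable]: "(\<lambda>\<omega>. p k (arctan (Fs j \<omega>))) \<in> borel_measurable M" for k j
    by (rule measurable_compose[OF meas(3) borel_measurable_continuous_onI[OF cont(3)]])
  have hF: "(\<lambda>\<omega>. h (F \<omega>)) \<in> Lp 2 M"
  proof -
    have "(\<lambda>\<omega>. h (F \<omega>) - h 0) \<in> Lp 2 M"
      by (rule Lp2_dominated[OF F(2), of _ B]) (use h_lip[of _ 0] in auto)
    moreover have "(\<lambda>\<omega>. h 0) \<in> Lp 2 M" by (simp add: Lp_def)
    ultimately show ?thesis using Lp2_add[of "\<lambda>\<omega>. h (F \<omega>) - h 0" M "\<lambda>\<omega>. h 0"] by simp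
  qed
  have hG: "(\<lambda>\<omega>. h' (F \<omega>) *\<^sub>R G \<omega>) \<in> Lp 2 M"
    by (rule Lp2_dominated[OF G(2), of _ B]) (use bound in \<open>auto intro: mult_right_mono\<close>)
  have "tendsto_Lp 2 M (\<lambda>k \<omega>. H k (Fs k \<omega>)) (\<lambda>\<omega>. h (F \<omega>))"
  proof (rule tendsto_Lp2I[where a="\<lambda>k \<omega>. (B + 1) * \<bar>Fs k \<omega> - F \<omega>\<bar>" and b="\<lambda>k \<omega>. \<bar>H k (F \<omega>) - h (F \<omega>)\<bar>"])
    show "norm (H k (Fs k \<omega>) - h (F \<omega>)) \<le> (B + 1) * \<bar>Fs k \<omega> - F \<omega>\<bar> + \<bar>H k (F \<omega>) - h (F \<omega>)\<bar>" for k \<omega>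
      using H_lip[of k "Fs k \<omega>" "F \<omega>"] by auto
    show "integrable M (\<lambda>\<omega>. ((B + 1) * \<bar>Fs k \<omega> - F \<omega>\<bar>)\<^sup>2)" for k
      using F(4)[of k] unfolding power_mult_distrib by simp
    show "(\<lambda>k. \<integral>\<omega>. ((B + 1) * \<bar>Fs k \<omega> - F \<omega>\<bar>)\<^sup>2 \<partial>M) \<longlonglongrightarrow> 0"
      using tendsto_mult_left[OF F(3), of "(B + 1)\<^sup>2"] unfolding power_mult_distrib by simp
    have dom: "\<bar>H k (F \<omega>) - h (F \<omega>)\<bar>\<^sup>2 \<le> (2 * B + 1)\<^sup>2 * (norm (F \<omega>))\<^sup>2" for k \<omega>
      using power_mono[OF H_le, of k "F \<omega>" 2] by (simp add: power_mult_distrib)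
    have dom_int: "integrable M (\<lambda>\<omega>. (2 * B + 1)\<^sup>2 * (norm (F \<omega>))\<^sup>2)"
      using Lp2D(2)[OF F(2)] by simp
    show "integrable M (\<lambda>\<omega>. \<bar>H k (F \<omega>) - h (F \<omega>)\<bar>\<^sup>2)" for k
      by (rule Bochner_Integration.integrable_bound[OF dom_int]) (use dom in auto)
    have "(\<lambda>k. \<integral>\<omega>. \<bar>H k (F \<omega>) - h (F \<omega>)\<bar>\<^sup>2 \<partial>M) \<longlonglongrightarrow> (\<integral>\<omega>. 0 \<partial>M)"
    proof (rule integral_dominated_convergence[OF _ _ dom_int])
      have "(\<lambda>k. \<bar>H k y - h y\<bar>\<^sup>2) \<longlonglongrightarrow> 0" for y
      proof -
        have "(\<lambda>k. H k y - h y) \<longlonglongrightarrow> 0"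
        proof (rule Lim_null_comparison)
          show "\<forall>\<^sub>F k in sequentially. norm (H k y - h y) \<le> \<bar>y\<bar> / Suc k"
            using eventually_ge_at_top[of "nat \<lceil>\<bar>y\<bar>\<rceil>"]
            by eventually_elim (use H_lim in \<open>auto simp: nat_ceiling_le_eq\<close>)
          show "(\<lambda>k. \<bar>y\<bar> / Suc k) \<longlonglongrightarrow> 0"
            by (intro real_tendsto_divide_at_top[OF tendsto_const]
                filterlim_compose[OF filterlim_real_sequentially filterlim_Suc])
        qed
        from tendsto_power[OF this, of 2] show ?thesis by simp
      qed
      then show "AE \<omega> in M. (\<lambda>k. \<bar>H k (F \<omega>) - h (F \<omega>)\<bar>\<^sup>2) \<longlonglongrightarrow> 0" by simp
      show "AE \<omega> in M. norm (\<bar>H k (F \<omega>) - h (F \<omega>)\<bar>\<^sup>2) \<le> (2 * B + 1)\<^sup>2 * (norm (F \<omega>))\<^sup>2" for k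
        using dom by simp
    qed measurable
    then show "(\<lambda>k. \<integral>\<omega>. \<bar>H k (F \<omega>) - h (F \<omega>)\<bar>\<^sup>2 \<partial>M) \<longlonglongrightarrow> 0" by simp
  qed (use hF in measurable)
  \<comment> \<open>The L^2 error of \<open>Gs k\<close> is multiplied by a bounded factor, while
    the error of that factor is multiplied by the fixed function \<open>G\<close>, which also
    supplies the dominating function.\<close>
  moreover have "tendsto_Lp 2 M (\<lambda>k \<omega>. p k (arctan (Fs k \<omega>)) *\<^sub>R Gs k \<omega>) (\<lambda>\<omega>. h' (F \<omega>) *\<^sub>R G \<omega>)"
  proof (rule tendsto_Lp2I[where a="\<lambda>k \<omega>. (B + 1) * norm (Gs k \<omega> - G \<omega>)"
        and b="\<lambda>k \<omega>. \<bar>p k (arctan (Fs k \<omega>)) - h' (F \<omega>)\<bar> * norm (G \<omega>)"])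
    show "norm (p k (arctan (Fs k \<omega>)) *\<^sub>R Gs k \<omega> - h' (F \<omega>) *\<^sub>R G \<omega>) \<le>
        (B + 1) * norm (Gs k \<omega> - G \<omega>) + \<bar>p k (arctan (Fs k \<omega>)) - h' (F \<omega>)\<bar> * norm (G \<omega>)" for k \<omega>
    proof -
      have "p k (arctan (Fs k \<omega>)) *\<^sub>R Gs k \<omega> - h' (F \<omega>) *\<^sub>R G \<omega> =
          p k (arctan (Fs k \<omega>)) *\<^sub>R (Gs k \<omega> - G \<omega>) + (p k (arctan (Fs k \<omega>)) - h' (F \<omega>)) *\<^sub>R G \<omega>"
        by (simp add: algebra_simps)
      also have "norm \<dots> \<le> \<bar>p k (arctan (Fs k \<omega>))\<bar> * norm (Gs k \<omega> - G \<omega>) +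
          \<bar>p k (arctan (Fs k \<omega>)) - h' (F \<omega>)\<bar> * norm (G \<omega>)"
        by (rule order_trans[OF norm_triangle_ineq]) simp
      also have "\<dots> \<le> (B + 1) * norm (Gs k \<omega> - G \<omega>) + \<bar>p k (arctan (Fs k \<omega>)) - h' (F \<omega>)\<bar> * norm (G \<omega>)"
        using pB by (intro add_right_mono mult_right_mono) auto
      finally show ?thesis .
    qed
    show "integrable M (\<lambda>\<omega>. ((B + 1) * norm (Gs k \<omega> - G \<omega>))\<^sup>2)" for k
      using G(4)[of k] unfolding power_mult_distrib by simp
    show "(\<lambda>k. \<integral>\<omega>. ((B + 1) * norm (Gs k \<omega> - G \<omega>))\<^sup>2 \<partial>M) \<longlonglongrightarrow> 0"
      using tendsto_mult_left[OF G(3), of "(B + 1)\<^sup>2"] unfolding power_mult_distrib by simp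
    have dom: "(\<bar>p k (arctan (Fs k \<omega>)) - h' (F \<omega>)\<bar> * norm (G \<omega>))\<^sup>2 \<le> (2 * B + 1)\<^sup>2 * (norm (G \<omega>))\<^sup>2" for k \<omega>
    proof -
      have "\<bar>p k (arctan (Fs k \<omega>)) - h' (F \<omega>)\<bar> \<le> 2 * B + 1"
        using pB[of k "Fs k \<omega>"] bound[of "F \<omega>"] by linarith
      then show ?thesis unfolding power_mult_distrib by (intro mult_right_mono power_mono) auto
    qed
    have dom_int: "integrable M (\<lambda>\<omega>. (2 * B + 1)\<^sup>2 * (norm (G \<omega>))\<^sup>2)"
      using Lp2D(2)[OF G(2)] by simp
    show "integrable M (\<lambda>\<omega>. (\<bar>p k (arctan (Fs k \<omega>)) - h' (F \<omega>)\<bar> * norm (G \<omega>))\<^sup>2)" for k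
      by (rule Bochner_Integration.integrable_bound[OF dom_int]) (use dom in auto)
    have "(\<lambda>k. \<integral>\<omega>. (\<bar>p k (arctan (Fs k \<omega>)) - h' (F \<omega>)\<bar> * norm (G \<omega>))\<^sup>2 \<partial>M) \<longlonglongrightarrow> (\<integral>\<omega>. 0 \<partial>M)"
    proof (rule integral_dominated_convergence[OF _ _ dom_int])
      show "AE \<omega> in M. (\<lambda>k. (\<bar>p k (arctan (Fs k \<omega>)) - h' (F \<omega>)\<bar> * norm (G \<omega>))\<^sup>2) \<longlonglongrightarrow> 0"
        using AE
      proof eventually_elim
        case (elim \<omega>)
        have "(\<lambda>k. p k (arctan (Fs k \<omega>)) - h' (Fs k \<omega>)) \<longlonglongrightarrow> 0"
        \<comment> \<open>The estimate for \<open>p k\<close> is available only on [-k, k].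
          Eventually \<open>Fs k \<omega>\<close> is smaller in modulus than
          \<open>\<bar>F \<omega>\<bar> + 1\<close>, hence than \<open>k\<close>.\<close>
        proof (rule Lim_null_comparison)
          have "\<forall>\<^sub>F k in sequentially. \<bar>Fs k \<omega>\<bar> < \<bar>F \<omega>\<bar> + 1"
            using tendsto_rabs[OF elim] by (rule order_tendstoD) simp
          with eventually_ge_at_top[of "nat \<lceil>\<bar>F \<omega>\<bar> + 1\<rceil>"]
          show "\<forall>\<^sub>F k in sequentially. norm (p k (arctan (Fs k \<omega>)) - h' (Fs k \<omega>)) \<le> 1 / Suc k"
          proof eventually_elim
            case (elim k)
            then have "\<bar>F \<omega>\<bar> + 1 \<le> real k" by (simp only: nat_ceiling_le_eq)
            with elim have "\<bar>Fs k \<omega>\<bar> \<le> real k" by linarith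
            from p_lim[OF this] show ?case by simp
          qed
          show "(\<lambda>k. 1 / Suc k) \<longlonglongrightarrow> 0"
            by (intro real_tendsto_divide_at_top[OF tendsto_const]
                filterlim_compose[OF filterlim_real_sequentially filterlim_Suc])
        qed
        moreover have "(\<lambda>k. h' (Fs k \<omega>)) \<longlonglongrightarrow> h' (F \<omega>)"
          using elim h' by (auto intro: isCont_tendsto_compose simp: continuous_on_eq_continuous_at)
        ultimately have "(\<lambda>k. p k (arctan (Fs k \<omega>)) - h' (F \<omega>)) \<longlonglongrightarrow> 0"
          using tendsto_add[of "\<lambda>k. p k (arctan (Fs k \<omega>)) - h' (Fs k \<omega>)" 0 sequentially
              "\<lambda>k. h' (Fs k \<omega>) - h' (F \<omega>)" 0] by (simp add: LIM_zero_iff)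
        then have "(\<lambda>k. (\<bar>p k (arctan (Fs k \<omega>)) - h' (F \<omega>)\<bar> * norm (G \<omega>))\<^sup>2) \<longlonglongrightarrow> (\<bar>0\<bar> * norm (G \<omega>))\<^sup>2"
          by (intro tendsto_intros)
        then show ?case by simp
      qed
      show "AE \<omega> in M. norm ((\<bar>p k (arctan (Fs k \<omega>)) - h' (F \<omega>)\<bar> * norm (G \<omega>))\<^sup>2) \<le>
          (2 * B + 1)\<^sup>2 * (norm (G \<omega>))\<^sup>2" for k
        using dom by simp
    qed measurable
    then show "(\<lambda>k. \<integral>\<omega>. (\<bar>p k (arctan (Fs k \<omega>)) - h' (F \<omega>)\<bar> * norm (G \<omega>))\<^sup>2 \<partial>M) \<longlonglongrightarrow> 0" by simp
  qed (use hG in measurable)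
  ultimately show ?thesis
    unfolding has_malliavin_deriv_def
    by (intro exI[of _ "\<lambda>k \<omega>. H k (Fs k \<omega>)"] exI[of _ "\<lambda>k \<omega>. p k (arctan (Fs k \<omega>)) *\<^sub>R Gs k \<omega>"] conjI allI
        smooth_cylindrical_compose[OF cyl p H H_growth])
qed

text \<open>The covariance identity does not settle integrability when \<open>h = 0\<close>, since a
  nonintegrable function also has Bochner integral 0. The Gaussian law of a one-element combination
  settles it for every \<open>h\<close>.\<close>

lemma isonormal_process_Lp2:
  assumes "prob_space M" "isonormal_process M X"
  shows "X h \<in> Lp 2 M"
proof -
  interpret prob_space M by (rule assms)
  have [measurable]: "X h \<in> borel_measurable M"
    using assms unfolding isonormal_process_def by blast
  have "\<forall>B c. finite B \<longrightarrow>
      (\<exists>\<sigma>\<ge>0. distr M borel (\<lambda>\<omega>. \<Sum>h\<in>B. c h * X h \<omega>) = normal_law 0 \<sigma>)"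
    using assms unfolding isonormal_process_def by blast
  from this[rule_format, of "{h}" "\<lambda>_. 1"] obtain \<sigma> where "0 \<le> \<sigma>"
    and \<sigma>: "distr M borel (X h) = normal_law 0 \<sigma>" by auto
  have "integrable (normal_law 0 \<sigma>) (\<lambda>x. x\<^sup>2)"
  proof (cases "\<sigma> = 0")
    case True
    then show ?thesis by (simp add: normal_law_def integrable_iff_bounded nn_integral_return)
  next
    case False
    with \<open>0 \<le> \<sigma>\<close> have "0 < \<sigma>" by simp
    from integrable_normal_moment[OF this, of 0 2] False show ?thesis
      by (simp add: normal_law_def integrable_density)
  qed
  then have "integrable (distr M borel (X h)) (\<lambda>x. x\<^sup>2)" by (simp add: \<sigma>)
  then have "integrable M (\<lambda>\<omega>. (X h \<omega>)\<^sup>2)"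
    by (subst (asm) integrable_distr_eq) auto
  then show ?thesis by (simp add: Lp_def)
qed

lemma has_malliavin_deriv_isonormal:
  assumes "prob_space M" "isonormal_process M X"
  shows "has_malliavin_deriv M X (X h) (\<lambda>\<omega>. h)"
proof -
  interpret prob_space M by (rule assms)
  have "partial_deriv 0 (\<lambda>x. x 0) = (\<lambda>x. 1)"
    by (rule partial_deriv_eqI) simp
  then have "smooth_cylindrical X (X h) (\<lambda>\<omega>. h)"
    unfolding smooth_cylindrical_def
    by (intro exI[of _ "Suc 0"] exI[of _ "\<lambda>x. x 0"] exI[of _ "\<lambda>_. h"])
      (simp add: smooth_poly_growth_coordinate)
  moreover have "tendsto_Lp 2 M (\<lambda>n. X h) (X h)"
    using isonormal_process_Lp2[OF assms] by (simp add: tendsto_Lp_def)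
  moreover have "tendsto_Lp 2 M (\<lambda>n \<omega>. h) (\<lambda>\<omega>. h)"
    by (simp add: tendsto_Lp_def Lp_def)
  ultimately show ?thesis
    unfolding has_malliavin_deriv_def
    by (intro exI[of _ "\<lambda>n. X h"] exI[of _ "\<lambda>n \<omega>. h"]) simp
qed

section \<open>Gaussian integration by parts\<close>

definition std_gauss :: "real measure" where
  "std_gauss = density lborel (\<lambda>x. ennreal (std_normal_density x))"

lemma sets_std_gauss[simp, measurable_cong]: "sets std_gauss = sets borel"
  and space_std_gauss[simp]: "space std_gauss = UNIV"
  by (simp_all add: std_gauss_def)

lemma prob_space_std_gauss: "prob_space std_gauss"
  unfolding std_gauss_def by (rule prob_space_normal_density) simp

lemma integrable_std_gauss_iff:
  fixes f :: "real \<Rightarrow> real"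
  assumes "f \<in> borel_measurable borel"
  shows "integrable std_gauss f \<longleftrightarrow> integrable lborel (\<lambda>x. std_normal_density x * f x)"
  unfolding std_gauss_def using assms by (subst integrable_density) auto

lemma integral_std_gauss:
  fixes f :: "real \<Rightarrow> real"
  assumes "f \<in> borel_measurable borel"
  shows "(\<integral>x. f x \<partial>std_gauss) = (\<integral>x. std_normal_density x * f x \<partial>lborel)"
  unfolding std_gauss_def using assms by (subst integral_density) auto

lemma id_Lp2_std_gauss: "(\<lambda>y. y) \<in> Lp 2 std_gauss"
  unfolding Lp_def using integrable_std_normal_moment[of 2] by (simp add: integrable_std_gauss_iff)

lemma has_derivative_growth:
  fixes f f' :: "real \<Rightarrow> real"
  assumes "\<And>y. (f has_real_derivative f' y) (at y)" "\<And>y. \<bar>f' y\<bar> \<le> B"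
  shows "\<bar>f y\<bar> \<le> \<bar>f 0\<bar> + B * \<bar>y\<bar>"
proof -
  have "norm (f y - f 0) \<le> B * norm (y - 0)"
    by (rule field_differentiable_bound[of UNIV]) (use assms in auto)
  then show ?thesis by simp
qed

text \<open>From exp x \<ge> 1 + x the density is at most 1/(1 + y^2/2), and (1 + |y|)|y| \<le> 3 (1
  + y^2/2) by completing a square. This makes the boundary terms of functions of linear growth
  vanish.\<close>

lemma std_normal_density_decay: "y \<noteq> 0 \<Longrightarrow> (1 + \<bar>y\<bar>) * std_normal_density y \<le> 3 * \<bar>inverse y\<bar>"
proof -
  assume "y \<noteq> 0"
  have "1 + y\<^sup>2 / 2 \<le> exp (y\<^sup>2 / 2)" by (rule exp_ge_add_one_self)
  moreover have "1 \<le> sqrt (2 * pi)" using pi_ge_two by simp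
  ultimately have "1 + y\<^sup>2 / 2 \<le> sqrt (2 * pi) * exp (y\<^sup>2 / 2)"
    using mult_mono[of 1 "sqrt (2 * pi)" "1 + y\<^sup>2 / 2" "exp (y\<^sup>2 / 2)"] by simp
  moreover have "0 < 1 + y\<^sup>2 / 2" by (simp add: add_pos_nonneg)
  ultimately have "inverse (sqrt (2 * pi) * exp (y\<^sup>2 / 2)) \<le> inverse (1 + y\<^sup>2 / 2)"
    by (rule le_imp_inverse_le)
  then have d: "std_normal_density y \<le> inverse (1 + y\<^sup>2 / 2)"
    by (simp add: std_normal_density_def exp_minus field_simps)
  have "(1 + \<bar>y\<bar>) * \<bar>y\<bar> \<le> 3 * (1 + y\<^sup>2 / 2)"
  proof -
    have "0 \<le> (\<bar>y\<bar> - 1)\<^sup>2" by simp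
    then show ?thesis by (simp add: power2_diff power2_eq_square algebra_simps)
  qed
  then have "(1 + \<bar>y\<bar>) * inverse (1 + y\<^sup>2 / 2) \<le> 3 * inverse \<bar>y\<bar>"
    using \<open>y \<noteq> 0\<close> \<open>0 < 1 + y\<^sup>2 / 2\<close> by (simp add: field_simps)
  moreover have "(1 + \<bar>y\<bar>) * std_normal_density y \<le> (1 + \<bar>y\<bar>) * inverse (1 + y\<^sup>2 / 2)"
    using d by (intro mult_left_mono) auto
  ultimately show ?thesis by simp
qed

text \<open>The density \<open>d\<close> satisfies d' = -y d, so (f d)' = f' d - y f d, and this
  integrates to 0 over the line. A bounded \<open>f'\<close> gives \<open>f\<close> linear growth,
  hence integrability and vanishing boundary values.\<close>

lemma gaussian_integration_by_parts:
  fixes f f' :: "real \<Rightarrow> real"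
  assumes f: "\<And>y. (f has_real_derivative f' y) (at y)" and f': "continuous_on UNIV f'"
    and bound: "\<And>y. \<bar>f' y\<bar> \<le> B"
  shows "(\<integral>y. f y * y \<partial>std_gauss) = (\<integral>y. f' y \<partial>std_gauss)"
proof -
  let ?d = std_normal_density
  have B: "0 \<le> B" using bound[of 0] by linarith
  note growth = has_derivative_growth[OF f bound]
  have cf: "continuous_on UNIV f"
    by (rule DERIV_continuous_on, rule has_field_derivative_at_within, rule f)
  have [measurable]: "f \<in> borel_measurable borel" "f' \<in> borel_measurable borel"
    using cf f' by (simp_all add: borel_measurable_continuous_onI)
  have int1: "integrable lborel (\<lambda>y. ?d y * f' y)"
  proof (rule Bochner_Integration.integrable_bound[of _ "\<lambda>y. B * ?d y"])
    show "AE y in lborel. norm (?d y * f' y) \<le> norm (B * ?d y)"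
      using bound B by (auto simp: abs_mult mult.commute intro!: mult_right_mono AE_I2)
  qed auto
  have int2: "integrable lborel (\<lambda>y. ?d y * (f y * y))"
  proof (rule Bochner_Integration.integrable_bound[of _ "\<lambda>y. \<bar>f 0\<bar> * (?d y * \<bar>y\<bar>^1) + B * (?d y * \<bar>y\<bar>^2)"])
    show "integrable lborel (\<lambda>y. \<bar>f 0\<bar> * (?d y * \<bar>y\<bar>^1) + B * (?d y * \<bar>y\<bar>^2))"
      using integrable_std_normal_moment_abs by (intro Bochner_Integration.integrable_add integrable_mult_right) blast+
    have "norm (?d y * (f y * y)) \<le> \<bar>f 0\<bar> * (?d y * \<bar>y\<bar>^1) + B * (?d y * \<bar>y\<bar>^2)" for y
    proof -
      have "norm (?d y * (f y * y)) = ?d y * (\<bar>f y\<bar> * \<bar>y\<bar>)" by (simp add: abs_mult)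
      also have "\<dots> \<le> ?d y * ((\<bar>f 0\<bar> + B * \<bar>y\<bar>) * \<bar>y\<bar>)"
        using growth by (intro mult_left_mono mult_right_mono) auto
      finally show ?thesis by (simp add: algebra_simps power2_eq_square)
    qed
    then show "AE y in lborel. norm (?d y * (f y * y)) \<le> norm (\<bar>f 0\<bar> * (?d y * \<bar>y\<bar>^1) + B * (?d y * \<bar>y\<bar>^2))"
      by (auto intro!: AE_I2 order_trans[OF _ abs_ge_self])
  qed measurable
  have dd: "(?d has_real_derivative - (y * ?d y)) (at y)" for y
    unfolding std_normal_density_def by (auto intro!: derivative_eq_intros simp: field_simps)
  have lim: "((\<lambda>y. f y * ?d y) \<longlongrightarrow> 0) at_infinity"
  proof (rule Lim_null_comparison)
    have "norm (f y * ?d y) \<le> (\<bar>f 0\<bar> + B) * (3 * \<bar>inverse y\<bar>)" if "y \<noteq> 0" for y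
    proof -
      have "norm (f y * ?d y) = \<bar>f y\<bar> * ?d y" by (simp add: abs_mult)
      also have "\<dots> \<le> ((\<bar>f 0\<bar> + B) * (1 + \<bar>y\<bar>)) * ?d y"
      proof (rule mult_right_mono)
        have "0 \<le> \<bar>f 0\<bar> * \<bar>y\<bar>" by simp
        with growth[of y] B show "\<bar>f y\<bar> \<le> (\<bar>f 0\<bar> + B) * (1 + \<bar>y\<bar>)"
          unfolding distrib_left distrib_right by linarith
      qed simp
      also have "\<dots> \<le> (\<bar>f 0\<bar> + B) * (3 * \<bar>inverse y\<bar>)"
        unfolding mult.assoc using std_normal_density_decay[OF that] B by (intro mult_left_mono) auto
      finally show ?thesis .
    qed
    then show "\<forall>\<^sub>F y in at_infinity. norm (f y * ?d y) \<le> (\<bar>f 0\<bar> + B) * (3 * \<bar>inverse y\<bar>)"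
      by (auto simp: eventually_at_infinity intro!: exI[of _ 1])
    have "((\<lambda>y. (\<bar>f 0\<bar> + B) * (3 * \<bar>inverse y\<bar>)) \<longlongrightarrow> (\<bar>f 0\<bar> + B) * (3 * \<bar>0\<bar>)) (at_infinity :: real filter)"
      by (intro tendsto_intros tendsto_inverse_0)
    then show "((\<lambda>y. (\<bar>f 0\<bar> + B) * (3 * \<bar>inverse y\<bar>)) \<longlongrightarrow> 0) (at_infinity :: real filter)" by simp
  qed
  have "(LBINT y=-\<infinity>..\<infinity>. ?d y * f' y - ?d y * (f y * y)) = 0 - 0"
  proof (rule interval_integral_FTC_integrable[where F="\<lambda>y. f y * ?d y"])
    show "((\<lambda>y. f y * ?d y) has_vector_derivative ?d y * f' y - ?d y * (f y * y)) (at y)" for y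
      using DERIV_mult[OF f dd, of y]
      by (simp add: has_real_derivative_iff_has_vector_derivative[symmetric] algebra_simps)
    have cd: "continuous_on UNIV ?d"
      unfolding std_normal_density_def by (intro continuous_intros) auto
    have "continuous_on UNIV (\<lambda>y. ?d y * f' y - ?d y * (f y * y))"
      by (intro continuous_intros cf f' cd)
    then show "isCont (\<lambda>y. ?d y * f' y - ?d y * (f y * y)) y" for y
      by (simp add: continuous_on_eq_continuous_at)
    show "set_integrable lborel (einterval (- \<infinity>) \<infinity>) (\<lambda>y. ?d y * f' y - ?d y * (f y * y))"
      using int1 int2 by (simp add: set_integrable_def)
    show "(((\<lambda>y. f y * ?d y) \<circ> real_of_ereal) \<longlongrightarrow> 0) (at_right (- \<infinity>))"
      "(((\<lambda>y. f y * ?d y) \<circ> real_of_ereal) \<longlongrightarrow> 0) (at_left \<infinity>)"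
      using tendsto_mono[OF at_bot_le_at_infinity lim] tendsto_mono[OF at_top_le_at_infinity lim]
      by (simp_all add: ereal_tendsto_simps)
  qed simp
  then have "(\<integral>y. ?d y * f' y - ?d y * (f y * y) \<partial>lborel) = 0"
    by (simp add: interval_lebesgue_integral_def set_lebesgue_integral_def)
  then show ?thesis
    using int1 int2 by (simp add: integral_std_gauss)
qed

text \<open>For fixed \<omega> the interpolation is affine in the Gaussian variable; the slope
  \<open>b\<close> that comes out is what later cancels the denominator in the derivative of the
  square root.\<close>

lemma gaussian_integration_by_parts_affine:
  fixes f f' :: "real \<Rightarrow> real"
  assumes f: "\<And>y. (f has_real_derivative f' y) (at y)" and f': "continuous_on UNIV f'"
    and bound: "\<And>y. \<bar>f' y\<bar> \<le> B"
  shows "(\<integral>y. f (a + b * y) * y \<partial>std_gauss) = b * (\<integral>y. f' (a + b * y) \<partial>std_gauss)"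
proof -
  have "(\<integral>y. f (a + b * y) * y \<partial>std_gauss) = (\<integral>y. f' (a + b * y) * b \<partial>std_gauss)"
  proof (rule gaussian_integration_by_parts)
    show "((\<lambda>y. f (a + b * y)) has_real_derivative f' (a + b * y) * b) (at y)" for y
      by (rule DERIV_chain2[OF f]) (auto intro!: derivative_eq_intros)
    show "continuous_on UNIV (\<lambda>y. f' (a + b * y) * b)"
      by (intro continuous_intros continuous_on_compose2[OF f']) auto
    show "\<bar>f' (a + b * y) * b\<bar> \<le> B * \<bar>b\<bar>" for y
      using bound by (simp add: abs_mult mult_right_mono)
  qed
  then show ?thesis by simp
qed

text \<open>The chain rule needs a \<open>C\<^sup>1\<close> function on the whole line, since the approximants of
  \<open>S\<^sup>2\<close> need not be nonnegative.\<close>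

lemma sqrt_C1_extension:
  fixes \<epsilon> :: real
  assumes "0 < \<epsilon>"
  obtains h h' :: "real \<Rightarrow> real" where "\<And>v. (h has_real_derivative h' v) (at v)"
    "continuous_on UNIV h'" "\<And>v. \<bar>h' v\<bar> \<le> inverse (2 * sqrt \<epsilon>)"
    "\<And>v. 0 \<le> v \<Longrightarrow> h v = sqrt (v + \<epsilon>)" "\<And>v. 0 \<le> v \<Longrightarrow> h' v = inverse (2 * sqrt (v + \<epsilon>))"
proof -
  \<comment> \<open>For negative \<open>v\<close> the slope keeps its value at 0, so sqrt(v +
    \<epsilon>) is continued by its tangent line and 1/(2 sqrt(\<epsilon>)) bounds the slope
    globally.\<close>
  define h' where "h' = (\<lambda>v. inverse (2 * sqrt (max 0 v + \<epsilon>)))"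
  have pos: "0 < max 0 v + \<epsilon>" for v using assms by (simp add: add_nonneg_pos)
  then have cont: "continuous_on UNIV h'"
    unfolding h'_def by (intro continuous_intros) (auto simp: less_imp_neq[symmetric])
  then have "\<exists>H. \<forall>v. (H has_real_derivative h' v) (at v)"
    using einterval_antiderivative[of "-\<infinity>" \<infinity> h']
    by (auto simp: has_real_derivative_iff_has_vector_derivative continuous_on_eq_continuous_at)
  then obtain H where H: "\<And>v. (H has_real_derivative h' v) (at v)" by blast
  define h where "h = (\<lambda>v. H v - H 0 + sqrt \<epsilon>)"
  have h: "(h has_real_derivative h' v) (at v)" for v
    unfolding h_def using DERIV_add[OF DERIV_diff[OF H DERIV_const] DERIV_const] by simp
  have "h v = sqrt (v + \<epsilon>)" if v: "0 \<le> v" for v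
  proof -
    have "norm ((h v - sqrt (v + \<epsilon>)) - (h 0 - sqrt (0 + \<epsilon>))) \<le> 0 * norm (v - 0)"
    proof (rule field_differentiable_bound[of "{0..}"])
      fix z :: real assume z: "z \<in> {0..}"
      then have "((\<lambda>v. sqrt (v + \<epsilon>)) has_real_derivative h' z) (at z)"
        using assms by (auto intro!: derivative_eq_intros simp: h'_def)
      from DERIV_diff[OF h this]
      show "((\<lambda>v. h v - sqrt (v + \<epsilon>)) has_real_derivative 0) (at z within {0..})"
        by (simp add: has_field_derivative_at_within)
    qed (use v in auto)
    then show ?thesis by (simp add: h_def)
  qed
  moreover have "\<bar>h' v\<bar> \<le> inverse (2 * sqrt \<epsilon>)" for v
    unfolding h'_def using assms pos[of v] by (simp add: le_imp_inverse_le)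
  moreover have "0 \<le> v \<Longrightarrow> h' v = inverse (2 * sqrt (v + \<epsilon>))" for v
    by (simp add: h'_def)
  ultimately show thesis using that h cont by blast
qed

section \<open>Integrability of products\<close>

lemma Lp2_mult_integrable:
  fixes f g :: "'a \<Rightarrow> real"
  assumes "f \<in> Lp 2 M" "g \<in> Lp 2 M"
  shows "integrable M (\<lambda>\<omega>. f \<omega> * g \<omega>)"
proof (rule Bochner_Integration.integrable_bound)
  show "integrable M (\<lambda>\<omega>. (norm (f \<omega>))\<^sup>2 + (norm (g \<omega>))\<^sup>2)"
    using Lp2D(2)[OF assms(1)] Lp2D(2)[OF assms(2)] by auto
  show "(\<lambda>\<omega>. f \<omega> * g \<omega>) \<in> borel_measurable M"
    using Lp2D(1)[OF assms(1)] Lp2D(1)[OF assms(2)] by measurable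
  have "\<bar>f \<omega> * g \<omega>\<bar> \<le> (f \<omega>)\<^sup>2 + (g \<omega>)\<^sup>2" for \<omega>
  proof -
    have "2 * \<bar>f \<omega>\<bar> * \<bar>g \<omega>\<bar> \<le> \<bar>f \<omega>\<bar>\<^sup>2 + \<bar>g \<omega>\<bar>\<^sup>2" by (rule sum_squares_bound)
    moreover have "0 \<le> \<bar>f \<omega>\<bar> * \<bar>g \<omega>\<bar>" by simp
    ultimately show ?thesis unfolding abs_mult power2_abs by linarith
  qed
  then show "AE \<omega> in M. norm (f \<omega> * g \<omega>) \<le> norm ((norm (f \<omega>))\<^sup>2 + (norm (g \<omega>))\<^sup>2)"
    by (intro AE_I2) simp
qed

lemma Lp2_inner_integrable:
  fixes f g :: "'a \<Rightarrow> 'h::{real_inner, banach, second_countable_topology}"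
  assumes "f \<in> Lp 2 M" "g \<in> Lp 2 M"
  shows "integrable M (\<lambda>\<omega>. f \<omega> \<bullet> g \<omega>)"
proof (rule Bochner_Integration.integrable_bound)
  have n: "(\<lambda>\<omega>. norm (f \<omega>)) \<in> Lp 2 M" "(\<lambda>\<omega>. norm (g \<omega>)) \<in> Lp 2 M"
    using assms by (auto simp: Lp_def)
  show "integrable M (\<lambda>\<omega>. norm (f \<omega>) * norm (g \<omega>))" by (rule Lp2_mult_integrable[OF n])
  show "(\<lambda>\<omega>. f \<omega> \<bullet> g \<omega>) \<in> borel_measurable M"
    using Lp2D(1)[OF assms(1)] Lp2D(1)[OF assms(2)] by measurable
  show "AE \<omega> in M. norm (f \<omega> \<bullet> g \<omega>) \<le> norm (norm (f \<omega>) * norm (g \<omega>))"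
    by (intro AE_I2) (simp add: Cauchy_Schwarz_ineq2)
qed

lemma (in pair_sigma_finite) integrable_times:
  fixes f g :: "_ \<Rightarrow> real"
  assumes f: "integrable M1 f" and g: "integrable M2 g"
  shows "integrable (M1 \<Otimes>\<^sub>M M2) (\<lambda>z. f (fst z) * g (snd z))"
proof (rule Fubini_integrable)
  have [measurable]: "f \<in> borel_measurable M1" "g \<in> borel_measurable M2" using f g by auto
  show "(\<lambda>z. f (fst z) * g (snd z)) \<in> borel_measurable (M1 \<Otimes>\<^sub>M M2)" by measurable
  have "(\<lambda>x. \<integral>y. norm (f (fst (x, y)) * g (snd (x, y))) \<partial>M2) = (\<lambda>x. \<bar>f x\<bar> * (\<integral>y. \<bar>g y\<bar> \<partial>M2))"
    by (simp add: abs_mult)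
  then show "integrable M1 (\<lambda>x. \<integral>y. norm (f (fst (x, y)) * g (snd (x, y))) \<partial>M2)"
    using f by simp
  show "AE x in M1. integrable M2 (\<lambda>y. f (fst (x, y)) * g (snd (x, y)))"
    using g by simp
qed

section \<open>Interpolation\<close>

lemma integral_abs_le:
  fixes f g :: "'a \<Rightarrow> real"
  assumes "integrable M f" "integrable M g" "\<And>x. \<bar>f x\<bar> \<le> g x"
  shows "\<bar>\<integral>x. f x \<partial>M\<bar> \<le> (\<integral>x. g x \<partial>M)"
proof -
  have "\<bar>\<integral>x. f x \<partial>M\<bar> \<le> (\<integral>x. \<bar>f x\<bar> \<partial>M)" by (rule integral_abs_bound)
  also have "\<dots> \<le> (\<integral>x. g x \<partial>M)" by (rule integral_mono) (use assms in auto)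
  finally show ?thesis .
qed

text \<open>\<open>V\<close> stands for the square of \<open>S\<close>, and \<open>W\<close> for the
  test exponent, which is 0 in the quantitative bound. Explicit derivatives and bounds let the same
  estimates serve a general \<phi> as well as rescaled sine and cosine; keeping \<epsilon> a
  parameter allows the locale to be instantiated again with smaller values.\<close>

locale gaussian_interpolation =
  fixes M :: "'a measure" and X :: "'h::{real_inner, banach, second_countable_topology} \<Rightarrow> 'a \<Rightarrow> real"
    and F V W :: "'a \<Rightarrow> real" and DF DV DW u :: "'a \<Rightarrow> 'h"
    and \<phi> \<phi>1 \<phi>2 \<phi>3 :: "real \<Rightarrow> real" and B2 B3 \<epsilon> :: real
  assumes prob: "prob_space M"
    and F: "has_malliavin_deriv M X F DF"
    and V: "has_malliavin_deriv M X V DV"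
    and W: "has_malliavin_deriv M X W DW"
    and divergence: "has_divergence M X u F"
    and V_nonneg: "\<And>\<omega>. 0 \<le> V \<omega>"
    and \<epsilon>: "0 < \<epsilon>"
    and \<phi>1: "\<And>x. (\<phi> has_real_derivative \<phi>1 x) (at x)"
    and \<phi>2: "\<And>x. (\<phi>1 has_real_derivative \<phi>2 x) (at x)"
    and \<phi>3: "\<And>x. (\<phi>2 has_real_derivative \<phi>3 x) (at x)"
    and \<phi>3_cont: "continuous_on UNIV \<phi>3"
    and B2: "\<And>x. \<bar>\<phi>2 x\<bar> \<le> B2"
    and B3: "\<And>x. \<bar>\<phi>3 x\<bar> \<le> B3"
begin

sublocale prob_space M by (rule prob)
sublocale G: prob_space std_gauss by (rule prob_space_std_gauss)
sublocale Q: pair_prob_space M std_gauss ..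

abbreviation Q where "Q \<equiv> M \<Otimes>\<^sub>M std_gauss"

definition sd where "sd \<omega> = sqrt (V \<omega> + \<epsilon>)"

definition Y where "Y \<theta> z = W (fst z) + sin \<theta> * F (fst z) + cos \<theta> * (sd (fst z) * snd z)"

section \<open>Integrability on the product with the Gaussian line\<close>

lemma B2_nonneg: "0 \<le> B2" and B3_nonneg: "0 \<le> B3"
  using B2[of 0] B3[of 0] by linarith+

lemma u_Lp2: "u \<in> Lp 2 M"
  using divergence by (simp add: has_divergence_def)

lemmas Lp2 = has_malliavin_derivD[OF F] has_malliavin_derivD[OF V] has_malliavin_derivD[OF W] u_Lp2

lemma meas [measurable]:
  "F \<in> borel_measurable M" "V \<in> borel_measurable M" "W \<in> borel_measurable M"
  "DF \<in> borel_measurable M" "DV \<in> borel_measurable M" "DW \<in> borel_measurable M"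
  "u \<in> borel_measurable M" "sd \<in> borel_measurable M"
proof -
  show [measurable]: "V \<in> borel_measurable M" by (rule Lp2D(1)[OF Lp2(3)])
  show "sd \<in> borel_measurable M" unfolding sd_def[abs_def] by measurable
qed (rule Lp2D(1), rule Lp2)+

lemma cont: "continuous_on UNIV \<phi>" "continuous_on UNIV \<phi>1" "continuous_on UNIV \<phi>2"
  by (rule DERIV_continuous_on, rule has_field_derivative_at_within, rule \<phi>1 \<phi>2 \<phi>3)+

lemma meas_\<phi> [measurable]:
  "\<phi> \<in> borel_measurable borel" "\<phi>1 \<in> borel_measurable borel"
  "\<phi>2 \<in> borel_measurable borel" "\<phi>3 \<in> borel_measurable borel"
  by (rule borel_measurable_continuous_onI, rule cont \<phi>3_cont)+

lemma Y_meas [measurable]: "Y \<theta> \<in> borel_measurable Q"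
  unfolding Y_def[abs_def] by measurable

lemma sd_pos: "0 < sd \<omega>" and sd_ge: "sqrt \<epsilon> \<le> sd \<omega>" and sd_sq: "(sd \<omega>)\<^sup>2 = V \<omega> + \<epsilon>"
  using V_nonneg[of \<omega>] \<epsilon> by (simp_all add: sd_def)

lemma V_integrable: "integrable M V"
  using Lp2_mult_integrable[OF Lp2(3), of "\<lambda>_. 1"] by (simp add: Lp_def)

lemma sd_Lp2: "sd \<in> Lp 2 M"
  using V_integrable by (simp add: Lp_def sd_sq)

lemma const_Lp2_Q: "(\<lambda>z. c) \<in> Lp 2 Q" for c :: real
  by (simp add: Lp_def)

lemma lift_integrable:
  assumes "integrable M f"
  shows "integrable Q (\<lambda>z. f (fst z) :: real)"
  using Q.integrable_times[OF assms, of "\<lambda>_. 1"] by simp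

lemma lift_Lp2:
  fixes f :: "'a \<Rightarrow> real"
  assumes "f \<in> Lp 2 M"
  shows "(\<lambda>z. f (fst z)) \<in> Lp 2 Q"
  using Lp2D[OF assms] lift_integrable[of "\<lambda>\<omega>. (norm (f \<omega>))\<^sup>2"] by (simp add: Lp_def)

lemma sdy_Lp2: "(\<lambda>z. sd (fst z) * snd z) \<in> Lp 2 Q"
  using Q.integrable_times[OF Lp2D(2)[OF sd_Lp2] Lp2D(2)[OF id_Lp2_std_gauss]]
  by (simp add: Lp_def power_mult_distrib)

lemma Y_Lp2: "Y \<theta> \<in> Lp 2 Q"
  unfolding Y_def[abs_def]
  using Lp2_add[OF Lp2_add[OF lift_Lp2[OF Lp2(5)] Lp2_scaleR[OF lift_Lp2[OF Lp2(1)], of "sin \<theta>"]]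
      Lp2_scaleR[OF sdy_Lp2, of "cos \<theta>"]] by simp

lemma abs_Lp2: "f \<in> Lp 2 N \<Longrightarrow> (\<lambda>z. \<bar>f z\<bar>) \<in> Lp 2 N" for f :: "'b \<Rightarrow> real"
  by (auto simp: Lp_def)

lemma \<phi>1_growth: "\<bar>\<phi>1 x\<bar> \<le> \<bar>\<phi>1 0\<bar> + B2 * \<bar>x\<bar>"
  by (rule has_derivative_growth[OF \<phi>2 B2])

text \<open>A bounded second derivative gives quadratic growth; this is why square integrability of
  the argument suffices for the expectation of \<phi> to exist.\<close>

lemma \<phi>_growth: "\<bar>\<phi> x\<bar> \<le> \<bar>\<phi> 0\<bar> + (\<bar>\<phi>1 0\<bar> + B2 * \<bar>x\<bar>) * \<bar>x\<bar>"
proof -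
  have "norm (\<phi> x - \<phi> 0) \<le> (\<bar>\<phi>1 0\<bar> + B2 * \<bar>x\<bar>) * norm (x - 0)"
  proof (rule field_differentiable_bound[of "{- \<bar>x\<bar>..\<bar>x\<bar>}"])
    fix z assume z: "z \<in> {- \<bar>x\<bar>..\<bar>x\<bar>}"
    show "(\<phi> has_real_derivative \<phi>1 z) (at z within {- \<bar>x\<bar>..\<bar>x\<bar>})"
      using \<phi>1 by (rule has_field_derivative_at_within)
    have "B2 * \<bar>z\<bar> \<le> B2 * \<bar>x\<bar>" using z B2_nonneg by (intro mult_left_mono) auto
    then show "norm (\<phi>1 z) \<le> \<bar>\<phi>1 0\<bar> + B2 * \<bar>x\<bar>" using \<phi>1_growth[of z] by simp
  qed auto
  then show ?thesis by simp
qed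

lemma \<phi>_integrable:
  assumes "f \<in> Lp 2 N" "prob_space N"
  shows "integrable N (\<lambda>z. \<phi> (f z))"
proof -
  interpret N: prob_space N by (rule assms)
  note [measurable] = Lp2D(1)[OF assms(1)]
  have f: "integrable N f" using Lp2_mult_integrable[OF assms(1), of "\<lambda>_. 1"] by (simp add: Lp_def)
  show ?thesis
  proof (rule Bochner_Integration.integrable_bound)
    show "integrable N (\<lambda>z. \<bar>\<phi> 0\<bar> + \<bar>\<phi>1 0\<bar> * \<bar>f z\<bar> + B2 * (norm (f z))\<^sup>2)"
      using f Lp2D(2)[OF assms(1)] by simp
    have "norm (\<phi> x) \<le> norm (\<bar>\<phi> 0\<bar> + \<bar>\<phi>1 0\<bar> * \<bar>x\<bar> + B2 * (norm x)\<^sup>2)" for x :: real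
    proof -
      have "norm (\<phi> x) \<le> \<bar>\<phi> 0\<bar> + \<bar>\<phi>1 0\<bar> * \<bar>x\<bar> + B2 * (norm x)\<^sup>2"
        using \<phi>_growth[of x] by (simp add: algebra_simps power2_eq_square)
      also have "\<dots> \<le> norm \<dots>" by simp
      finally show ?thesis .
    qed
    then show "AE z in N. norm (\<phi> (f z)) \<le> norm (\<bar>\<phi> 0\<bar> + \<bar>\<phi>1 0\<bar> * \<bar>f z\<bar> + B2 * (norm (f z))\<^sup>2)"
      by (intro AE_I2)
  qed measurable
qed

lemma \<phi>1_Lp2: "(\<lambda>z. \<phi>1 (Y \<theta> z)) \<in> Lp 2 Q"
proof (rule Lp2_dominated[where c=1])
  show "(\<lambda>z. \<bar>\<phi>1 0\<bar> + B2 *\<^sub>R \<bar>Y \<theta> z\<bar>) \<in> Lp 2 Q"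
    by (intro Lp2_add const_Lp2_Q Lp2_scaleR abs_Lp2 Y_Lp2)
  show "norm (\<phi>1 (Y \<theta> z)) \<le> 1 * norm (\<bar>\<phi>1 0\<bar> + B2 *\<^sub>R \<bar>Y \<theta> z\<bar>)" for z
    using order_trans[OF \<phi>1_growth abs_ge_self] by simp
qed measurable

lemma bounded_times_integrable:
  fixes a g :: "'b \<Rightarrow> real"
  assumes "integrable N a" "g \<in> borel_measurable N" "\<And>z. \<bar>g z\<bar> \<le> B"
  shows "integrable N (\<lambda>z. g z * a z)"
proof (rule Bochner_Integration.integrable_bound)
  show "integrable N (\<lambda>z. B * a z)" using assms by simp
  show "AE z in N. norm (g z * a z) \<le> norm (B * a z)"
    using order_trans[OF assms(3) abs_ge_self] by (auto simp: abs_mult intro!: AE_I2 mult_right_mono)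
qed (use assms in measurable)

lemma \<phi>2_integrable: "integrable Q a \<Longrightarrow> integrable Q (\<lambda>z. \<phi>2 (Y \<theta> z) * a z)"
  and \<phi>3_integrable: "integrable Q a \<Longrightarrow> integrable Q (\<lambda>z. \<phi>3 (Y \<theta> z) * a z)"
  by (rule bounded_times_integrable[where B=B2], use B2 in measurable)
    (rule bounded_times_integrable[where B=B3], use B3 in measurable)

lemma inner_integrable:
  "integrable M (\<lambda>\<omega>. DF \<omega> \<bullet> u \<omega>)" "integrable M (\<lambda>\<omega>. DV \<omega> \<bullet> u \<omega>)" "integrable M (\<lambda>\<omega>. DW \<omega> \<bullet> u \<omega>)"
  by (rule Lp2_inner_integrable; rule Lp2)+

text \<open>The inner product of \<open>u\<close> with the Malliavin derivative of
  \<open>sd\<close>, as given by the chain rule for the square root.\<close>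

definition c where "c \<omega> = (DV \<omega> \<bullet> u \<omega>) * inverse (2 * sd \<omega>)"

lemma c_integrable: "integrable M c"
proof -
  have "integrable M (\<lambda>\<omega>. inverse (2 * sd \<omega>) * (DV \<omega> \<bullet> u \<omega>))"
  proof (rule bounded_times_integrable[OF inner_integrable(2)])
    show "\<bar>inverse (2 * sd \<omega>)\<bar> \<le> inverse (2 * sqrt \<epsilon>)" for \<omega>
      using sd_pos[of \<omega>] sd_ge[of \<omega>] \<epsilon> by (simp add: le_imp_inverse_le)
  qed measurable
  then show ?thesis by (simp add: c_def[abs_def] mult.commute)
qed

lemma cy_integrable: "integrable Q (\<lambda>z. c (fst z) * snd z)"
proof -
  have "integrable std_gauss (\<lambda>y. y)"
    using Lp2_mult_integrable[OF id_Lp2_std_gauss, of "\<lambda>_. 1"] by (simp add: Lp_def)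
  from Q.integrable_times[OF c_integrable this] show ?thesis .
qed

section \<open>Duality and Gaussian integration by parts along the path\<close>

text \<open>With \<open>y\<close> frozen, \<open>Y\<close> is a linear combination of
  \<open>W\<close>, \<open>F\<close> and \<open>sd\<close>. One chain rule differentiates
  \<open>sd\<close>, another differentiates \<open>\<phi>1\<close> of the combination, and the
  divergence identity then replaces the factor \<open>F\<close> by the inner product with
  \<open>u\<close>.\<close>

lemma duality_slice:
  "(\<integral>\<omega>. \<phi>1 (Y \<theta> (\<omega>, y)) * F \<omega> \<partial>M) =
   (\<integral>\<omega>. \<phi>2 (Y \<theta> (\<omega>, y)) * (DW \<omega> \<bullet> u \<omega> + sin \<theta> * (DF \<omega> \<bullet> u \<omega>) + cos \<theta> * (c \<omega> * y)) \<partial>M)"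
proof -
  obtain h h' where h: "\<And>v. (h has_real_derivative h' v) (at v)" "continuous_on UNIV h'"
    "\<And>v. \<bar>h' v\<bar> \<le> inverse (2 * sqrt \<epsilon>)"
    and h_eq: "\<And>v. 0 \<le> v \<Longrightarrow> h v = sqrt (v + \<epsilon>)" "\<And>v. 0 \<le> v \<Longrightarrow> h' v = inverse (2 * sqrt (v + \<epsilon>))"
    using sqrt_C1_extension[OF \<epsilon>] by blast
  \<comment> \<open>\<open>V\<close> is nonnegative, so the C^1 extension agrees with the square
    root at all values it takes.\<close>
  have "has_malliavin_deriv M X sd (\<lambda>\<omega>. inverse (2 * sd \<omega>) *\<^sub>R DV \<omega>)"
    using has_malliavin_deriv_chain[OF V prob h] V_nonneg by (simp add: h_eq sd_def[abs_def])
  from has_malliavin_deriv_lincomb[OF F this, of "sin \<theta>" "cos \<theta> * y"]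
  have "has_malliavin_deriv M X (\<lambda>\<omega>. 1 * W \<omega> + 1 * (sin \<theta> * F \<omega> + cos \<theta> * y * sd \<omega>))
      (\<lambda>\<omega>. 1 *\<^sub>R DW \<omega> + 1 *\<^sub>R (sin \<theta> *\<^sub>R DF \<omega> + (cos \<theta> * y) *\<^sub>R inverse (2 * sd \<omega>) *\<^sub>R DV \<omega>))"
    by (rule has_malliavin_deriv_lincomb[OF W])
  moreover have "1 * W \<omega> + 1 * (sin \<theta> * F \<omega> + cos \<theta> * y * sd \<omega>) = Y \<theta> (\<omega>, y)" for \<omega>
    by (simp add: Y_def)
  ultimately have "has_malliavin_deriv M X (\<lambda>\<omega>. Y \<theta> (\<omega>, y))
      (\<lambda>\<omega>. DW \<omega> + (sin \<theta> *\<^sub>R DF \<omega> + (cos \<theta> * y) *\<^sub>R inverse (2 * sd \<omega>) *\<^sub>R DV \<omega>))"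
    by simp
  from has_malliavin_deriv_chain[OF this prob \<phi>2 cont(3) B2]
  have "(\<integral>\<omega>. \<phi>1 (Y \<theta> (\<omega>, y)) * F \<omega> \<partial>M) = (\<integral>\<omega>. (\<phi>2 (Y \<theta> (\<omega>, y)) *\<^sub>R
      (DW \<omega> + (sin \<theta> *\<^sub>R DF \<omega> + (cos \<theta> * y) *\<^sub>R inverse (2 * sd \<omega>) *\<^sub>R DV \<omega>))) \<bullet> u \<omega> \<partial>M)"
    using divergence unfolding has_divergence_def by blast
  also have "\<dots> = (\<integral>\<omega>. \<phi>2 (Y \<theta> (\<omega>, y)) *
      (DW \<omega> \<bullet> u \<omega> + sin \<theta> * (DF \<omega> \<bullet> u \<omega>) + cos \<theta> * (c \<omega> * y)) \<partial>M)"
    by (intro Bochner_Integration.integral_cong refl)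
      (simp add: inner_add_left c_def algebra_simps)
  finally show ?thesis .
qed

lemma Y_affine: "Y \<theta> (\<omega>, y) = (W \<omega> + sin \<theta> * F \<omega>) + (cos \<theta> * sd \<omega>) * y"
  by (simp add: Y_def)

text \<open>Integration by parts in \<open>y\<close> for fixed \<omega>: the slope
  \<open>cos \<theta> * sd \<omega>\<close> meets the factor \<open>sd \<omega>\<close> already
  present and gives V + \<epsilon>, the quantity to be compared with the inner product of
  \<open>DF\<close> and \<open>u\<close>.\<close>

lemma parts_sd:
  "(\<integral>z. \<phi>1 (Y \<theta> z) * (sd (fst z) * snd z) \<partial>Q) = cos \<theta> * (\<integral>z. \<phi>2 (Y \<theta> z) * (sd (fst z))\<^sup>2 \<partial>Q)"
proof -
  have i: "integrable Q (\<lambda>z. \<phi>1 (Y \<theta> z) * (sd (fst z) * snd z))"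
    by (rule Lp2_mult_integrable[OF \<phi>1_Lp2 sdy_Lp2])
  have i2: "integrable Q (\<lambda>z. \<phi>2 (Y \<theta> z) * (sd (fst z))\<^sup>2)"
    using lift_integrable[OF Lp2D(2)[OF sd_Lp2]] by (intro \<phi>2_integrable) simp
  have "(\<integral>z. \<phi>1 (Y \<theta> z) * (sd (fst z) * snd z) \<partial>Q) =
      (\<integral>\<omega>. (\<integral>y. sd \<omega> * (\<phi>1 (Y \<theta> (\<omega>, y)) * y) \<partial>std_gauss) \<partial>M)"
    by (subst Q.integral_fst'[OF i, symmetric]) (simp add: mult_ac)
  also have "\<dots> = (\<integral>\<omega>. sd \<omega> * (cos \<theta> * sd \<omega> * (\<integral>y. \<phi>2 (Y \<theta> (\<omega>, y)) \<partial>std_gauss)) \<partial>M)"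
    unfolding Y_affine by (simp add: gaussian_integration_by_parts_affine[OF \<phi>2 cont(3) B2])
  also have "\<dots> = (\<integral>\<omega>. (\<integral>y. cos \<theta> * (\<phi>2 (Y \<theta> (\<omega>, y)) * (sd \<omega>)\<^sup>2) \<partial>std_gauss) \<partial>M)"
    by (intro Bochner_Integration.integral_cong refl) (simp add: power2_eq_square)
  also have "\<dots> = cos \<theta> * (\<integral>z. \<phi>2 (Y \<theta> z) * (sd (fst z))\<^sup>2 \<partial>Q)"
    by (subst Q.integral_fst'[OF i2, symmetric]) simp
  finally show ?thesis .
qed

text \<open>The slope supplies a factor \<open>sd\<close> that cancels the denominator of
  \<open>c\<close> and leaves half of the inner product of \<open>DV\<close> and \<open>u\<close>;
  no negative power of \<epsilon> remains.\<close>

lemma parts_c: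
  "(\<integral>z. \<phi>2 (Y \<theta> z) * (c (fst z) * snd z) \<partial>Q) =
   cos \<theta> / 2 * (\<integral>z. \<phi>3 (Y \<theta> z) * (DV (fst z) \<bullet> u (fst z)) \<partial>Q)"
proof -
  have i: "integrable Q (\<lambda>z. \<phi>2 (Y \<theta> z) * (c (fst z) * snd z))"
    by (rule \<phi>2_integrable[OF cy_integrable])
  have i2: "integrable Q (\<lambda>z. \<phi>3 (Y \<theta> z) * (DV (fst z) \<bullet> u (fst z)))"
    by (rule \<phi>3_integrable[OF lift_integrable[OF inner_integrable(2)]])
  have "(\<integral>z. \<phi>2 (Y \<theta> z) * (c (fst z) * snd z) \<partial>Q) =
      (\<integral>\<omega>. (\<integral>y. c \<omega> * (\<phi>2 (Y \<theta> (\<omega>, y)) * y) \<partial>std_gauss) \<partial>M)"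
    by (subst Q.integral_fst'[OF i, symmetric]) (simp add: mult_ac)
  also have "\<dots> = (\<integral>\<omega>. c \<omega> * (cos \<theta> * sd \<omega> * (\<integral>y. \<phi>3 (Y \<theta> (\<omega>, y)) \<partial>std_gauss)) \<partial>M)"
    unfolding Y_affine by (simp add: gaussian_integration_by_parts_affine[OF \<phi>3 \<phi>3_cont B3])
  also have "\<dots> = (\<integral>\<omega>. cos \<theta> / 2 * (\<integral>y. \<phi>3 (Y \<theta> (\<omega>, y)) * (DV \<omega> \<bullet> u \<omega>) \<partial>std_gauss) \<partial>M)"
    using sd_pos by (intro Bochner_Integration.integral_cong refl)
      (simp add: c_def field_simps less_imp_neq[symmetric])
  also have "\<dots> = cos \<theta> / 2 * (\<integral>z. \<phi>3 (Y \<theta> z) * (DV (fst z) \<bullet> u (fst z)) \<partial>Q)"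
    by (subst Q.integral_fst'[OF i2, symmetric]) simp
  finally show ?thesis .
qed

text \<open>Duality is available for each fixed \<open>y\<close>, so here the integral over \<omega>
  is taken first, whereas Gaussian integration by parts requires the opposite order.\<close>

lemma parts_F:
  "(\<integral>z. \<phi>1 (Y \<theta> z) * F (fst z) \<partial>Q) =
   (\<integral>z. \<phi>2 (Y \<theta> z) * (DW (fst z) \<bullet> u (fst z)) \<partial>Q) +
   sin \<theta> * (\<integral>z. \<phi>2 (Y \<theta> z) * (DF (fst z) \<bullet> u (fst z)) \<partial>Q) +
   (cos \<theta>)\<^sup>2 / 2 * (\<integral>z. \<phi>3 (Y \<theta> z) * (DV (fst z) \<bullet> u (fst z)) \<partial>Q)"
proof -
  note iW = \<phi>2_integrable[OF lift_integrable[OF inner_integrable(3)], of \<theta>]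
    and iF = \<phi>2_integrable[OF lift_integrable[OF inner_integrable(1)], of \<theta>]
    and ic = \<phi>2_integrable[OF cy_integrable, of \<theta>]
  let ?k = "\<lambda>z. \<phi>2 (Y \<theta> z) * (DW (fst z) \<bullet> u (fst z)) + sin \<theta> * (\<phi>2 (Y \<theta> z) * (DF (fst z) \<bullet> u (fst z)))
    + cos \<theta> * (\<phi>2 (Y \<theta> z) * (c (fst z) * snd z))"
  have i: "integrable Q (\<lambda>z. \<phi>1 (Y \<theta> z) * F (fst z))"
    by (rule Lp2_mult_integrable[OF \<phi>1_Lp2 lift_Lp2[OF Lp2(1)]])
  have ik: "integrable Q ?k" using iW iF ic by simp
  have "(\<integral>z. \<phi>1 (Y \<theta> z) * F (fst z) \<partial>Q) = (\<integral>y. (\<integral>\<omega>. \<phi>1 (Y \<theta> (\<omega>, y)) * F \<omega> \<partial>M) \<partial>std_gauss)"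
    using Q.integral_snd[of "\<lambda>\<omega> y. \<phi>1 (Y \<theta> (\<omega>, y)) * F \<omega>"] i by (simp add: case_prod_beta')
  also have "\<dots> = (\<integral>y. (\<integral>\<omega>. ?k (\<omega>, y) \<partial>M) \<partial>std_gauss)"
    unfolding duality_slice
    by (intro Bochner_Integration.integral_cong refl) (simp add: algebra_simps)
  also have "\<dots> = (\<integral>z. ?k z \<partial>Q)"
    using Q.integral_snd[of "\<lambda>\<omega> y. ?k (\<omega>, y)"] ik by (simp add: case_prod_beta')
  also have "\<dots> = (\<integral>z. \<phi>2 (Y \<theta> z) * (DW (fst z) \<bullet> u (fst z)) \<partial>Q) +
      sin \<theta> * (\<integral>z. \<phi>2 (Y \<theta> z) * (DF (fst z) \<bullet> u (fst z)) \<partial>Q) +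
      cos \<theta> * (\<integral>z. \<phi>2 (Y \<theta> z) * (c (fst z) * snd z) \<partial>Q)"
    using iW iF ic by simp
  finally show ?thesis by (simp add: parts_c power2_eq_square)
qed

section \<open>Estimates for the derivative in the angle and their integration\<close>

abbreviation "EW \<equiv> (\<integral>\<omega>. \<bar>DW \<omega> \<bullet> u \<omega>\<bar> \<partial>M)"
abbreviation "EF \<equiv> (\<integral>\<omega>. \<bar>DF \<omega> \<bullet> u \<omega> - (V \<omega> + \<epsilon>)\<bar> \<partial>M)"
abbreviation "EV \<equiv> (\<integral>\<omega>. \<bar>DV \<omega> \<bullet> u \<omega>\<bar> \<partial>M)"

lemma integral_lift:
  fixes f :: "'a \<Rightarrow> real"
  assumes "integrable M f"
  shows "(\<integral>z. f (fst z) \<partial>Q) = (\<integral>\<omega>. f \<omega> \<partial>M)"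
  by (subst Q.integral_fst'[OF lift_integrable[OF assms], symmetric]) (simp add: G.prob_space[unfolded space_std_gauss])

lemma bounded_times_integral:
  fixes a :: "'a \<Rightarrow> real"
  assumes a: "integrable M a" and g: "g \<in> borel_measurable Q" "\<And>z. \<bar>g z\<bar> \<le> B"
  shows "\<bar>\<integral>z. g z * a (fst z) \<partial>Q\<bar> \<le> B * (\<integral>\<omega>. \<bar>a \<omega>\<bar> \<partial>M)"
proof -
  have "\<bar>\<integral>z. g z * a (fst z) \<partial>Q\<bar> \<le> (\<integral>z. B * \<bar>a (fst z)\<bar> \<partial>Q)"
  proof (rule integral_abs_le)
    show "integrable Q (\<lambda>z. g z * a (fst z))"
      by (rule bounded_times_integrable[OF lift_integrable[OF a] g])
    show "integrable Q (\<lambda>z. B * \<bar>a (fst z)\<bar>)"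
      using lift_integrable[OF a] by simp
    show "\<bar>g z * a (fst z)\<bar> \<le> B * \<bar>a (fst z)\<bar>" for z
      using g(2) by (simp add: abs_mult mult_right_mono)
  qed
  also have "\<dots> = B * (\<integral>\<omega>. \<bar>a \<omega>\<bar> \<partial>M)"
    using integral_lift[of "\<lambda>\<omega>. \<bar>a \<omega>\<bar>"] a by simp
  finally show ?thesis .
qed

text \<open>The inner product of \<open>DF\<close> and \<open>u\<close> from \<open>parts_F\<close>
  and the square of \<open>sd\<close> from \<open>parts_sd\<close> carry the same coefficient sin
  \<theta> cos \<theta> with opposite signs, so only their difference matters. On [0, pi/2] all
  trigonometric factors are nonnegative and can be pulled out of absolute values.\<close>

lemma velocity_integral_bound:
  assumes "0 \<le> \<theta>" "\<theta> \<le> pi / 2"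
  shows "\<bar>\<integral>z. \<phi>1 (Y \<theta> z) * (cos \<theta> * F (fst z) - sin \<theta> * (sd (fst z) * snd z)) \<partial>Q\<bar> \<le>
    cos \<theta> * (B2 * EW) + sin \<theta> * cos \<theta> * (B2 * EF) + (cos \<theta>) ^ 3 / 2 * (B3 * EV)"
proof -
  have s: "0 \<le> sin \<theta>" "0 \<le> cos \<theta>"
    using assms sin_ge_zero[of \<theta>] cos_ge_zero[of \<theta>] by auto
  let ?D = "\<integral>z. \<phi>1 (Y \<theta> z) * (cos \<theta> * F (fst z) - sin \<theta> * (sd (fst z) * snd z)) \<partial>Q"
  let ?T1 = "\<integral>z. \<phi>2 (Y \<theta> z) * (DW (fst z) \<bullet> u (fst z)) \<partial>Q"
  let ?TF = "\<integral>z. \<phi>2 (Y \<theta> z) * (DF (fst z) \<bullet> u (fst z)) \<partial>Q"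
  let ?TV = "\<integral>z. \<phi>2 (Y \<theta> z) * (sd (fst z))\<^sup>2 \<partial>Q"
  let ?T3 = "\<integral>z. \<phi>3 (Y \<theta> z) * (DV (fst z) \<bullet> u (fst z)) \<partial>Q"
  let ?T2 = "\<integral>z. \<phi>2 (Y \<theta> z) * (DF (fst z) \<bullet> u (fst z) - (V (fst z) + \<epsilon>)) \<partial>Q"
  have iFu: "integrable M (\<lambda>\<omega>. DF \<omega> \<bullet> u \<omega> - (V \<omega> + \<epsilon>))"
    using inner_integrable(1) V_integrable by simp
  have T2: "?T2 = ?TF - ?TV"
    using \<phi>2_integrable[OF lift_integrable[OF inner_integrable(1)]]
      \<phi>2_integrable[OF lift_integrable[of "\<lambda>\<omega>. V \<omega> + \<epsilon>"]] V_integrable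
    by (simp add: right_diff_distrib sd_sq)
  have "?D =
      (\<integral>z. cos \<theta> * (\<phi>1 (Y \<theta> z) * F (fst z)) - sin \<theta> * (\<phi>1 (Y \<theta> z) * (sd (fst z) * snd z)) \<partial>Q)"
    by (intro Bochner_Integration.integral_cong refl) (simp add: algebra_simps)
  also have "\<dots> = cos \<theta> * (\<integral>z. \<phi>1 (Y \<theta> z) * F (fst z) \<partial>Q)
      - sin \<theta> * (\<integral>z. \<phi>1 (Y \<theta> z) * (sd (fst z) * snd z) \<partial>Q)"
    using Lp2_mult_integrable[OF \<phi>1_Lp2[of \<theta>] lift_Lp2[OF Lp2(1)]]
      Lp2_mult_integrable[OF \<phi>1_Lp2[of \<theta>] sdy_Lp2] by simp
  also have "\<dots> = cos \<theta> * ?T1 + sin \<theta> * cos \<theta> * ?T2 + (cos \<theta>) ^ 3 / 2 * ?T3"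
    unfolding parts_F parts_sd T2 by (simp add: algebra_simps power2_eq_square power3_eq_cube)
  finally have D: "?D = cos \<theta> * ?T1 + sin \<theta> * cos \<theta> * ?T2 + (cos \<theta>) ^ 3 / 2 * ?T3" .
  have "\<bar>?D\<bar> \<le> cos \<theta> * \<bar>?T1\<bar> + sin \<theta> * cos \<theta> * \<bar>?T2\<bar> + (cos \<theta>) ^ 3 / 2 * \<bar>?T3\<bar>"
  proof -
    have "\<bar>a + b + c\<bar> \<le> \<bar>a\<bar> + \<bar>b\<bar> + \<bar>c\<bar>" for a b c :: real by linarith
    from this[of "cos \<theta> * ?T1" "sin \<theta> * cos \<theta> * ?T2" "(cos \<theta>) ^ 3 / 2 * ?T3"]
    show ?thesis unfolding D using s by (simp add: abs_mult)
  qed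
  also have "\<dots> \<le> cos \<theta> * (B2 * EW) + sin \<theta> * cos \<theta> * (B2 * EF) + (cos \<theta>) ^ 3 / 2 * (B3 * EV)"
  proof -
    have "\<bar>?T1\<bar> \<le> B2 * EW" "\<bar>?T2\<bar> \<le> B2 * EF" "\<bar>?T3\<bar> \<le> B3 * EV"
      using bounded_times_integral[where g="\<lambda>z. \<phi>2 (Y \<theta> z)", OF inner_integrable(3) _ B2]
        bounded_times_integral[where g="\<lambda>z. \<phi>2 (Y \<theta> z)", OF iFu _ B2]
        bounded_times_integral[where g="\<lambda>z. \<phi>3 (Y \<theta> z)", OF inner_integrable(2) _ B3] by simp_all
    then show ?thesis
      using s by (intro add_mono mult_left_mono mult_nonneg_nonneg divide_nonneg_nonneg zero_le_power) auto
  qed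
  finally show ?thesis .
qed

text \<open>Justifies exchanging the integral over the angle with the expectation. Both
  \<open>Y\<close> and its angular derivative are bounded by the angle-free function
  \<open>w\<close> in L^2, and \<open>\<phi>1\<close> grows linearly, so the integrand is dominated
  by an integrable function on a bounded interval of angles.\<close>

lemma velocity_integrable:
  "integrable (Q \<Otimes>\<^sub>M lborel) (\<lambda>p. indicator {0..pi / 2} (snd p) *
     (\<phi>1 (Y (snd p) (fst p)) * (cos (snd p) * F (fst (fst p)) - sin (snd p) * (sd (fst (fst p)) * snd (fst p)))))"
proof -
  interpret R: pair_sigma_finite Q lborel ..
  define w where "w z = \<bar>W (fst z)\<bar> + \<bar>F (fst z)\<bar> + \<bar>sd (fst z) * snd z\<bar>" for z
  have [measurable]: "(\<lambda>p. Y (snd p) (fst p)) \<in> borel_measurable (Q \<Otimes>\<^sub>M lborel)"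
    unfolding Y_def by measurable
  have w: "w \<in> Lp 2 Q"
    unfolding w_def[abs_def] by (intro Lp2_add abs_Lp2 lift_Lp2 Lp2 sdy_Lp2)
  have "(\<lambda>z. \<bar>\<phi>1 0\<bar> + B2 *\<^sub>R w z) \<in> Lp 2 Q"
    by (intro Lp2_add const_Lp2_Q Lp2_scaleR w)
  from Lp2_mult_integrable[OF this w]
  have i: "integrable (Q \<Otimes>\<^sub>M lborel) (\<lambda>p. ((\<bar>\<phi>1 0\<bar> + B2 *\<^sub>R w (fst p)) * w (fst p)) * indicator {0..pi / 2} (snd p))"
    by (rule R.integrable_times) (simp add: emeasure_lborel_Icc_eq)
  have le: "norm (indicator {0..pi / 2} (snd p) *
     (\<phi>1 (Y (snd p) (fst p)) * (cos (snd p) * F (fst (fst p)) - sin (snd p) * (sd (fst (fst p)) * snd (fst p)))))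
     \<le> norm (((\<bar>\<phi>1 0\<bar> + B2 *\<^sub>R w (fst p)) * w (fst p)) * indicator {0..pi / 2} (snd p))"
    for p :: "('a \<times> real) \<times> real"
  proof -
    obtain z \<theta> where p: "p = (z, \<theta>)" by (cases p)
    have sc: "\<bar>sin \<theta>\<bar> * \<bar>x\<bar> \<le> \<bar>x\<bar>" "\<bar>cos \<theta>\<bar> * \<bar>x\<bar> \<le> \<bar>x\<bar>" for x :: real
      by (simp_all add: mult_left_le_one_le)
    have "\<bar>Y \<theta> z\<bar> \<le> w z"
      unfolding Y_def w_def
      using sc(1)[of "F (fst z)"] sc(2)[of "sd (fst z) * snd z"] by (simp only: abs_mult[symmetric])
    then have "\<bar>\<phi>1 (Y \<theta> z)\<bar> \<le> \<bar>\<phi>1 0\<bar> + B2 * w z"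
      using B2_nonneg by (intro order_trans[OF \<phi>1_growth] add_left_mono mult_left_mono)
    moreover have "\<bar>cos \<theta> * F (fst z) - sin \<theta> * (sd (fst z) * snd z)\<bar> \<le> w z"
      unfolding w_def
      using sc(2)[of "F (fst z)"] sc(1)[of "sd (fst z) * snd z"] by (simp only: abs_mult[symmetric])
    ultimately have "\<bar>\<phi>1 (Y \<theta> z) * (cos \<theta> * F (fst z) - sin \<theta> * (sd (fst z) * snd z))\<bar> \<le> (\<bar>\<phi>1 0\<bar> + B2 * w z) * w z"
      unfolding abs_mult[of "\<phi>1 (Y \<theta> z)"] by (intro mult_mono) (auto intro: order_trans[OF abs_ge_zero])
    then show ?thesis
      unfolding p by (auto simp: indicator_def intro: order_trans[OF _ abs_ge_self])
  qed
  show ?thesis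
    by (rule Bochner_Integration.integrable_bound[OF i _ AE_I2[OF le]]) measurable
qed

lemma regularized_bound:
  "\<bar>(\<integral>\<omega>. \<phi> (W \<omega> + F \<omega>) \<partial>M) - (\<integral>z. \<phi> (W (fst z) + sd (fst z) * snd z) \<partial>Q)\<bar> \<le>
    B2 * EW + B2 / 2 * EF + B3 / 3 * EV"
proof -
  interpret R: pair_sigma_finite Q lborel ..
  let ?lhs = "(\<integral>\<omega>. \<phi> (W \<omega> + F \<omega>) \<partial>M) - (\<integral>z. \<phi> (W (fst z) + sd (fst z) * snd z) \<partial>Q)"
  let ?v = "\<lambda>\<theta> z. \<phi>1 (Y \<theta> z) * (cos \<theta> * F (fst z) - sin \<theta> * (sd (fst z) * snd z))"
  let ?f = "\<lambda>z \<theta>. indicator {0..pi / 2} \<theta> * ?v \<theta> z"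
  let ?K' = "\<lambda>\<theta>. cos \<theta> * (B2 * EW) + sin \<theta> * cos \<theta> * (B2 * EF) + (cos \<theta>) ^ 3 / 2 * (B3 * EV)"
  \<comment> \<open>An antiderivative of \<open>?K'\<close>, using cos^3 = cos - cos sin^2. Its
    increment over [0, pi/2] produces the coefficients 1, 1/2 and (1 - 1/3)/2 = 1/3.\<close>
  let ?K = "\<lambda>\<theta>. sin \<theta> * (B2 * EW) + (sin \<theta>)\<^sup>2 / 2 * (B2 * EF) + (sin \<theta> - (sin \<theta>) ^ 3 / 3) / 2 * (B3 * EV)"
  have int: "integrable (Q \<Otimes>\<^sub>M lborel) (\<lambda>(z, \<theta>). ?f z \<theta>)"
    using velocity_integrable by (simp add: case_prod_beta')
  have ftc: "(\<integral>\<theta>. ?f z \<theta> \<partial>lborel) = \<phi> (Y (pi / 2) z) - \<phi> (Y 0 z)" for z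
  proof -
    have dY: "((\<lambda>\<theta>. Y \<theta> z) has_real_derivative cos \<theta> * F (fst z) - sin \<theta> * (sd (fst z) * snd z)) (at \<theta>)" for \<theta>
      unfolding Y_def by (auto intro!: derivative_eq_intros)
    have "(\<integral>\<theta>. ?v \<theta> z * indicator {0..pi / 2} \<theta> \<partial>lborel) = \<phi> (Y (pi / 2) z) - \<phi> (Y 0 z)"
    proof (rule integral_FTC_Icc_real)
      show "((\<lambda>\<theta>. \<phi> (Y \<theta> z)) has_real_derivative ?v \<theta> z) (at \<theta>)" for \<theta>
        by (rule DERIV_chain2[OF \<phi>1 dY])
      have "isCont (\<lambda>\<theta>. Y \<theta> z) \<theta>" for \<theta> using DERIV_isCont[OF dY] .
      then have "isCont (\<lambda>\<theta>. \<phi>1 (Y \<theta> z)) \<theta>" for \<theta>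
        by (rule isCont_o2) (rule DERIV_isCont[OF \<phi>2])
      then show "isCont (\<lambda>\<theta>. ?v \<theta> z) \<theta>" for \<theta>
        by (intro continuous_intros) auto
    qed simp
    then show ?thesis by (simp add: mult.commute)
  qed
  have Y1: "Y (pi / 2) z = W (fst z) + F (fst z)" and Y0: "Y 0 z = W (fst z) + sd (fst z) * snd z" for z
    by (simp_all add: Y_def)
  have iY: "integrable Q (\<lambda>z. \<phi> (Y \<theta> z))" for \<theta>
    by (rule \<phi>_integrable[OF Y_Lp2]) (rule Q.P.prob_space_axioms)
  have WF: "integrable M (\<lambda>\<omega>. \<phi> (W \<omega> + F \<omega>))"
    by (rule \<phi>_integrable[OF Lp2_add[OF Lp2(5) Lp2(1)] prob])
  have "?lhs =
      (\<integral>z. \<phi> (Y (pi / 2) z) \<partial>Q) - (\<integral>z. \<phi> (Y 0 z) \<partial>Q)"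
    unfolding Y1 Y0 using integral_lift[OF WF] by simp
  also have "\<dots> = (\<integral>z. \<phi> (Y (pi / 2) z) - \<phi> (Y 0 z) \<partial>Q)"
    using iY by simp
  also have "\<dots> = (\<integral>\<theta>. (\<integral>z. ?f z \<theta> \<partial>Q) \<partial>lborel)"
    unfolding ftc[symmetric] using R.Fubini_integral[OF int] by simp
  finally have lhs: "?lhs = (\<integral>\<theta>. (\<integral>z. ?f z \<theta> \<partial>Q) \<partial>lborel)" .
  have "\<bar>?lhs\<bar> \<le> (\<integral>\<theta>. ?K' \<theta> * indicator {0..pi / 2} \<theta> \<partial>lborel)"
    unfolding lhs
  proof (rule integral_abs_le)
    show "integrable lborel (\<lambda>\<theta>. \<integral>z. ?f z \<theta> \<partial>Q)"
      by (rule R.integrable_snd[OF int])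
    show "integrable lborel (\<lambda>\<theta>. ?K' \<theta> * indicator {0..pi / 2} \<theta>)"
    proof -
      have "continuous_on {0..pi / 2} ?K'" by (intro continuous_intros) auto
      from borel_integrable_atLeastAtMost'[OF this] show ?thesis
        by (simp add: set_integrable_def mult.commute)
    qed
    show "\<bar>\<integral>z. ?f z \<theta> \<partial>Q\<bar> \<le> ?K' \<theta> * indicator {0..pi / 2} \<theta>" for \<theta>
      using velocity_integral_bound[of \<theta>] by (cases "\<theta> \<in> {0..pi / 2}") simp_all
  qed
  also have "\<dots> = ?K (pi / 2) - ?K 0"
  proof (rule integral_FTC_Icc_real[where F="?K" and f="?K'"])
    show "(?K has_real_derivative ?K' \<theta>) (at \<theta>)" for \<theta>
    proof -
      have "(cos \<theta>) ^ 3 = cos \<theta> - cos \<theta> * (sin \<theta>)\<^sup>2"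
        unfolding sin_squared_eq by (simp add: algebra_simps power2_eq_square power3_eq_cube)
      then have K': "?K' \<theta> = cos \<theta> * (B2 * EW) + 2 * sin \<theta> * cos \<theta> / 2 * (B2 * EF) +
          (cos \<theta> - 3 * (sin \<theta>)\<^sup>2 * cos \<theta> / 3) / 2 * (B3 * EV)"
        by (simp add: mult.commute)
      show ?thesis
        unfolding K' by (auto intro!: derivative_eq_intros)
    qed
    show "isCont ?K' \<theta>" for \<theta> by (intro continuous_intros) auto
  qed simp
  also have "\<dots> = B2 * EW + B2 / 2 * EF + B3 / 3 * EV"
    by simp
  finally show ?thesis .
qed

end

section \<open>Stable convergence\<close>

context gaussian_interpolation
begin

text \<open>Regularization by \<open>e k\<close> enlarges the right-hand side by at most
  \<open>B2 / 2 * e k\<close>, and the regularized expectation converges by dominated convergence,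
  so the bound passes to the limit.\<close>

lemma bound_without_regularization:
  "\<bar>(\<integral>\<omega>. \<phi> (W \<omega> + F \<omega>) \<partial>M) - (\<integral>z. \<phi> (W (fst z) + sqrt (V (fst z)) * snd z) \<partial>Q)\<bar> \<le>
    B2 * EW + B2 / 2 * (\<integral>\<omega>. \<bar>DF \<omega> \<bullet> u \<omega> - V \<omega>\<bar> \<partial>M) + B3 / 3 * EV"
proof -
  \<comment> \<open>All members are at most \<epsilon>, so \<open>sd\<close>, which is built with
    \<epsilon>, dominates every regularized square root; the function \<open>m\<close> below relies
    on this.\<close>
  define e where "e k = \<epsilon> / real (Suc k)" for k
  have e: "0 < e k" "e k \<le> \<epsilon>" for k
    using \<epsilon> by (auto simp: e_def field_simps)
  have e0: "e \<longlonglongrightarrow> 0"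
    unfolding e_def[abs_def]
    by (intro real_tendsto_divide_at_top[OF tendsto_const]
        filterlim_compose[OF filterlim_real_sequentially filterlim_Suc])
  let ?a = "\<integral>\<omega>. \<phi> (W \<omega> + F \<omega>) \<partial>M"
  let ?g = "\<lambda>k z. \<phi> (W (fst z) + sqrt (V (fst z) + e k) * snd z)"
  let ?E = "\<integral>\<omega>. \<bar>DF \<omega> \<bullet> u \<omega> - V \<omega>\<bar> \<partial>M"
  have step: "\<bar>?a - (\<integral>z. ?g k z \<partial>Q)\<bar> \<le> B2 * EW + B2 / 2 * (?E + e k) + B3 / 3 * EV" for k
  proof -
    interpret I: gaussian_interpolation M X F V W DF DV DW u \<phi> \<phi>1 \<phi>2 \<phi>3 B2 B3 "e k"
      by unfold_locales (fact F V W divergence V_nonneg e(1) \<phi>1 \<phi>2 \<phi>3 \<phi>3_cont B2 B3)+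
    have i: "integrable M (\<lambda>\<omega>. \<bar>DF \<omega> \<bullet> u \<omega> - V \<omega>\<bar>)"
      using inner_integrable(1) V_integrable by simp
    have i2: "integrable M (\<lambda>\<omega>. \<bar>DF \<omega> \<bullet> u \<omega> - (V \<omega> + e k)\<bar>)"
      using inner_integrable(1) V_integrable by simp
    have "(\<integral>\<omega>. \<bar>DF \<omega> \<bullet> u \<omega> - (V \<omega> + e k)\<bar> \<partial>M) \<le> (\<integral>\<omega>. \<bar>DF \<omega> \<bullet> u \<omega> - V \<omega>\<bar> + e k \<partial>M)"
    proof (rule integral_mono[OF i2])
      show "integrable M (\<lambda>\<omega>. \<bar>DF \<omega> \<bullet> u \<omega> - V \<omega>\<bar> + e k)" using i by simp
      show "\<bar>DF \<omega> \<bullet> u \<omega> - (V \<omega> + e k)\<bar> \<le> \<bar>DF \<omega> \<bullet> u \<omega> - V \<omega>\<bar> + e k" for \<omega>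
        using e(1)[of k] by linarith
    qed
    also have "\<dots> = ?E + e k" using i by (simp add: prob_space)
    finally have "B2 / 2 * (\<integral>\<omega>. \<bar>DF \<omega> \<bullet> u \<omega> - (V \<omega> + e k)\<bar> \<partial>M) \<le> B2 / 2 * (?E + e k)"
      using B2_nonneg by (intro mult_left_mono) auto
    with I.regularized_bound show ?thesis unfolding I.sd_def by linarith
  qed
  have "(\<lambda>k. \<integral>z. ?g k z \<partial>Q) \<longlonglongrightarrow> (\<integral>z. \<phi> (W (fst z) + sqrt (V (fst z)) * snd z) \<partial>Q)"
  proof -
    define m where "m z = \<bar>W (fst z)\<bar> + \<bar>sd (fst z) * snd z\<bar>" for z
    have m: "m \<in> Lp 2 Q"
      unfolding m_def[abs_def] by (intro Lp2_add abs_Lp2 lift_Lp2 Lp2 sdy_Lp2)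
    have "(\<lambda>z. \<bar>\<phi>1 0\<bar> + B2 *\<^sub>R m z) \<in> Lp 2 Q"
      by (intro Lp2_add const_Lp2_Q Lp2_scaleR m)
    from Lp2_mult_integrable[OF this m]
    have w: "integrable Q (\<lambda>z. \<bar>\<phi> 0\<bar> + (\<bar>\<phi>1 0\<bar> + B2 *\<^sub>R m z) * m z)" by simp
    have le: "\<bar>?g k z\<bar> \<le> \<bar>\<phi> 0\<bar> + (\<bar>\<phi>1 0\<bar> + B2 *\<^sub>R m z) * m z" for k z
    proof -
      let ?x = "W (fst z) + sqrt (V (fst z) + e k) * snd z"
      have "\<bar>sqrt (V (fst z) + e k) * snd z\<bar> \<le> \<bar>sd (fst z) * snd z\<bar>"
        unfolding abs_mult sd_def using e[of k] V_nonneg[of "fst z"] by (intro mult_right_mono) auto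
      then have x: "\<bar>?x\<bar> \<le> m z" unfolding m_def by linarith
      have "\<bar>\<phi> ?x\<bar> \<le> \<bar>\<phi> 0\<bar> + (\<bar>\<phi>1 0\<bar> + B2 * \<bar>?x\<bar>) * \<bar>?x\<bar>" by (rule \<phi>_growth)
      also have "\<dots> \<le> \<bar>\<phi> 0\<bar> + (\<bar>\<phi>1 0\<bar> + B2 * m z) * m z"
        using x B2_nonneg by (intro add_left_mono mult_mono mult_left_mono) auto
      finally show ?thesis by simp
    qed
    show ?thesis
    proof (rule integral_dominated_convergence[OF _ _ w])
      have "isCont \<phi> x" for x using DERIV_isCont[OF \<phi>1] .
      then have "(\<lambda>k. ?g k z) \<longlonglongrightarrow> \<phi> (W (fst z) + sqrt (V (fst z) + 0) * snd z)" for z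
        by (rule isCont_tendsto_compose) (intro tendsto_intros e0)
      then show "AE z in Q. (\<lambda>k. ?g k z) \<longlonglongrightarrow> \<phi> (W (fst z) + sqrt (V (fst z)) * snd z)" by simp
      show "AE z in Q. norm (?g k z) \<le> \<bar>\<phi> 0\<bar> + (\<bar>\<phi>1 0\<bar> + B2 *\<^sub>R m z) * m z" for k
        using le by simp
    qed measurable
  qed
  then have "(\<lambda>k. \<bar>?a - (\<integral>z. ?g k z \<partial>Q)\<bar>) \<longlonglongrightarrow>
      \<bar>?a - (\<integral>z. \<phi> (W (fst z) + sqrt (V (fst z)) * snd z) \<partial>Q)\<bar>"
    by (intro tendsto_intros)
  moreover have "(\<lambda>k. B2 * EW + B2 / 2 * (?E + e k) + B3 / 3 * EV) \<longlonglongrightarrow>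
      B2 * EW + B2 / 2 * (?E + 0) + B3 / 3 * EV"
    by (intro tendsto_intros e0)
  ultimately have "\<bar>?a - (\<integral>z. \<phi> (W (fst z) + sqrt (V (fst z)) * snd z) \<partial>Q)\<bar> \<le>
      B2 * EW + B2 / 2 * (?E + 0) + B3 / 3 * EV"
    by (rule LIMSEQ_le) (use step in blast)
  then show ?thesis by simp
qed

end

section \<open>The completed sigma-algebra and the joint law on the extension\<close>

lemma completion_of_generatedE:
  assumes "completion_of_generated M X" "\<And>h. X h \<in> borel_measurable M" "A \<in> sets M"
  obtains S where "S \<in> sets (generated_sigma M X)" "S \<in> sets M" "AE \<omega> in M. \<omega> \<in> A \<longleftrightarrow> \<omega> \<in> S"
proof -
  let ?G = "{X h -` B \<inter> space M |h B. B \<in> sets borel}"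
  have sub: "?G \<subseteq> sets M" using measurable_sets[OF assms(2)] by blast
  have "subalgebra M (generated_sigma M X)"
    unfolding subalgebra_def generated_sigma_def
    using sub sets.sigma_sets_subset[OF sub] sets.space_closed[of M] by (auto simp: space_measure_of_conv)
  note R = sets_restr_to_subalg[OF this] null_sets_restr_to_subalg[OF this]
  have "A \<in> sets (completion (restr_to_subalg M (generated_sigma M X)))"
    using assms(1,3) by (simp add: completion_of_generated_def)
  then obtain S N N' where *: "A = S \<union> N" "N \<subseteq> N'"
    "N' \<in> null_sets (restr_to_subalg M (generated_sigma M X))"
    "S \<in> sets (restr_to_subalg M (generated_sigma M X))"
    by (rule sets_completionE)
  have S: "S \<in> sets (generated_sigma M X)" and N': "N' \<in> null_sets M"
    using * R by auto
  moreover have "S \<in> sets M"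
    using S \<open>subalgebra M (generated_sigma M X)\<close> by (auto simp: subalgebra_def)
  moreover have "AE \<omega> in M. \<omega> \<in> A \<longleftrightarrow> \<omega> \<in> S"
    using AE_not_in[OF N'] by eventually_elim (use * in auto)
  ultimately show thesis using that by blast
qed

text \<open>A product measure is determined by rectangles. Independence is given only for events of
  the lifted process, so an event of \<open>M\<close> is first exchanged for an almost surely equal
  one in the uncompleted sigma-algebra. The result moves expectations from the product space to
  \<open>M'\<close>.\<close>

lemma distr_extension_pair:
  assumes "prob_space M" and gen: "completion_of_generated M X" and X: "\<And>h. X h \<in> borel_measurable M"
    and ext: "extension_of M' \<pi> M"
    and normal: "distributed M' lborel \<eta> (\<lambda>x. ennreal (std_normal_density x))"
    and indep: "prob_space.indep_set M'
                  (sets (generated_sigma M' (\<lambda>h \<omega>. X h (\<pi> \<omega>))))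
                  {\<eta> -` A \<inter> space M' | A. A \<in> sets borel}"
  shows "distr M' (M \<Otimes>\<^sub>M std_gauss) (\<lambda>\<omega>. (\<pi> \<omega>, \<eta> \<omega>)) = M \<Otimes>\<^sub>M std_gauss"
proof -
  interpret M: prob_space M by fact
  interpret M': prob_space M' using ext by (simp add: extension_of_def)
  interpret G: prob_space std_gauss by (rule prob_space_std_gauss)
  have \<pi>[measurable]: "\<pi> \<in> measurable M' M" and d\<pi>: "distr M' M \<pi> = M"
    using ext by (auto simp: extension_of_def)
  have \<eta>[measurable]: "\<eta> \<in> borel_measurable M'"
    using distributed_measurable[OF normal] by simp
  have d\<eta>: "distr M' std_gauss \<eta> = std_gauss"
    using distributed_distr_eq_density[OF normal]
    by (simp add: std_gauss_def cong: distr_cong)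
  have "M \<Otimes>\<^sub>M std_gauss = distr M' (M \<Otimes>\<^sub>M std_gauss) (\<lambda>\<omega>. (\<pi> \<omega>, \<eta> \<omega>))"
  proof (rule pair_measure_eqI)
    fix A and B :: "real set"
    assume A: "A \<in> sets M" and "B \<in> sets std_gauss"
    then have B: "B \<in> sets borel" by simp
    obtain S where S: "S \<in> sets (generated_sigma M X)" "S \<in> sets M" "AE \<omega> in M. \<omega> \<in> A \<longleftrightarrow> \<omega> \<in> S"
      using completion_of_generatedE[OF gen X A] by blast
    have "AE \<omega> in distr M' M \<pi>. \<omega> \<in> A \<longleftrightarrow> \<omega> \<in> S" unfolding d\<pi> by (rule S)
    then have AE: "AE \<omega> in M'. \<pi> \<omega> \<in> A \<longleftrightarrow> \<pi> \<omega> \<in> S" by (rule AE_distrD[OF \<pi>])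
    \<comment> \<open>Preimages under \<open>\<pi>\<close> of events generated by \<open>X\<close>
      are events generated by the lifted process, the side on which independence is known.\<close>
    have "\<pi> \<in> measurable (generated_sigma M' (\<lambda>h \<omega>. X h (\<pi> \<omega>))) (generated_sigma M X)"
      unfolding generated_sigma_def[of M X]
    proof (rule measurable_measure_of)
      have sp: "space (generated_sigma M' (\<lambda>h \<omega>. X h (\<pi> \<omega>))) = space M'"
        by (simp add: generated_sigma_def space_measure_of_conv)
      show "\<pi> \<in> space (generated_sigma M' (\<lambda>h \<omega>. X h (\<pi> \<omega>))) \<rightarrow> space M"
        unfolding sp using measurable_space[OF \<pi>] by auto
      show "\<pi> -` y \<inter> space (generated_sigma M' (\<lambda>h \<omega>. X h (\<pi> \<omega>))) \<in> sets (generated_sigma M' (\<lambda>h \<omega>. X h (\<pi> \<omega>)))"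
        if "y \<in> {X h -` A \<inter> space M |h A. A \<in> sets borel}" for y
      proof -
        obtain h C where y: "y = X h -` C \<inter> space M" "C \<in> sets borel" using \<open>y \<in> _\<close> by blast
        have "\<pi> -` y \<inter> space M' = (\<lambda>\<omega>. X h (\<pi> \<omega>)) -` C \<inter> space M'"
          using measurable_space[OF \<pi>] unfolding y by auto
        then show ?thesis
          unfolding sp unfolding generated_sigma_def using y(2)
          by (subst sets_measure_of) (auto intro!: sigma_sets.Basic)
      qed
    qed auto
    from measurable_sets[OF this S(1)]
    have \<pi>S: "\<pi> -` S \<inter> space M' \<in> sets (generated_sigma M' (\<lambda>h \<omega>. X h (\<pi> \<omega>)))"
      by (simp add: generated_sigma_def space_measure_of_conv)
    have "emeasure (distr M' (M \<Otimes>\<^sub>M std_gauss) (\<lambda>\<omega>. (\<pi> \<omega>, \<eta> \<omega>))) (A \<times> B) =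
        emeasure M' ((\<lambda>\<omega>. (\<pi> \<omega>, \<eta> \<omega>)) -` (A \<times> B) \<inter> space M')"
      using A B by (intro emeasure_distr) (auto intro!: pair_measureI)
    also have "\<dots> = emeasure M' ((\<pi> -` S \<inter> space M') \<inter> (\<eta> -` B \<inter> space M'))"
    proof (rule emeasure_eq_AE)
      show "AE x in M'. x \<in> (\<lambda>\<omega>. (\<pi> \<omega>, \<eta> \<omega>)) -` (A \<times> B) \<inter> space M' \<longleftrightarrow>
          x \<in> (\<pi> -` S \<inter> space M') \<inter> (\<eta> -` B \<inter> space M')"
        using AE by eventually_elim auto
      have "(\<lambda>\<omega>. (\<pi> \<omega>, \<eta> \<omega>)) -` (A \<times> B) \<inter> space M' = (\<pi> -` A \<inter> space M') \<inter> (\<eta> -` B \<inter> space M')"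
        by auto
      then show "(\<lambda>\<omega>. (\<pi> \<omega>, \<eta> \<omega>)) -` (A \<times> B) \<inter> space M' \<in> sets M'"
        using measurable_sets[OF \<pi> A] measurable_sets[OF \<eta> B] by auto
      show "(\<pi> -` S \<inter> space M') \<inter> (\<eta> -` B \<inter> space M') \<in> sets M'"
        using measurable_sets[OF \<pi> S(2)] measurable_sets[OF \<eta> B] by auto
    qed
    also have "\<dots> = emeasure M' (\<pi> -` S \<inter> space M') * emeasure M' (\<eta> -` B \<inter> space M')"
    proof -
      have "M'.prob ((\<pi> -` S \<inter> space M') \<inter> (\<eta> -` B \<inter> space M')) =
          M'.prob (\<pi> -` S \<inter> space M') * M'.prob (\<eta> -` B \<inter> space M')"
        using B by (intro M'.indep_setD[OF indep \<pi>S]) blast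
      then show ?thesis
        by (simp add: M'.emeasure_eq_measure ennreal_mult)
    qed
    also have "emeasure M' (\<eta> -` B \<inter> space M') = emeasure std_gauss B"
      by (subst d\<eta>[symmetric], subst emeasure_distr) (use B in simp_all)
    also have "emeasure M' (\<pi> -` S \<inter> space M') = emeasure M S"
      by (subst d\<pi>[symmetric], subst emeasure_distr) (use S in simp_all)
    also have "emeasure M S = emeasure M A"
      by (rule emeasure_eq_AE) (use S A in auto)
    finally show "emeasure M A * emeasure std_gauss B =
        emeasure (distr M' (M \<Otimes>\<^sub>M std_gauss) (\<lambda>\<omega>. (\<pi> \<omega>, \<eta> \<omega>))) (A \<times> B)" by simp
  qed (auto intro: M.sigma_finite_measure_axioms G.sigma_finite_measure_axioms)
  then show ?thesis by simp
qed

section \<open>From exponential test variables to all bounded ones\<close>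

text \<open>The measure-theoretic half of stable convergence in isolation: \<open>e n\<close> and
  \<open>e'\<close> play the role of exp(i t F_n) and exp(i t S \<eta>), and \<open>\<W>\<close>
  collects exponents for which convergence is already known. Unit modulus makes approximation errors
  uniform in \<open>n\<close>.\<close>

locale stable_testing =
  M: prob_space M + M': prob_space M' for M :: "'a measure" and M' :: "'b measure" +
  fixes \<pi> :: "'b \<Rightarrow> 'a" and e :: "nat \<Rightarrow> 'a \<Rightarrow> complex" and e' :: "'b \<Rightarrow> complex"
    and \<W> :: "('a \<Rightarrow> real) set"
  assumes \<pi> [measurable]: "\<pi> \<in> measurable M' M" and distr_\<pi>: "distr M' M \<pi> = M"
    and e [measurable]: "\<And>n. e n \<in> borel_measurable M" and norm_e: "\<And>n \<omega>. cmod (e n \<omega>) = 1"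
    and e' [measurable]: "e' \<in> borel_measurable M'" and norm_e': "\<And>\<omega>. cmod (e' \<omega>) = 1"
    and \<W>_meas: "\<And>W. W \<in> \<W> \<Longrightarrow> W \<in> borel_measurable M"
    and \<W>_0: "(\<lambda>_. 0) \<in> \<W>"
    and \<W>_add: "\<And>W W'. W \<in> \<W> \<Longrightarrow> W' \<in> \<W> \<Longrightarrow> (\<lambda>\<omega>. W \<omega> + W' \<omega>) \<in> \<W>"
    and \<W>_conv: "\<And>W. W \<in> \<W> \<Longrightarrow>
      (\<lambda>n. \<integral>\<omega>. iexp (W \<omega>) * e n \<omega> \<partial>M) \<longlonglongrightarrow> (\<integral>\<omega>. iexp (W (\<pi> \<omega>)) * e' \<omega> \<partial>M')"
begin

definition conv :: "('a \<Rightarrow> complex) \<Rightarrow> bool" where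
  "conv Z \<longleftrightarrow> (\<lambda>n. \<integral>\<omega>. Z \<omega> * e n \<omega> \<partial>M) \<longlonglongrightarrow> (\<integral>\<omega>. Z (\<pi> \<omega>) * e' \<omega> \<partial>M')"

definition bounded_rv :: "('a \<Rightarrow> complex) \<Rightarrow> bool" where
  "bounded_rv Z \<longleftrightarrow> Z \<in> borel_measurable M \<and> (\<exists>c. \<forall>\<omega>\<in>space M. cmod (Z \<omega>) \<le> c)"

lemma bounded_rv_meas: "bounded_rv Z \<Longrightarrow> Z \<in> borel_measurable M"
  by (simp add: bounded_rv_def)

lemma bounded_rv_mult: "bounded_rv Z \<Longrightarrow> bounded_rv Z' \<Longrightarrow> bounded_rv (\<lambda>\<omega>. Z \<omega> * Z' \<omega>)"
  unfolding bounded_rv_def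
proof (elim conjE exE, intro conjI)
  fix c c' assume "\<forall>\<omega>\<in>space M. cmod (Z \<omega>) \<le> c" "\<forall>\<omega>\<in>space M. cmod (Z' \<omega>) \<le> c'"
  then have "\<forall>\<omega>\<in>space M. cmod (Z \<omega> * Z' \<omega>) \<le> c * c'"
    by (auto simp: norm_mult intro!: mult_mono order_trans[OF norm_ge_zero])
  then show "\<exists>c. \<forall>\<omega>\<in>space M. cmod (Z \<omega> * Z' \<omega>) \<le> c" by blast
qed measurable

lemma bounded_rv_add: "bounded_rv Z \<Longrightarrow> bounded_rv Z' \<Longrightarrow> bounded_rv (\<lambda>\<omega>. Z \<omega> + Z' \<omega>)"
  unfolding bounded_rv_def
proof (elim conjE exE, intro conjI)
  fix c c' assume "\<forall>\<omega>\<in>space M. cmod (Z \<omega>) \<le> c" "\<forall>\<omega>\<in>space M. cmod (Z' \<omega>) \<le> c'"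
  then have "\<forall>\<omega>\<in>space M. cmod (Z \<omega> + Z' \<omega>) \<le> c + c'"
    by (auto intro!: order_trans[OF norm_triangle_ineq] add_mono)
  then show "\<exists>c. \<forall>\<omega>\<in>space M. cmod (Z \<omega> + Z' \<omega>) \<le> c" by blast
qed measurable

lemma bounded_rv_const: "bounded_rv (\<lambda>_. c)"
  by (auto simp: bounded_rv_def)

lemma bounded_rv_iexp: "W \<in> borel_measurable M \<Longrightarrow> bounded_rv (\<lambda>\<omega>. iexp (W \<omega>))"
  by (auto simp: bounded_rv_def)

lemma bounded_rv_integrable:
  assumes "bounded_rv Z"
  shows "integrable M (\<lambda>\<omega>. Z \<omega> * e n \<omega>)" "integrable M' (\<lambda>\<omega>. Z (\<pi> \<omega>) * e' \<omega>)" "integrable M Z"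
proof -
  obtain c where c: "\<And>\<omega>. \<omega> \<in> space M \<Longrightarrow> cmod (Z \<omega>) \<le> c" and [measurable]: "Z \<in> borel_measurable M"
    using assms by (auto simp: bounded_rv_def)
  show "integrable M (\<lambda>\<omega>. Z \<omega> * e n \<omega>)" "integrable M Z"
    by (rule M.integrable_const_bound[where B=c]; use c in \<open>simp add: norm_mult norm_e\<close>)+
  show "integrable M' (\<lambda>\<omega>. Z (\<pi> \<omega>) * e' \<omega>)"
    by (rule M'.integrable_const_bound[where B=c])
      (use c measurable_space[OF \<pi>] in \<open>simp_all add: norm_mult norm_e'\<close>)
qed

lemma conv_add:
  assumes "bounded_rv Z" "bounded_rv Z'" "conv Z" "conv Z'"
  shows "conv (\<lambda>\<omega>. Z \<omega> + Z' \<omega>)"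
  using tendsto_add[OF assms(3,4)[unfolded conv_def]]
  by (simp add: conv_def distrib_right bounded_rv_integrable[OF assms(1)] bounded_rv_integrable[OF assms(2)])

lemma conv_cmult:
  assumes "conv Z"
  shows "conv (\<lambda>\<omega>. c * Z \<omega>)"
  using tendsto_mult_left[OF assms[unfolded conv_def], of c] by (simp add: conv_def mult.assoc)

lemma conv_AE:
  assumes "bounded_rv Z" "bounded_rv Z'" "AE \<omega> in M. Z \<omega> = Z' \<omega>" "conv Z"
  shows "conv Z'"
proof -
  note [measurable] = bounded_rv_meas[OF assms(1)] bounded_rv_meas[OF assms(2)]
  have "AE \<omega> in distr M' M \<pi>. Z \<omega> = Z' \<omega>" unfolding distr_\<pi> by (rule assms)
  then have "AE \<omega> in M'. Z (\<pi> \<omega>) = Z' (\<pi> \<omega>)" by (rule AE_distrD[OF \<pi>])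
  then have "(\<integral>\<omega>. Z (\<pi> \<omega>) * e' \<omega> \<partial>M') = (\<integral>\<omega>. Z' (\<pi> \<omega>) * e' \<omega> \<partial>M')"
    by (intro integral_cong_AE) auto
  moreover have "(\<integral>\<omega>. Z \<omega> * e n \<omega> \<partial>M) = (\<integral>\<omega>. Z' \<omega> * e n \<omega> \<partial>M)" for n
    using assms(3) by (intro integral_cong_AE) auto
  ultimately show ?thesis using assms(4) by (simp add: conv_def)
qed

text \<open>Because \<open>e n\<close> and \<open>e'\<close> have modulus 1 and \<open>\<pi>\<close>
  preserves the measure, replacing \<open>Z\<close> by \<open>Zk k\<close> changes the prelimit and
  the limit by at most the same L^1 distance \<open>d k\<close>, whatever \<open>n\<close>
  is.\<close>

lemma conv_limit:
  assumes Zk: "\<And>k. Zk k \<in> borel_measurable M" "\<And>k \<omega>. \<omega> \<in> space M \<Longrightarrow> cmod (Zk k \<omega>) \<le> c"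
    and Z: "\<And>\<omega>. \<omega> \<in> space M \<Longrightarrow> (\<lambda>k. Zk k \<omega>) \<longlonglongrightarrow> Z \<omega>"
    and conv: "\<And>k :: nat. conv (Zk k)"
  shows "conv Z"
proof -
  have [measurable]: "Z \<in> borel_measurable M"
    by (rule borel_measurable_LIMSEQ_metric[OF Zk(1) Z])
  note Zk(1)[measurable]
  have Zc: "cmod (Z \<omega>) \<le> c" if "\<omega> \<in> space M" for \<omega>
    using LIMSEQ_le_const2[OF tendsto_norm[OF Z[OF that]]] Zk(2)[OF that] by blast
  have bZ: "bounded_rv Z" "bounded_rv (Zk k)" for k
    using Zc Zk(2) by (auto simp: bounded_rv_def)
  define d where "d k = (\<integral>\<omega>. cmod (Zk k \<omega> - Z \<omega>) \<partial>M)" for k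
  have "(\<lambda>k. \<integral>\<omega>. cmod (Zk k \<omega> - Z \<omega>) \<partial>M) \<longlonglongrightarrow> (\<integral>\<omega>. 0 \<partial>M)"
  proof (rule integral_dominated_convergence[where w="\<lambda>_. 2 * c"])
    show "AE \<omega> in M. (\<lambda>k. cmod (Zk k \<omega> - Z \<omega>)) \<longlonglongrightarrow> 0"
      using Z by (intro AE_I2 tendsto_norm_zero) (simp add: LIM_zero_iff)
    show "AE \<omega> in M. norm (cmod (Zk k \<omega> - Z \<omega>)) \<le> 2 * c" for k
    proof (rule AE_I2)
      fix \<omega> assume "\<omega> \<in> space M"
      from Zc[OF this] Zk(2)[OF this, of k] norm_triangle_ineq4[of "Zk k \<omega>" "Z \<omega>"]
      show "norm (cmod (Zk k \<omega> - Z \<omega>)) \<le> 2 * c" by simp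
    qed
  qed auto
  then have d: "d \<longlonglongrightarrow> 0" by (simp add: d_def[abs_def])
  have d1: "cmod ((\<integral>\<omega>. Zk k \<omega> * e n \<omega> \<partial>M) - (\<integral>\<omega>. Z \<omega> * e n \<omega> \<partial>M)) \<le> d k" for k n
  proof -
    have "(\<integral>\<omega>. Zk k \<omega> * e n \<omega> \<partial>M) - (\<integral>\<omega>. Z \<omega> * e n \<omega> \<partial>M) = (\<integral>\<omega>. (Zk k \<omega> - Z \<omega>) * e n \<omega> \<partial>M)"
      using bounded_rv_integrable[OF bZ(1)] bounded_rv_integrable[OF bZ(2)] by (simp add: left_diff_distrib)
    also have "cmod \<dots> \<le> (\<integral>\<omega>. cmod ((Zk k \<omega> - Z \<omega>) * e n \<omega>) \<partial>M)" by (rule integral_norm_bound)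
    finally show ?thesis by (simp add: norm_mult norm_e d_def)
  qed
  have d2: "cmod ((\<integral>\<omega>. Zk k (\<pi> \<omega>) * e' \<omega> \<partial>M') - (\<integral>\<omega>. Z (\<pi> \<omega>) * e' \<omega> \<partial>M')) \<le> d k" for k
  proof -
    have "(\<integral>\<omega>. Zk k (\<pi> \<omega>) * e' \<omega> \<partial>M') - (\<integral>\<omega>. Z (\<pi> \<omega>) * e' \<omega> \<partial>M') =
        (\<integral>\<omega>. (Zk k (\<pi> \<omega>) - Z (\<pi> \<omega>)) * e' \<omega> \<partial>M')"
      using bounded_rv_integrable[OF bZ(1)] bounded_rv_integrable[OF bZ(2)] by (simp add: left_diff_distrib)
    also have "cmod \<dots> \<le> (\<integral>\<omega>. cmod ((Zk k (\<pi> \<omega>) - Z (\<pi> \<omega>)) * e' \<omega>) \<partial>M')" by (rule integral_norm_bound)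
    also have "\<dots> = (\<integral>\<omega>. cmod (Zk k \<omega> - Z \<omega>) \<partial>distr M' M \<pi>)"
      by (subst integral_distr[OF \<pi>]) (simp_all add: norm_mult norm_e')
    finally show ?thesis by (simp add: distr_\<pi> d_def)
  qed
  show ?thesis
    unfolding conv_def
  proof (rule LIMSEQ_I)
    fix r :: real assume "0 < r"
    then obtain k where k: "d k < r / 3"
      using order_tendstoD(2)[OF d, of "r / 3"] by (auto simp: eventually_sequentially)
    obtain n0 where n0: "\<And>n. n \<ge> n0 \<Longrightarrow>
        norm ((\<integral>\<omega>. Zk k \<omega> * e n \<omega> \<partial>M) - (\<integral>\<omega>. Zk k (\<pi> \<omega>) * e' \<omega> \<partial>M')) < r / 3"
      using LIMSEQ_D[OF conv[of k, unfolded conv_def], of "r / 3"] \<open>0 < r\<close> by auto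
    have "norm ((\<integral>\<omega>. Z \<omega> * e n \<omega> \<partial>M) - (\<integral>\<omega>. Z (\<pi> \<omega>) * e' \<omega> \<partial>M')) < r" if "n \<ge> n0" for n
    proof -
      have tri: "norm (x - y) \<le> norm (x' - x) + norm (x' - y') + norm (y' - y)" for x y x' y' :: complex
        using norm_triangle_ineq[of "x - x'" "x' - y"] norm_triangle_ineq[of "x' - y'" "y' - y"]
        by (simp add: norm_minus_commute[of x x'])
      show ?thesis
        using tri[of "\<integral>\<omega>. Z \<omega> * e n \<omega> \<partial>M" "\<integral>\<omega>. Z (\<pi> \<omega>) * e' \<omega> \<partial>M'"
            "\<integral>\<omega>. Zk k \<omega> * e n \<omega> \<partial>M" "\<integral>\<omega>. Zk k (\<pi> \<omega>) * e' \<omega> \<partial>M'"] d1[of k n] d2[of k] n0[OF that] k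
        by linarith
    qed
    then show "\<exists>n0. \<forall>n\<ge>n0. norm ((\<integral>\<omega>. Z \<omega> * e n \<omega> \<partial>M) - (\<integral>\<omega>. Z (\<pi> \<omega>) * e' \<omega> \<partial>M')) < r"
      by blast
  qed
qed

text \<open>Convergence tested with \<open>Z\<close> alone does not pass to products. Requiring it
  for \<open>Z\<close> times every exponential does, because \<open>\<W>\<close> is closed under
  addition and a further exponential factor is absorbed.\<close>

definition K :: "('a \<Rightarrow> complex) set" where
  "K = {Z. bounded_rv Z \<and> (\<forall>W\<in>\<W>. conv (\<lambda>\<omega>. Z \<omega> * iexp (W \<omega>)))}"

lemma K_one: "(\<lambda>_. 1) \<in> K"
  using \<W>_conv by (simp add: K_def bounded_rv_const conv_def)

lemma K_conv: "Z \<in> K \<Longrightarrow> conv Z"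
  using \<W>_0 by (force simp: K_def)

lemma K_diff:
  assumes "Z \<in> K" "Z' \<in> K"
  shows "(\<lambda>\<omega>. Z \<omega> - Z' \<omega>) \<in> K"
proof -
  have b: "bounded_rv Z" "bounded_rv Z'" using assms by (auto simp: K_def)
  have "bounded_rv (\<lambda>\<omega>. Z \<omega> + (-1) * Z' \<omega>)"
    by (intro bounded_rv_add bounded_rv_mult bounded_rv_const b)
  moreover have "conv (\<lambda>\<omega>. Z \<omega> * iexp (W \<omega>) + (-1) * (Z' \<omega> * iexp (W \<omega>)))" if "W \<in> \<W>" for W
    using assms that
    by (intro conv_add conv_cmult bounded_rv_mult bounded_rv_const bounded_rv_iexp \<W>_meas b) (auto simp: K_def)
  ultimately show ?thesis by (simp add: K_def left_diff_distrib)
qed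

lemma K_limit:
  assumes Zk: "\<And>k :: nat. Zk k \<in> K" "\<And>k \<omega>. \<omega> \<in> space M \<Longrightarrow> cmod (Zk k \<omega>) \<le> c"
    and Z: "\<And>\<omega>. \<omega> \<in> space M \<Longrightarrow> (\<lambda>k. Zk k \<omega>) \<longlonglongrightarrow> Z \<omega>"
  shows "Z \<in> K"
proof -
  have m: "Zk k \<in> borel_measurable M" for k using Zk(1) by (auto simp: K_def bounded_rv_def)
  have "Z \<in> borel_measurable M"
    by (rule borel_measurable_LIMSEQ_metric[OF m Z])
  moreover have "cmod (Z \<omega>) \<le> c" if "\<omega> \<in> space M" for \<omega>
    using LIMSEQ_le_const2[OF tendsto_norm[OF Z[OF that]]] Zk(2)[OF that] by blast
  ultimately have "bounded_rv Z" by (auto simp: bounded_rv_def)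
  moreover have "conv (\<lambda>\<omega>. Z \<omega> * iexp (W \<omega>))" if W: "W \<in> \<W>" for W
  proof (rule conv_limit[where Zk="\<lambda>k \<omega>. Zk k \<omega> * iexp (W \<omega>)" and c=c])
    show "(\<lambda>\<omega>. Zk k \<omega> * iexp (W \<omega>)) \<in> borel_measurable M" for k
      using m \<W>_meas[OF W] by measurable
    show "(\<lambda>k. Zk k \<omega> * iexp (W \<omega>)) \<longlonglongrightarrow> Z \<omega> * iexp (W \<omega>)" if "\<omega> \<in> space M" for \<omega>
      by (intro tendsto_intros Z that)
  qed (use Zk W in \<open>auto simp: norm_mult K_def\<close>)
  ultimately show ?thesis by (simp add: K_def)
qed

text \<open>The factor \<open>R\<close> is recovered from the exponentials as the limit of
  \<open>(exp (\<i> s R) - 1) / (\<i> s)\<close> for \<open>s \<rightarrow> 0\<close>, so no density of trigonometric polynomials is needed.\<close>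

lemma K_mult:
  assumes Z: "Z \<in> K" and R: "\<And>s. (\<lambda>\<omega>. s * R \<omega>) \<in> \<W>" and bound: "\<And>\<omega>. \<bar>R \<omega>\<bar> \<le> c"
  shows "(\<lambda>\<omega>. Z \<omega> * of_real (R \<omega>)) \<in> K"
proof -
  define s where "s k = 1 / real (Suc k)" for k
  have s: "0 < s k" for k by (simp add: s_def)
  define Q where "Q k \<omega> = (iexp (s k * R \<omega>) - 1) / (\<i> * of_real (s k))" for k \<omega>
  have c: "0 \<le> c" using bound[of undefined] by (rule order_trans[OF abs_ge_zero])
  have [measurable]: "R \<in> borel_measurable M" using \<W>_meas[OF R[of 1]] by simp
  obtain b where b: "\<And>\<omega>. \<omega> \<in> space M \<Longrightarrow> cmod (Z \<omega>) \<le> b" and bZ: "bounded_rv Z"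
    using Z by (auto simp: K_def bounded_rv_def)
  have exp: "(\<lambda>\<omega>. Z \<omega> * iexp (s * R \<omega>)) \<in> K" for s
  proof -
    have "conv (\<lambda>\<omega>. Z \<omega> * iexp (s * R \<omega>) * iexp (W \<omega>))" if W: "W \<in> \<W>" for W
    proof -
      have "\<forall>W\<in>\<W>. conv (\<lambda>\<omega>. Z \<omega> * iexp (W \<omega>))"
        using Z by (simp add: K_def)
      from bspec[OF this \<W>_add[OF R[of s] W]]
      have "conv (\<lambda>\<omega>. Z \<omega> * iexp (s * R \<omega> + W \<omega>))" .
      then show ?thesis by (simp add: distrib_left exp_add mult.assoc)
    qed
    moreover have "bounded_rv (\<lambda>\<omega>. Z \<omega> * iexp (s * R \<omega>))"
      by (intro bounded_rv_mult bZ bounded_rv_iexp) measurable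
    ultimately show ?thesis by (simp add: K_def)
  qed
  have cmultK: "(\<lambda>\<omega>. a * Y \<omega>) \<in> K" if Y: "Y \<in> K" for a Y
    using conv_cmult[of "\<lambda>\<omega>. Y \<omega> * iexp (W \<omega>)" a for W] Y
    by (auto simp: K_def mult.assoc intro: bounded_rv_mult bounded_rv_const)
  show ?thesis
  proof (rule K_limit[where Zk="\<lambda>k \<omega>. Z \<omega> * Q k \<omega>" and c="b * (c + c\<^sup>2)"])
    have "(\<lambda>\<omega>. inverse (\<i> * of_real (s k)) * (Z \<omega> * iexp (s k * R \<omega>) - Z \<omega>)) \<in> K" for k
      by (intro cmultK K_diff exp Z)
    then show "(\<lambda>\<omega>. Z \<omega> * Q k \<omega>) \<in> K" for k
      by (simp add: Q_def field_simps)
    have QR: "cmod (Q k \<omega> - of_real (R \<omega>)) \<le> s k * c\<^sup>2" for k \<omega>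
    proof -
      \<comment> \<open>The difference is the first-order Taylor remainder of exp(i s R) divided by
        i s, hence of order s.\<close>
      have "Q k \<omega> - of_real (R \<omega>) =
          (iexp (s k * R \<omega>) - (\<Sum>j\<le>1. (\<i> * of_real (s k * R \<omega>)) ^ j / fact j)) / (\<i> * of_real (s k))"
        using s[of k] by (simp add: Q_def field_simps)
      also have "cmod \<dots> = cmod (iexp (s k * R \<omega>) - (\<Sum>j\<le>1. (\<i> * of_real (s k * R \<omega>)) ^ j / fact j)) / s k"
        using s[of k] by (simp add: norm_divide norm_mult)
      also have "\<dots> \<le> (\<bar>s k * R \<omega>\<bar> ^ Suc 1 / fact (Suc 1)) / s k"
        using s[of k] by (intro divide_right_mono iexp_approx1) auto
      also have "\<dots> = s k * \<bar>R \<omega>\<bar>\<^sup>2 / 2"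
        using s[of k] by (simp add: abs_mult power2_eq_square field_simps)
      also have "\<dots> \<le> s k * \<bar>R \<omega>\<bar>\<^sup>2"
        using s[of k] by simp
      also have "\<dots> \<le> s k * c\<^sup>2"
        using s[of k] bound by (intro mult_left_mono power_mono) auto
      finally show ?thesis .
    qed
    show "cmod (Z \<omega> * Q k \<omega>) \<le> b * (c + c\<^sup>2)" if "\<omega> \<in> space M" for k \<omega>
    proof -
      have "s k * c\<^sup>2 \<le> 1 * c\<^sup>2" by (intro mult_right_mono) (simp_all add: s_def)
      then have "cmod (Q k \<omega>) \<le> c + c\<^sup>2"
        using QR[of k \<omega>] bound[of \<omega>] norm_triangle_ineq[of "Q k \<omega> - of_real (R \<omega>)" "of_real (R \<omega>)"] by simp
      then show ?thesis
        unfolding norm_mult using b[OF that] by (intro mult_mono) (auto intro: order_trans[OF norm_ge_zero])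
    qed
    show "(\<lambda>k. Z \<omega> * Q k \<omega>) \<longlonglongrightarrow> Z \<omega> * of_real (R \<omega>)" for \<omega>
    proof (rule tendsto_mult_left)
      have "(\<lambda>k. Q k \<omega> - of_real (R \<omega>)) \<longlonglongrightarrow> 0"
      proof (rule Lim_null_comparison)
        show "\<forall>\<^sub>F k in sequentially. norm (Q k \<omega> - of_real (R \<omega>)) \<le> s k * c\<^sup>2"
          using QR by simp
        have "s \<longlonglongrightarrow> 0" unfolding s_def[abs_def]
          by (intro real_tendsto_divide_at_top[OF tendsto_const]
              filterlim_compose[OF filterlim_real_sequentially filterlim_Suc])
        from tendsto_mult_right[OF this, of "c\<^sup>2"] show "(\<lambda>k. s k * c\<^sup>2) \<longlonglongrightarrow> 0" by simp
      qed
      then show "(\<lambda>k. Q k \<omega>) \<longlonglongrightarrow> of_real (R \<omega>)" by (simp add: LIM_zero_iff)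
    qed
  qed
qed

text \<open>Sets that act on \<open>K\<close> by multiplication, rather than sets whose indicator
  lies in \<open>K\<close>: intersections then correspond to two successive multiplications, and the
  sigma-algebra property follows directly.\<close>

definition \<P> :: "'a set set" where
  "\<P> = {A \<in> sets M. \<forall>Z\<in>K. (\<lambda>\<omega>. Z \<omega> * indicator A \<omega>) \<in> K}"

lemma sigma_algebra_\<P>: "sigma_algebra (space M) \<P>"
proof -
  \<comment> \<open>Complements are relative to \<open>space M\<close>, so identities between
    indicators hold only there. Membership in \<open>K\<close> depends only on these values, as the
    limit lemma with a constant sequence shows.\<close>
  have K_cong: "Y \<in> K" if "Z \<in> K" "\<And>\<omega>. \<omega> \<in> space M \<Longrightarrow> Y \<omega> = Z \<omega>" for Y Z
  proof (rule K_limit[where Zk="\<lambda>_. Z"])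
    show "cmod (Z \<omega>) \<le> (SOME c. \<forall>\<omega>\<in>space M. cmod (Z \<omega>) \<le> c)" if "\<omega> \<in> space M" for \<omega>
      using someI_ex[of "\<lambda>c. \<forall>\<omega>\<in>space M. cmod (Z \<omega>) \<le> c"] \<open>Z \<in> K\<close> that
      by (auto simp: K_def bounded_rv_def)
  qed (use that in auto)
  have Int: "A \<inter> B \<in> \<P>" if "A \<in> \<P>" "B \<in> \<P>" for A B
  proof -
    have "(\<lambda>\<omega>. Z \<omega> * indicator (A \<inter> B) \<omega>) \<in> K" if "Z \<in> K" for Z
    proof -
      have "(\<lambda>\<omega>. (Z \<omega> * indicator A \<omega>) * indicator B \<omega>) \<in> K"
        using \<open>A \<in> \<P>\<close> \<open>B \<in> \<P>\<close> that by (simp add: \<P>_def)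
      then show ?thesis by (simp add: indicator_inter_arith mult.assoc)
    qed
    then show ?thesis using that by (auto simp: \<P>_def)
  qed
  have compl: "space M - A \<in> \<P>" if "A \<in> \<P>" for A
  proof -
    have "(\<lambda>\<omega>. Z \<omega> * indicator (space M - A) \<omega>) \<in> K" if "Z \<in> K" for Z
    proof (rule K_cong)
      show "(\<lambda>\<omega>. Z \<omega> - Z \<omega> * indicator A \<omega>) \<in> K"
        using K_diff[OF that] \<open>A \<in> \<P>\<close> that by (auto simp: \<P>_def)
    qed (auto simp: indicator_def)
    then show ?thesis using that by (auto simp: \<P>_def)
  qed
  have empty: "{} \<in> \<P>"
    using K_diff by (fastforce simp: \<P>_def)
  have alg: "algebra (space M) \<P>"
  proof -
    have "\<P> \<subseteq> Pow (space M)" unfolding \<P>_def using sets.sets_into_space by blast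
    then show ?thesis unfolding algebra_iff_Int using empty Int compl by blast
  qed
  have UN: "(\<Union>i. A i) \<in> \<P>" if A: "range A \<subseteq> \<P>" for A :: "nat \<Rightarrow> 'a set"
  proof -
    have fin: "(\<Union>i<k. A i) \<in> \<P>" for k :: nat
      using A by (intro ring_of_sets.finite_UN[OF algebra.axioms(1)[OF alg]]) auto
    have "(\<lambda>\<omega>. Z \<omega> * indicator (\<Union>i. A i) \<omega>) \<in> K" if Z: "Z \<in> K" for Z
    proof -
      obtain b where b: "\<And>\<omega>. \<omega> \<in> space M \<Longrightarrow> cmod (Z \<omega>) \<le> b"
        using Z by (auto simp: K_def bounded_rv_def)
      show ?thesis
      proof (rule K_limit[where Zk="\<lambda>k \<omega>. Z \<omega> * indicator (\<Union>i<k. A i) \<omega>" and c=b])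
        show "(\<lambda>\<omega>. Z \<omega> * indicator (\<Union>i<k. A i) \<omega>) \<in> K" for k
          using fin Z by (simp add: \<P>_def)
        show "cmod (Z \<omega> * indicator (\<Union>i<k. A i) \<omega>) \<le> b" if "\<omega> \<in> space M" for k \<omega>
          using b[OF that] order_trans[OF norm_ge_zero b[OF that]] by (simp add: indicator_def)
        show "(\<lambda>k. Z \<omega> * indicator (\<Union>i<k. A i) \<omega>) \<longlonglongrightarrow> Z \<omega> * indicator (\<Union>i. A i) \<omega>" for \<omega>
          by (intro tendsto_mult_left LIMSEQ_indicator_UN)
      qed
    qed
    moreover have "(\<Union>i. A i) \<in> sets M" using A by (auto simp: \<P>_def)
    ultimately show ?thesis by (simp add: \<P>_def)
  qed
  show ?thesis
    unfolding sigma_algebra_iff using alg UN by blast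
qed

lemma halfline_\<P>:
  assumes f [measurable]: "f \<in> borel_measurable M"
    and \<W>: "\<And>s b c. (\<lambda>\<omega>. s * (1 / 2 + arctan (b * (f \<omega> - a) - c) / pi)) \<in> \<W>"
  shows "{\<omega> \<in> space M. a < f \<omega>} \<in> \<P>"
proof -
  \<comment> \<open>A sigmoid approximating the indicator of a < f. The shift by -k makes it tend to
    0 also where f = a, and the factor k^2 outgrows the shift where f > a.\<close>
  define R where "R k \<omega> = 1 / 2 + arctan ((real k)\<^sup>2 * (f \<omega> - a) - real k) / pi" for k :: nat and \<omega>
  have R1: "\<bar>R k \<omega>\<bar> \<le> 1" for k \<omega>
  proof -
    let ?x = "arctan ((real k)\<^sup>2 * (f \<omega> - a) - real k)"
    have "- (1 / 2) \<le> ?x / pi" "?x / pi \<le> 1 / 2"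
      using arctan_bounded[of "(real k)\<^sup>2 * (f \<omega> - a) - real k"] by (simp_all add: field_simps)
    then show ?thesis unfolding R_def by linarith
  qed
  have lim: "(\<lambda>k. R k \<omega>) \<longlonglongrightarrow> indicator {\<omega> \<in> space M. a < f \<omega>} \<omega>" if "\<omega> \<in> space M" for \<omega>
  proof (cases "a < f \<omega>")
    case True
    have "filterlim (\<lambda>k. (real k)\<^sup>2 * (f \<omega> - a) - real k) at_top sequentially"
    proof (rule filterlim_at_top_mono[OF filterlim_real_sequentially])
      show "\<forall>\<^sub>F k in sequentially. real k \<le> (real k)\<^sup>2 * (f \<omega> - a) - real k"
        using eventually_ge_at_top[of "nat \<lceil>2 / (f \<omega> - a)\<rceil>"]
      proof eventually_elim
        case (elim k)
        then have "2 / (f \<omega> - a) \<le> real k" by (simp only: nat_ceiling_le_eq)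
        then have "2 \<le> real k * (f \<omega> - a)" using True by (simp add: field_simps)
        then have "real k * 2 \<le> real k * (real k * (f \<omega> - a))" by (intro mult_left_mono) auto
        then show ?case by (simp add: power2_eq_square mult.assoc)
      qed
    qed
    from filterlim_compose[OF tendsto_arctan_at_top this]
    have "(\<lambda>k. R k \<omega>) \<longlonglongrightarrow> 1 / 2 + (pi / 2) / pi"
      unfolding R_def by (intro tendsto_intros) auto
    then show ?thesis using True that by simp
  next
    case False
    have "filterlim (\<lambda>k. (real k)\<^sup>2 * (f \<omega> - a) - real k) at_bot sequentially"
      unfolding filterlim_uminus_at_bot
    proof (rule filterlim_at_top_mono[OF filterlim_real_sequentially])
      have "(real k)\<^sup>2 * (f \<omega> - a) \<le> 0" for k :: nat
        using False by (intro mult_nonneg_nonpos) auto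
      then show "\<forall>\<^sub>F k in sequentially. real k \<le> - ((real k)\<^sup>2 * (f \<omega> - a) - real k)"
        by simp
    qed
    from filterlim_compose[OF tendsto_arctan_at_bot this]
    have "(\<lambda>k. R k \<omega>) \<longlonglongrightarrow> 1 / 2 + (- (pi / 2)) / pi"
      unfolding R_def by (intro tendsto_intros) auto
    then show ?thesis using False by simp
  qed
  have "(\<lambda>\<omega>. Z \<omega> * indicator {\<omega> \<in> space M. a < f \<omega>} \<omega>) \<in> K" if Z: "Z \<in> K" for Z
  proof -
    obtain b where b: "\<And>\<omega>. \<omega> \<in> space M \<Longrightarrow> cmod (Z \<omega>) \<le> b"
      using Z by (auto simp: K_def bounded_rv_def)
    show ?thesis
    proof (rule K_limit[where Zk="\<lambda>k \<omega>. Z \<omega> * of_real (R k \<omega>)" and c=b])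
      show "(\<lambda>\<omega>. Z \<omega> * of_real (R k \<omega>)) \<in> K" for k
        by (rule K_mult[OF Z _ R1]) (simp only: R_def \<W>)
      show "cmod (Z \<omega> * of_real (R k \<omega>)) \<le> b" if "\<omega> \<in> space M" for k \<omega>
        using mult_mono[OF b[OF that] R1[of k \<omega>]] order_trans[OF norm_ge_zero b[OF that]]
        by (simp add: norm_mult)
      show "(\<lambda>k. Z \<omega> * of_real (R k \<omega>)) \<longlonglongrightarrow> Z \<omega> * indicator {\<omega> \<in> space M. a < f \<omega>} \<omega>"
        if "\<omega> \<in> space M" for \<omega>
      proof -
        have "complex_of_real (indicator A \<omega>) = indicator A \<omega>" for A
          by (simp add: indicator_def)
        with tendsto_mult_left[OF tendsto_of_real[OF lim[OF that]], of "Z \<omega>"] show ?thesis by metis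
      qed
    qed
  qed
  then show ?thesis by (simp add: \<P>_def)
qed

text \<open>The half-line events of all \<open>X h\<close> generate the sigma-algebra of
  \<open>X\<close> inside \<open>\<P>\<close>. Applying their indicators to the constant 1 in
  \<open>K\<close> gives convergence for them; null sets, linear combinations and bounded pointwise
  limits then lead to \<open>Z\<close>.\<close>

lemma conv_bounded:
  fixes X :: "'c \<Rightarrow> 'a \<Rightarrow> real"
  assumes gen: "completion_of_generated M X" and X: "\<And>h. X h \<in> borel_measurable M"
    and \<W>: "\<And>h s a b c. (\<lambda>\<omega>. s * (1 / 2 + arctan (b * (X h \<omega> - a) - c) / pi)) \<in> \<W>"
    and Z [measurable]: "Z \<in> borel_measurable M" and c: "\<And>\<omega>. \<bar>Z \<omega>\<bar> \<le> c"
  shows "conv (\<lambda>\<omega>. complex_of_real (Z \<omega>))"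
proof -
  have setsP: "sets (sigma (space M) \<P>) = \<P>"
    by (rule sigma_algebra.sets_measure_of_eq[OF sigma_algebra_\<P>])
  have "X h \<in> borel_measurable (sigma (space M) \<P>)" for h
    unfolding borel_measurable_iff_greater setsP
    using halfline_\<P>[OF X \<W>] by (simp add: space_measure_of_conv)
  from measurable_sets[OF this]
  have "X h -` B \<inter> space M \<in> \<P>" if "B \<in> sets borel" for h B
    using that by (simp add: setsP space_measure_of_conv)
  then have gP: "sigma_sets (space M) {X h -` B \<inter> space M |h B. B \<in> sets borel} \<subseteq> \<P>"
    by (intro sigma_algebra.sigma_sets_subset[OF sigma_algebra_\<P>]) blast
  have ind: "bounded_rv (indicator A)" if "A \<in> sets M" for A
    using that by (auto simp: bounded_rv_def indicator_def intro!: exI[of _ 1])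
  have conv_ind: "conv (indicator A)" if A: "A \<in> sets M" for A
  proof -
    obtain B where B: "B \<in> sets (generated_sigma M X)" "B \<in> sets M" "AE \<omega> in M. \<omega> \<in> A \<longleftrightarrow> \<omega> \<in> B"
      using completion_of_generatedE[OF gen X A] by blast
    have "{X h -` B \<inter> space M |h B. B \<in> sets borel} \<subseteq> Pow (space M)" by blast
    then have "B \<in> \<P>"
      using B(1) gP unfolding generated_sigma_def by (auto simp: sets_measure_of)
    then have "(\<lambda>\<omega>. 1 * indicator B \<omega>) \<in> K"
      using K_one by (simp only: \<P>_def mem_Collect_eq)
    then have "conv (indicator B)" using K_conv by simp
    moreover have "AE \<omega> in M. indicator B \<omega> = (indicator A \<omega> :: complex)"
      using B(3) by eventually_elim (auto simp: indicator_def)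
    ultimately show ?thesis using conv_AE[OF ind[OF B(2)] ind[OF A]] by blast
  qed
  have conv_simple: "conv (\<lambda>\<omega>. complex_of_real (f \<omega>))" if f: "simple_function M f" for f :: "'a \<Rightarrow> real"
  proof -
    let ?I = "\<lambda>y. indicator (f -` {y} \<inter> space M)"
    have sets: "f -` {y} \<inter> space M \<in> sets M" for y
      using f by (rule simple_functionD)
    have "finite (f ` space M)" using f by (rule simple_functionD)
    then have "bounded_rv (\<lambda>\<omega>. \<Sum>y\<in>f ` space M. of_real y * ?I y \<omega>) \<and>
        conv (\<lambda>\<omega>. \<Sum>y\<in>f ` space M. of_real y * ?I y \<omega>)"
    proof (induction rule: finite_induct)
      case empty
      then show ?case using bounded_rv_const[of 0] by (simp add: conv_def)
    next
      case (insert y Y)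
      have y: "bounded_rv (\<lambda>\<omega>. of_real y * ?I y \<omega>)" "conv (\<lambda>\<omega>. of_real y * ?I y \<omega>)"
        by (intro bounded_rv_mult bounded_rv_const ind sets conv_cmult conv_ind)+
      note Y = insert.IH[THEN conjunct1] insert.IH[THEN conjunct2]
      show ?case
        unfolding sum.insert[OF insert.hyps]
        by (rule conjI[OF bounded_rv_add[OF y(1) Y(1)] conv_add[OF y(1) Y(1) y(2) Y(2)]])
    qed
    moreover have "AE \<omega> in M. (\<Sum>y\<in>f ` space M. of_real y * ?I y \<omega>) = complex_of_real (f \<omega>)"
    proof (rule AE_I2)
      fix \<omega> assume "\<omega> \<in> space M"
      from arg_cong[OF simple_function_indicator_representation_banach[OF f this], of complex_of_real]
      have "complex_of_real (f \<omega>) = of_real (\<Sum>y\<in>f ` space M. ?I y \<omega> *\<^sub>R y)" .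
      also have "\<dots> = (\<Sum>y\<in>f ` space M. of_real y * ?I y \<omega>)"
        unfolding of_real_sum by (intro sum.cong refl) (simp add: indicator_def)
      finally show "(\<Sum>y\<in>f ` space M. of_real y * ?I y \<omega>) = complex_of_real (f \<omega>)" by (rule sym)
    qed
    moreover have "bounded_rv (\<lambda>\<omega>. complex_of_real (f \<omega>))"
    proof -
      have "finite ((\<lambda>\<omega>. \<bar>f \<omega>\<bar>) ` space M)"
        using finite_imageI[OF simple_functionD(1)[OF f], of abs] by (simp add: image_image)
      then have "\<forall>\<omega>\<in>space M. cmod (complex_of_real (f \<omega>)) \<le> Max ((\<lambda>\<omega>. \<bar>f \<omega>\<bar>) ` space M)"
        by auto
      then show ?thesis
        using borel_measurable_simple_function[OF f] by (auto simp: bounded_rv_def)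
    qed
    ultimately show ?thesis by (elim conjE) (rule conv_AE)
  qed
  obtain s where s: "\<And>i. simple_function M (s i)"
    "\<And>\<omega>. \<omega> \<in> space M \<Longrightarrow> (\<lambda>i. s i \<omega>) \<longlonglongrightarrow> Z \<omega>"
    "\<And>i \<omega>. \<omega> \<in> space M \<Longrightarrow> dist (s i \<omega>) 0 \<le> 2 * dist (Z \<omega>) 0"
    using borel_measurable_implies_sequence_metric[OF Z, of 0] by blast
  show ?thesis
  proof (rule conv_limit[where Zk="\<lambda>i \<omega>. complex_of_real (s i \<omega>)" and c="2 * c"])
    show "(\<lambda>\<omega>. complex_of_real (s i \<omega>)) \<in> borel_measurable M" for i
      using borel_measurable_simple_function[OF s(1)] by measurable
    show "cmod (complex_of_real (s i \<omega>)) \<le> 2 * c" if "\<omega> \<in> space M" for i \<omega>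
      using s(3)[OF that, of i] c[of \<omega>] by simp
    show "(\<lambda>i. complex_of_real (s i \<omega>)) \<longlonglongrightarrow> complex_of_real (Z \<omega>)" if "\<omega> \<in> space M" for \<omega>
      by (intro tendsto_of_real s that)
  qed (rule conv_simple[OF s(1)])
qed

end

section \<open>Transfer to the extended space and the two conclusions\<close>

text \<open>The square root of \<open>V\<close> is |S|, which equals \<open>S\<close> almost surely
  by the sign condition; the null set lifts to \<open>M'\<close> because \<open>\<pi>\<close>
  preserves the measure. The joint law then converts the integral over the product.\<close>

lemma (in gaussian_interpolation) bound_on_extension:
  fixes M' :: "'b measure" and \<pi> :: "'b \<Rightarrow> 'a" and \<eta> :: "'b \<Rightarrow> real"
  assumes \<pi> [measurable]: "\<pi> \<in> measurable M' M" and distr_\<pi>: "distr M' M \<pi> = M"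
    and \<eta> [measurable]: "\<eta> \<in> borel_measurable M'"
    and pair: "distr M' Q (\<lambda>\<omega>. (\<pi> \<omega>, \<eta> \<omega>)) = Q"
    and S [measurable]: "S \<in> borel_measurable M" and S_nonneg: "AE \<omega> in M. 0 \<le> S \<omega>"
    and V_eq: "\<And>\<omega>. V \<omega> = (S \<omega>)\<^sup>2"
  shows "\<bar>(\<integral>\<omega>. \<phi> (W \<omega> + F \<omega>) \<partial>M) - (\<integral>\<omega>. \<phi> (W (\<pi> \<omega>) + S (\<pi> \<omega>) * \<eta> \<omega>) \<partial>M')\<bar> \<le>
    B2 * EW + B2 / 2 * (\<integral>\<omega>. \<bar>DF \<omega> \<bullet> u \<omega> - V \<omega>\<bar> \<partial>M) + B3 / 3 * EV"
proof -
  have "AE \<omega> in distr M' M \<pi>. 0 \<le> S \<omega>" unfolding distr_\<pi> by (rule S_nonneg)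
  then have "AE \<omega> in M'. 0 \<le> S (\<pi> \<omega>)" by (rule AE_distrD[OF \<pi>])
  then have "AE \<omega> in M'. \<phi> (W (\<pi> \<omega>) + S (\<pi> \<omega>) * \<eta> \<omega>) = \<phi> (W (\<pi> \<omega>) + sqrt (V (\<pi> \<omega>)) * \<eta> \<omega>)"
    by eventually_elim (simp add: V_eq)
  then have "(\<integral>\<omega>. \<phi> (W (\<pi> \<omega>) + S (\<pi> \<omega>) * \<eta> \<omega>) \<partial>M') =
      (\<integral>\<omega>. \<phi> (W (\<pi> \<omega>) + sqrt (V (\<pi> \<omega>)) * \<eta> \<omega>) \<partial>M')"
    by (intro integral_cong_AE) auto
  also have "\<dots> = (\<integral>z. \<phi> (W (fst z) + sqrt (V (fst z)) * snd z) \<partial>distr M' Q (\<lambda>\<omega>. (\<pi> \<omega>, \<eta> \<omega>)))"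
    by (subst integral_distr) auto
  finally show ?thesis
    unfolding pair using bound_without_regularization by simp
qed

lemma integral_iexp:
  assumes "prob_space N" and [measurable]: "g \<in> borel_measurable N"
  shows "(\<integral>\<omega>. iexp (g \<omega>) \<partial>N) = of_real (\<integral>\<omega>. cos (g \<omega>) \<partial>N) + \<i> * of_real (\<integral>\<omega>. sin (g \<omega>) \<partial>N)"
proof -
  interpret prob_space N by fact
  have "integrable N (\<lambda>\<omega>. cos (g \<omega>))" "integrable N (\<lambda>\<omega>. sin (g \<omega>))"
    by (rule integrable_const_bound[where B=1]; simp)+
  moreover have "iexp (g \<omega>) = of_real (cos (g \<omega>)) + \<i> * of_real (sin (g \<omega>))" for \<omega>
    by (simp add: exp_Euler cos_of_real sin_of_real)
  ultimately show ?thesis by simp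
qed

lemma tendsto_Lp1D:
  fixes Y :: "nat \<Rightarrow> 'a \<Rightarrow> real"
  assumes "tendsto_Lp 1 M Y L"
  shows "(\<lambda>n. \<integral>\<omega>. \<bar>Y n \<omega> - L \<omega>\<bar> \<partial>M) \<longlonglongrightarrow> 0" "integrable M (\<lambda>\<omega>. \<bar>Y n \<omega>\<bar>)"
  using assms by (simp_all add: tendsto_Lp_def Lp_def)

lemma malliavin_D_works:
  assumes "F \<in> D12 M X"
  shows "has_malliavin_deriv M X F (malliavin_D M X F)"
  using assms someI_ex[of "has_malliavin_deriv M X F"] unfolding D12_def malliavin_D_def by blast

theorem corollary3p2:
  fixes M :: "'a measure" and M' :: "'b measure" and \<pi> :: "'b \<Rightarrow> 'a"
    and X :: "'h::{real_inner, banach, second_countable_topology} \<Rightarrow> 'a \<Rightarrow> real"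
    and S :: "'a \<Rightarrow> real" and \<eta> :: "'b \<Rightarrow> real"
    and F :: "nat \<Rightarrow> 'a \<Rightarrow> real" and u :: "nat \<Rightarrow> 'a \<Rightarrow> 'h"
  assumes infinite_dim: "\<nexists>B :: 'h set. finite B \<and> span B = UNIV"
    and prob: "prob_space M"
    and isonormal: "isonormal_process M X"
    and generated: "completion_of_generated M X"
    and S_meas: "S \<in> borel_measurable M"
    and S_nonneg: "AE \<omega> in M. 0 \<le> S \<omega>"
    and S_D12: "(\<lambda>\<omega>. (S \<omega>)\<^sup>2) \<in> D12 M X"
    and ext: "extension_of M' \<pi> M"
    and eta_normal: "distributed M' lborel \<eta> (\<lambda>x. ennreal (std_normal_density x))"
    and eta_indep: "prob_space.indep_set M'
                      (sets (generated_sigma M' (\<lambda>h \<omega>. X h (\<pi> \<omega>))))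
                      {\<eta> -` A \<inter> space M' | A. A \<in> sets borel}"
    and F_D12: "\<And>n. F n \<in> D12 M X"
    and F_mean: "\<And>n. (\<integral>\<omega>. F n \<omega> \<partial>M) = 0"
    and u_D12: "\<And>n. u n \<in> D12_vec M X"
    and F_div: "\<And>n. has_divergence M X (u n) (F n)"
    and cond1: "tendsto_Lp 1 M (\<lambda>n \<omega>. u n \<omega> \<bullet> malliavin_D M X (F n) \<omega>) (\<lambda>\<omega>. (S \<omega>)\<^sup>2)"
    and cond2: "\<And>h. tendsto_Lp 1 M (\<lambda>n \<omega>. u n \<omega> \<bullet> h) (\<lambda>_. 0)"
    and cond3: "tendsto_Lp 1 M (\<lambda>n \<omega>. u n \<omega> \<bullet> malliavin_D M X (\<lambda>\<omega>. (S \<omega>)\<^sup>2) \<omega>) (\<lambda>_. 0)"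
  shows "converges_stably M F M' \<pi> (\<lambda>\<omega>. S (\<pi> \<omega>) * \<eta> \<omega>) \<and>
    (\<forall>\<phi>. class_C 3 \<phi> \<and> bounded (range ((deriv ^^ 2) \<phi>)) \<and> bounded (range ((deriv ^^ 3) \<phi>)) \<longrightarrow>
      (\<forall>n. \<bar>(\<integral>\<omega>. \<phi> (F n \<omega>) \<partial>M) - (\<integral>\<omega>. \<phi> (S (\<pi> \<omega>) * \<eta> \<omega>) \<partial>M')\<bar>
         \<le> 1 / 2 * sup_norm ((deriv ^^ 2) \<phi>)
             * (\<integral>\<omega>. \<bar>u n \<omega> \<bullet> malliavin_D M X (F n) \<omega> - (S \<omega>)\<^sup>2\<bar> \<partial>M)
           + 1 / 3 * sup_norm ((deriv ^^ 3) \<phi>)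
             * (\<integral>\<omega>. \<bar>u n \<omega> \<bullet> malliavin_D M X (\<lambda>\<omega>. (S \<omega>)\<^sup>2) \<omega>\<bar> \<partial>M)))"
proof -
  interpret M: prob_space M by (rule prob)
  interpret M': prob_space M' using ext by (simp add: extension_of_def)
  have X[measurable]: "X h \<in> borel_measurable M" for h
    using isonormal by (simp add: isonormal_process_def)
  have \<pi>[measurable]: "\<pi> \<in> measurable M' M" and d\<pi>: "distr M' M \<pi> = M"
    using ext by (auto simp: extension_of_def)
  have \<eta>[measurable]: "\<eta> \<in> borel_measurable M'"
    using distributed_measurable[OF eta_normal] by simp
  note S_meas[measurable]
  note pair = distr_extension_pair[OF prob generated X ext eta_normal eta_indep]
  note F = malliavin_D_works[OF F_D12] and V = malliavin_D_works[OF S_D12]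
  have F_meas[measurable]: "F n \<in> borel_measurable M" for n
    using Lp2D(1)[OF has_malliavin_derivD(1)[OF F]] .
  have u: "u n \<in> Lp 2 M" for n
    using F_div by (simp add: has_divergence_def)
  let ?A = "\<lambda>n. \<integral>\<omega>. \<bar>u n \<omega> \<bullet> malliavin_D M X (F n) \<omega> - (S \<omega>)\<^sup>2\<bar> \<partial>M"
  let ?C = "\<lambda>n. \<integral>\<omega>. \<bar>u n \<omega> \<bullet> malliavin_D M X (\<lambda>\<omega>. (S \<omega>)\<^sup>2) \<omega>\<bar> \<partial>M"
  have bound: "\<bar>(\<integral>\<omega>. \<phi> (W \<omega> + F n \<omega>) \<partial>M) - (\<integral>\<omega>. \<phi> (W (\<pi> \<omega>) + S (\<pi> \<omega>) * \<eta> \<omega>) \<partial>M')\<bar> \<le>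
      B2 * (\<integral>\<omega>. \<bar>DW \<omega> \<bullet> u n \<omega>\<bar> \<partial>M) + B2 / 2 * ?A n + B3 / 3 * ?C n"
    if "has_malliavin_deriv M X W DW"
      "\<And>x. (\<phi> has_real_derivative \<phi>1 x) (at x)" "\<And>x. (\<phi>1 has_real_derivative \<phi>2 x) (at x)"
      "\<And>x. (\<phi>2 has_real_derivative \<phi>3 x) (at x)" "continuous_on UNIV \<phi>3"
      "\<And>x. \<bar>\<phi>2 x\<bar> \<le> B2" "\<And>x. \<bar>\<phi>3 x\<bar> \<le> B3" for W DW \<phi> \<phi>1 \<phi>2 \<phi>3 B2 B3 n
  proof -
    \<comment> \<open>The regularization parameter 1 is an arbitrary choice; the resulting bound
      does not contain it.\<close>
    interpret gaussian_interpolation M X "F n" "\<lambda>\<omega>. (S \<omega>)\<^sup>2" W "malliavin_D M X (F n)"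
      "malliavin_D M X (\<lambda>\<omega>. (S \<omega>)\<^sup>2)" DW "u n" \<phi> \<phi>1 \<phi>2 \<phi>3 B2 B3 1
      by unfold_locales (use F V F_div that in auto)
    show ?thesis
      using bound_on_extension[OF \<pi> d\<pi> \<eta> pair S_meas S_nonneg]
      by (simp add: inner_commute[of "u n _" "malliavin_D _ _ _ _"])
  qed
  have zero: "has_malliavin_deriv M X (\<lambda>_. 0) (\<lambda>_. 0)"
    using has_malliavin_deriv_lincomb[OF V V, of 0 0] by simp
  have "converges_stably M F M' \<pi> (\<lambda>\<omega>. S (\<pi> \<omega>) * \<eta> \<omega>)"
    unfolding converges_stably_def
  proof (intro allI ballI impI)
    fix t :: real and Z :: "'a \<Rightarrow> real" assume Z[measurable]: "Z \<in> borel_measurable M" and "\<exists>c. \<forall>\<omega>. \<bar>Z \<omega>\<bar> \<le> c"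
    then obtain c where c: "\<And>\<omega>. \<bar>Z \<omega>\<bar> \<le> c" by blast
    show "(\<lambda>n. \<integral>\<omega>. complex_of_real (Z \<omega>) * iexp (t * F n \<omega>) \<partial>M)
        \<longlonglongrightarrow> (\<integral>\<omega>. complex_of_real (Z (\<pi> \<omega>)) * iexp (t * (S (\<pi> \<omega>) * \<eta> \<omega>)) \<partial>M')"
    \<comment> \<open>The rescaling in the other case divides by \<open>t\<close>. For
      \<open>t = 0\<close> both sides are the expectation of \<open>Z\<close>, since
      \<open>\<pi>\<close> preserves the measure.\<close>
    proof (cases "t = 0")
      case True
      have "(\<integral>\<omega>. complex_of_real (Z \<omega>) \<partial>distr M' M \<pi>) = (\<integral>\<omega>. complex_of_real (Z (\<pi> \<omega>)) \<partial>M')"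
        by (rule integral_distr[OF \<pi>]) measurable
      then show ?thesis unfolding d\<pi> using True by simp
    next
      case False
      define \<W> where "\<W> = {W. \<exists>DW. has_malliavin_deriv M X W DW \<and>
        (\<lambda>n. \<integral>\<omega>. \<bar>DW \<omega> \<bullet> u n \<omega>\<bar> \<partial>M) \<longlonglongrightarrow> 0}"
      \<comment> \<open>Cosine and sine are treated together through g'' = -g, with \<open>g\<close>
        and g' bounded by 1.\<close>
      have trig: "(\<lambda>n. \<integral>\<omega>. g (W \<omega> + t * F n \<omega>) \<partial>M) \<longlonglongrightarrow>
          (\<integral>\<omega>. g (W (\<pi> \<omega>) + t * (S (\<pi> \<omega>) * \<eta> \<omega>)) \<partial>M')"
        if W: "W \<in> \<W>"
          and g: "\<And>x. (g has_real_derivative g' x) (at x)" "\<And>x. (g' has_real_derivative - g x) (at x)"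
            "\<And>x. \<bar>g x\<bar> \<le> 1" "\<And>x. \<bar>g' x\<bar> \<le> 1" for W and g g' :: "real \<Rightarrow> real"
      proof -
        obtain DW where DW: "has_malliavin_deriv M X W DW"
          and lim: "(\<lambda>n. \<integral>\<omega>. \<bar>DW \<omega> \<bullet> u n \<omega>\<bar> \<partial>M) \<longlonglongrightarrow> 0"
          using W by (auto simp: \<W>_def)
        \<comment> \<open>For \<phi>(x) = g(t x) the exponent W/t gives \<phi>(W/t + F_n) = g(W + t
          F_n); the price is the bounds t^2 and |t|^3 on the second and third derivatives.\<close>
        have W': "has_malliavin_deriv M X (\<lambda>\<omega>. W \<omega> / t) (\<lambda>\<omega>. (1 / t) *\<^sub>R DW \<omega>)"
          using has_malliavin_deriv_lincomb[OF DW zero, of "1 / t" 0] by simp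
        have scaled: "((\<lambda>x. a * f (t * x)) has_real_derivative (a * t) * f' (t * x)) (at x)"
          if "\<And>x. (f has_real_derivative f' x) (at x)" for a f f' x
          using DERIV_cmult[OF DERIV_chain2[OF that DERIV_cmult_Id], of a t x]
          by (simp add: mult_ac)
        have d3: "((\<lambda>x. - (t * t) * g (t * x)) has_real_derivative (- (t * t) * t) * g' (t * x)) (at x)" for x
          by (rule scaled[OF g(1)])
        have d2: "((\<lambda>x. t * g' (t * x)) has_real_derivative - (t * t) * g (t * x)) (at x)" for x
          using scaled[OF g(2), of t x] by simp
        have d1: "((\<lambda>x. g (t * x)) has_real_derivative t * g' (t * x)) (at x)" for x
          using scaled[OF g(1), of 1 x] by simp
        have "continuous_on UNIV g'"
          by (rule DERIV_continuous_on, rule has_field_derivative_at_within, rule g(2))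
        then have "continuous_on UNIV (\<lambda>x. g' (t * x))"
          by (rule continuous_on_compose2[where f="\<lambda>x. t * x"]) (auto intro!: continuous_intros)
        then have c3: "continuous_on UNIV (\<lambda>x. (- (t * t) * t) * g' (t * x))"
          by (intro continuous_on_mult continuous_on_const)
        have b2: "\<bar>- (t * t) * g (t * x)\<bar> \<le> t * t" for x
          using mult_left_mono[OF g(3)[of "t * x"], of "t * t"] by (simp add: abs_mult)
        have b3: "\<bar>(- (t * t) * t) * g' (t * x)\<bar> \<le> t * t * \<bar>t\<bar>" for x
          using mult_left_mono[OF g(4)[of "t * x"], of "t * t * \<bar>t\<bar>"] by (simp add: abs_mult)
        let ?r = "\<lambda>n. t * t * (\<bar>1 / t\<bar> * (\<integral>\<omega>. \<bar>DW \<omega> \<bullet> u n \<omega>\<bar> \<partial>M)) + t * t / 2 * ?A n + t * t * \<bar>t\<bar> / 3 * ?C n"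
        have le: "norm ((\<integral>\<omega>. g (W \<omega> + t * F n \<omega>) \<partial>M) - (\<integral>\<omega>. g (W (\<pi> \<omega>) + t * (S (\<pi> \<omega>) * \<eta> \<omega>)) \<partial>M')) \<le> ?r n" for n
          using bound[OF W' d1 d2 d3 c3 b2 b3, of n] False by (simp add: distrib_left abs_mult)
        have "?r \<longlonglongrightarrow> t * t * (\<bar>1 / t\<bar> * 0) + t * t / 2 * 0 + t * t * \<bar>t\<bar> / 3 * 0"
          using tendsto_Lp1D(1)[OF cond1] tendsto_Lp1D(1)[OF cond3] by (intro tendsto_intros lim) auto
        then have r: "?r \<longlonglongrightarrow> 0" by (simp only: mult_zero_right add_0_right)
        have "(\<lambda>n. (\<integral>\<omega>. g (W \<omega> + t * F n \<omega>) \<partial>M) - (\<integral>\<omega>. g (W (\<pi> \<omega>) + t * (S (\<pi> \<omega>) * \<eta> \<omega>)) \<partial>M')) \<longlonglongrightarrow> 0"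
          by (rule Lim_null_comparison[OF always_eventually[OF allI[OF le]] r])
        then show ?thesis by (simp add: LIM_zero_iff)
      qed
      have W_meas: "W \<in> borel_measurable M" if "W \<in> \<W>" for W
        using that Lp2D(1)[OF has_malliavin_derivD(1)] by (auto simp: \<W>_def)
      interpret stable_testing M M' \<pi> "\<lambda>n \<omega>. iexp (t * F n \<omega>)" "\<lambda>\<omega>. iexp (t * (S (\<pi> \<omega>) * \<eta> \<omega>))" \<W>
      proof
        show "(\<lambda>_. 0) \<in> \<W>" using zero by (auto simp: \<W>_def intro!: exI[of _ "\<lambda>_. 0"])
        show "(\<lambda>\<omega>. W \<omega> + W' \<omega>) \<in> \<W>" if WW: "W \<in> \<W>" "W' \<in> \<W>" for W W'
        proof -
          obtain DW DW' where D: "has_malliavin_deriv M X W DW" "has_malliavin_deriv M X W' DW'"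
            and lim: "(\<lambda>n. \<integral>\<omega>. \<bar>DW \<omega> \<bullet> u n \<omega>\<bar> \<partial>M) \<longlonglongrightarrow> 0" "(\<lambda>n. \<integral>\<omega>. \<bar>DW' \<omega> \<bullet> u n \<omega>\<bar> \<partial>M) \<longlonglongrightarrow> 0"
            using WW by (auto simp: \<W>_def)
          have "has_malliavin_deriv M X (\<lambda>\<omega>. W \<omega> + W' \<omega>) (\<lambda>\<omega>. DW \<omega> + DW' \<omega>)"
            using has_malliavin_deriv_lincomb[OF D, of 1 1] by simp
          moreover have "(\<lambda>n. \<integral>\<omega>. \<bar>(DW \<omega> + DW' \<omega>) \<bullet> u n \<omega>\<bar> \<partial>M) \<longlonglongrightarrow> 0"
          proof (rule tendsto_sandwich[OF _ _ tendsto_const])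
            have "(\<integral>\<omega>. \<bar>(DW \<omega> + DW' \<omega>) \<bullet> u n \<omega>\<bar> \<partial>M) \<le>
                (\<integral>\<omega>. \<bar>DW \<omega> \<bullet> u n \<omega>\<bar> \<partial>M) + (\<integral>\<omega>. \<bar>DW' \<omega> \<bullet> u n \<omega>\<bar> \<partial>M)" for n
            proof -
              have i: "integrable M (\<lambda>\<omega>. \<bar>DW \<omega> \<bullet> u n \<omega>\<bar>)" "integrable M (\<lambda>\<omega>. \<bar>DW' \<omega> \<bullet> u n \<omega>\<bar>)"
                using Lp2_inner_integrable[OF has_malliavin_derivD(2)[OF D(1)] u]
                  Lp2_inner_integrable[OF has_malliavin_derivD(2)[OF D(2)] u] by simp_all
              have "(\<integral>\<omega>. \<bar>(DW \<omega> + DW' \<omega>) \<bullet> u n \<omega>\<bar> \<partial>M) \<le> (\<integral>\<omega>. \<bar>DW \<omega> \<bullet> u n \<omega>\<bar> + \<bar>DW' \<omega> \<bullet> u n \<omega>\<bar> \<partial>M)"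
                using i by (intro integral_mono') (auto simp: inner_add_left)
              then show ?thesis using i by simp
            qed
            then show "\<forall>\<^sub>F n in sequentially. (\<integral>\<omega>. \<bar>(DW \<omega> + DW' \<omega>) \<bullet> u n \<omega>\<bar> \<partial>M) \<le>
                (\<integral>\<omega>. \<bar>DW \<omega> \<bullet> u n \<omega>\<bar> \<partial>M) + (\<integral>\<omega>. \<bar>DW' \<omega> \<bullet> u n \<omega>\<bar> \<partial>M)" by simp
            show "(\<lambda>n. (\<integral>\<omega>. \<bar>DW \<omega> \<bullet> u n \<omega>\<bar> \<partial>M) + (\<integral>\<omega>. \<bar>DW' \<omega> \<bullet> u n \<omega>\<bar> \<partial>M)) \<longlonglongrightarrow> 0"
              using tendsto_add[OF lim] by simp
          qed simp
          ultimately show ?thesis by (auto simp: \<W>_def)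
        qed
        show "(\<lambda>n. \<integral>\<omega>. iexp (W \<omega>) * iexp (t * F n \<omega>) \<partial>M) \<longlonglongrightarrow>
            (\<integral>\<omega>. iexp (W (\<pi> \<omega>)) * iexp (t * (S (\<pi> \<omega>) * \<eta> \<omega>)) \<partial>M')" if W: "W \<in> \<W>" for W
        proof -
          note [measurable] = W_meas[OF W]
          have cos: "(\<lambda>n. \<integral>\<omega>. cos (W \<omega> + t * F n \<omega>) \<partial>M) \<longlonglongrightarrow> (\<integral>\<omega>. cos (W (\<pi> \<omega>) + t * (S (\<pi> \<omega>) * \<eta> \<omega>)) \<partial>M')"
            by (rule trig[of W cos "\<lambda>x. - sin x", OF W]) (auto intro!: derivative_eq_intros)
          have sin: "(\<lambda>n. \<integral>\<omega>. sin (W \<omega> + t * F n \<omega>) \<partial>M) \<longlonglongrightarrow> (\<integral>\<omega>. sin (W (\<pi> \<omega>) + t * (S (\<pi> \<omega>) * \<eta> \<omega>)) \<partial>M')"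
            by (rule trig[of W sin cos, OF W]) (auto intro!: derivative_eq_intros)
          have mult: "iexp x * iexp y = iexp (x + y)" for x y
            by (simp add: distrib_left exp_add)
          have "(\<lambda>n. \<integral>\<omega>. iexp (W \<omega> + t * F n \<omega>) \<partial>M) \<longlonglongrightarrow>
              (\<integral>\<omega>. iexp (W (\<pi> \<omega>) + t * (S (\<pi> \<omega>) * \<eta> \<omega>)) \<partial>M')"
            by (subst (1 2) integral_iexp) (auto intro!: prob M'.prob_space_axioms tendsto_intros cos sin)
          then show ?thesis unfolding mult .
        qed
      qed (auto simp: d\<pi> W_meas)
      have "conv (\<lambda>\<omega>. complex_of_real (Z \<omega>))"
      proof (rule conv_bounded[OF generated X _ Z c])
        fix h s a b c
        \<comment> \<open>The derivative of a sigmoid of \<open>X h\<close> is a bounded random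
          multiple of the fixed direction \<open>h\<close>, so the second condition makes its inner
          product with \<open>u n\<close> vanish in L^1.\<close>
        let ?\<rho> = "\<lambda>x. s * (1 / 2 + arctan (b * (x - a) - c) / pi)"
        let ?\<rho>' = "\<lambda>x. s * b / pi * inverse (1 + (b * (x - a) - c)\<^sup>2)"
        have pos: "1 + (b * (x - a) - c)\<^sup>2 \<noteq> 0" for x
          by (simp add: add_nonneg_eq_0_iff)
        have le: "\<bar>?\<rho>' x\<bar> \<le> \<bar>s * b / pi\<bar>" for x
        proof -
          have "\<bar>inverse (1 + (b * (x - a) - c)\<^sup>2)\<bar> \<le> 1"
            by (simp add: inverse_le_1_iff abs_of_nonneg add_nonneg_nonneg)
          from mult_left_mono[OF this, of "\<bar>s * b / pi\<bar>"] show ?thesis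
            by (simp only: abs_mult[symmetric]) simp
        qed
        have "has_malliavin_deriv M X (\<lambda>\<omega>. ?\<rho> (X h \<omega>)) (\<lambda>\<omega>. ?\<rho>' (X h \<omega>) *\<^sub>R h)"
        proof (rule has_malliavin_deriv_chain[OF has_malliavin_deriv_isonormal[OF prob isonormal] prob _ _ le])
          show "(?\<rho> has_real_derivative ?\<rho>' x) (at x)" for x
          proof -
            have "((\<lambda>x. b * (x - a) - c) has_real_derivative b) (at x)"
              by (auto intro!: derivative_eq_intros)
            from DERIV_cmult[OF DERIV_add[OF DERIV_const DERIV_cdivide[OF DERIV_chain2[OF DERIV_arctan this]]]]
            show ?thesis by (rule DERIV_cong) (simp add: divide_inverse mult_ac)
          qed
          show "continuous_on UNIV ?\<rho>'"
            using pos by (intro continuous_intros) auto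
        qed
        moreover have "(\<lambda>n. \<integral>\<omega>. \<bar>(?\<rho>' (X h \<omega>) *\<^sub>R h) \<bullet> u n \<omega>\<bar> \<partial>M) \<longlonglongrightarrow> 0"
        proof (rule tendsto_sandwich[OF _ _ tendsto_const])
          have "(\<integral>\<omega>. \<bar>(?\<rho>' (X h \<omega>) *\<^sub>R h) \<bullet> u n \<omega>\<bar> \<partial>M) \<le> (\<integral>\<omega>. \<bar>s * b / pi\<bar> * \<bar>u n \<omega> \<bullet> h\<bar> \<partial>M)" for n
          proof (rule integral_mono')
            show "integrable M (\<lambda>\<omega>. \<bar>s * b / pi\<bar> * \<bar>u n \<omega> \<bullet> h\<bar>)"
              using tendsto_Lp1D(2)[OF cond2] by simp
            show "\<bar>(?\<rho>' (X h \<omega>) *\<^sub>R h) \<bullet> u n \<omega>\<bar> \<le> \<bar>s * b / pi\<bar> * \<bar>u n \<omega> \<bullet> h\<bar>" for \<omega>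
              unfolding inner_scaleR_left abs_mult[of "?\<rho>' _"] inner_commute[of h]
              by (rule mult_right_mono[OF le]) simp
          qed simp
          then show "\<forall>\<^sub>F n in sequentially. (\<integral>\<omega>. \<bar>(?\<rho>' (X h \<omega>) *\<^sub>R h) \<bullet> u n \<omega>\<bar> \<partial>M) \<le>
              \<bar>s * b / pi\<bar> * (\<integral>\<omega>. \<bar>u n \<omega> \<bullet> h\<bar> \<partial>M)" by simp
          show "(\<lambda>n. \<bar>s * b / pi\<bar> * (\<integral>\<omega>. \<bar>u n \<omega> \<bullet> h\<bar> \<partial>M)) \<longlonglongrightarrow> 0"
            using tendsto_mult_left[OF tendsto_Lp1D(1)[OF cond2[of h]], of "\<bar>s * b / pi\<bar>"] by simp
        qed simp
        ultimately show "(\<lambda>\<omega>. ?\<rho> (X h \<omega>)) \<in> \<W>"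
          unfolding \<W>_def by blast
      qed
      then show ?thesis unfolding conv_def .
    qed
  qed
  moreover have "\<bar>(\<integral>\<omega>. \<phi> (F n \<omega>) \<partial>M) - (\<integral>\<omega>. \<phi> (S (\<pi> \<omega>) * \<eta> \<omega>) \<partial>M')\<bar>
      \<le> 1 / 2 * sup_norm ((deriv ^^ 2) \<phi>) * ?A n + 1 / 3 * sup_norm ((deriv ^^ 3) \<phi>) * ?C n"
    if C: "class_C 3 \<phi>" and b2: "bounded (range ((deriv ^^ 2) \<phi>))" and b3: "bounded (range ((deriv ^^ 3) \<phi>))"
    for \<phi> n
  proof -
    have d: "((deriv ^^ j) \<phi> has_real_derivative (deriv ^^ Suc j) \<phi> x) (at x)" if "j < 3" for j x
      using C that by (simp add: class_C_def DERIV_deriv_iff_real_differentiable)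
    have sup: "\<bar>f x\<bar> \<le> sup_norm f" if "bounded (range f)" for f :: "real \<Rightarrow> real" and x
    proof -
      have "bdd_above (range (\<lambda>x. \<bar>f x\<bar>))"
        using that unfolding bounded_iff bdd_above_def by auto
      then show ?thesis unfolding sup_norm_def by (intro cSUP_upper) auto
    qed
    \<comment> \<open>The exponent and its derivative are both 0 here, so the first term of
      \<open>bound\<close> drops out and only the two terms of the claim remain.\<close>
    have "\<bar>(\<integral>\<omega>. \<phi> (0 + F n \<omega>) \<partial>M) - (\<integral>\<omega>. \<phi> (0 + S (\<pi> \<omega>) * \<eta> \<omega>) \<partial>M')\<bar> \<le>
        sup_norm ((deriv ^^ 2) \<phi>) * (\<integral>\<omega>. \<bar>0 \<bullet> u n \<omega>\<bar> \<partial>M) + sup_norm ((deriv ^^ 2) \<phi>) / 2 * ?A n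
        + sup_norm ((deriv ^^ 3) \<phi>) / 3 * ?C n"
    proof (rule bound[OF zero])
      show "(\<phi> has_real_derivative (deriv ^^ 1) \<phi> x) (at x)" for x using d[of 0 x] by simp
      show "((deriv ^^ 1) \<phi> has_real_derivative (deriv ^^ 2) \<phi> x) (at x)" for x
        using d[of 1 x] by (simp add: numeral_2_eq_2)
      show "((deriv ^^ 2) \<phi> has_real_derivative (deriv ^^ 3) \<phi> x) (at x)" for x
        using d[of 2 x] by (simp add: numeral_3_eq_3 numeral_2_eq_2)
      show "continuous_on UNIV ((deriv ^^ 3) \<phi>)" using C by (simp add: class_C_def)
    qed (rule sup[OF b2] sup[OF b3])+
    then show ?thesis by simp
  qed
  ultimately show ?thesis by blast
qed

end
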